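(* Let $\mu$ be a Radon measure on $\mathbb{R}^d$ with $\mu(B(x,r))\le C_0r^n$ for all $x\in\operatorname{supp}(\mu)$, $r>0$ ($0<n\le d$ fixed), and let $D_k=S_k-S_{k-1}$, $k\in\mathbb{Z}$, where $\{S_k\}_{k\in\mathbb{Z}}$ is the approximation of the identity constructed in the context. Then there is a constant $C>0$ such that for every $f\in L^2(\mu)$, $$C^{-1}\sum_{k\in\mathbb{Z}}\|D_kf\|_{L^2(\mu)}^2\le\|f\|_{L^2(\mu)}^2\le C\sum_{k\in\mathbb{Z}}\|D_kf\|_{L^2(\mu)}^2 .$$
   Context: **Cubes.** $\mu$ is as in the claim, with $C_0$ large enough that $\mu(Q)\le C_0\ell(Q)^n$ for all cubes. A cube is a closed cube with sides parallel to the axes centered at a point of $\operatorname{supp}(\mu)$; $\ell(Q)$ is its side length, $z_Q$ its center, $\lambda Q$ the concentric dilate. Points $x\in\operatorname{supp}(\mu)$ (with $\ell(x)=0$) and $\mathbb{R}^d$ (thought of as centered at every point of $\operatorname{supp}(\mu)$) are also admitted as cubes and regarded as doubling; cubes with $0<\ell(Q)<\infty$ are transit cubes. A transit cube is doubling if $\mu(2Q)\le2^{d+1}\mu(Q)$. $Q_R$ denotes the smallest cube concentric with $Q$ containing $Q$ and $R$, and $\delta(Q,R)=\max\big(\int_{Q_R\setminus Q}\frac{d\mu(x)}{|x-z_Q|^n},\int_{R_Q\setminus R}\frac{d\mu(x)}{|x-z_R|^n}\big)$ (for $R=\mathbb{R}^d$: $\int_{\mathbb{R}^d\setminus Q}\frac{d\mu(x)}{|x-z_Q|^n}$).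 $a=b\pm\varepsilon$ means $|a-b|\le\varepsilon$, and $a\le b\pm\varepsilon$ means $a\le b+\varepsilon$. **Parameters.** $\varepsilon_0$, depending only on $C_0,n,d$, is such that $|\delta(P,R)-\delta(P,Q)-\delta(Q,R)|\le\varepsilon_0$ for $P\subset Q\subset R$. $\varepsilon_1\ge\varepsilon_0$, depending only on $C_0,n,d$, is such that for all $\alpha$ larger than a constant $\gamma_0(C_0,n,d)$ and every transit cube $R_0$: (i) if $x\in R_0\cap\operatorname{supp}(\mu)$ and $\delta(x,2R_0)>\alpha$, there is a doubling cube $Q\subset2R_0$ centered at $x$ with $\delta(Q,2R_0)=\alpha\pm\varepsilon_1$; (ii) if $\delta(R_0,\mathbb{R}^d)>\alpha$, there is a doubling cube $S\supset R_0$ concentric with $R_0$, $\ell(S)\ge2\ell(R_0)$, $\delta(R_0,S)=\alpha\pm\varepsilon_1$. Put $\sigma=100\varepsilon_0+100\varepsilon_1+12^{n+1}C_0$, and fix $\alpha_1,\alpha_2>0$ and a positive integer $A$ with $\varepsilon_0,\varepsilon_1,C_0\ll\sigma\ll\alpha_1\ll\alpha_2\ll A$, each large enough depending on the preceding ones. **Generations.** $x\in\operatorname{supp}(\mu)$ is a stopping point (stopping cube) if $\delta(x,Q)<\infty$ for some transit cube $Q\ni x$; $\mathbb{R}^d$ is an initial cube if $\delta(Q,\mathbb{R}^d)<\infty$ for some transit cube $Q$. If $\mathbb{R}^d$ is not initial, fix a doubling transit cube $R_0$ and, for $j\ge1$, a doubling cube $R_{-j}\supset R_0$ concentric with $R_0$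 with $\delta(R_0,R_{-j})=jA\pm\varepsilon_1$. A transit cube $Q$ has generation $k\in\mathbb{Z}$ if it is doubling and $\delta(Q,R_{-j})=(j+k)A\pm\varepsilon_1$ for some $R_{-j}\supset Q$; a stopping cube $x$ has generation $k$ if $\delta(x,R_{-j})\le(j+k)A\pm\varepsilon_1$ for some $R_{-j}\ni x$. If $\mathbb{R}^d$ is initial, a doubling transit cube $Q$ has generation $k\ge1$ if $\delta(Q,\mathbb{R}^d)=kA\pm\varepsilon_1$, a stopping cube $x$ has generation $k\ge1$ if $\delta(x,\mathbb{R}^d)\le kA\pm\varepsilon_1$, and $\mathbb{R}^d$ has generation $k$ for all $k\le0$. For each $x\in\operatorname{supp}(\mu)$, $k\in\mathbb{Z}$, $Q_{x,k}$ is a fixed cube of generation $k$ centered at $x$. **Auxiliary cubes and functions.** If $Q_{y,k}$ is transit, $Q^1_{y,k},\widehat Q^1_{y,k},Q^2_{y,k},\widehat Q^2_{y,k},Q^3_{y,k}$ are doubling cubes centered at $y$ containing $Q_{y,k}$ whose $\delta$-distances from $Q_{y,k}$ equal, respectively, $\alpha_1$, $\alpha_1+\sigma$, $\alpha_1+\alpha_2$, $\alpha_1+\alpha_2+\sigma$, $\alpha_1+\alpha_2+2\sigma$, each up to $\pm\varepsilon_1$. If $Q_{y,k}=\mathbb{R}^d$, all five are $\mathbb{R}^d$. If $Q_{y,k}=Q_{y,k-1}=\{y\}$, all five are $\{y\}$. If $Q_{y,k}=\{y\}\ne Q_{y,k-1}$, they are doubling cubes centered at $y$, contained in $Q_{y,k-1}$,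 with $\delta(\cdot,Q_{y,k-1})$ equal to $A$ minus the respective numbers above, up to $\pm\varepsilon_1$ (any one that does not exist because $\delta(y,Q_{y,k-1})$ is too small is taken to be $\{y\}$). $\psi_{y,k}$ is a function with (1) $0\le\psi_{y,k}(x)\le\min(4\ell(Q^1_{y,k})^{-n},|y-x|^{-n})$; (2) $\psi_{y,k}(x)=|x-y|^{-n}$ on $\widehat Q^2_{y,k}\setminus Q^1_{y,k}$; (3) $\operatorname{supp}\psi_{y,k}\subset Q^3_{y,k}$; (4) $|\psi'_{y,k}(x)|\le C_7\min(\ell(Q^1_{y,k})^{-n-1},|y-x|^{-n-1})$, with $C_7$ a fixed large constant, $1/\ell(\{y\})=\infty$, and $\psi_{y,k}\equiv0$ if $\widehat Q^2_{y,k}=\{y\}$ or $Q_{y,k}=\mathbb{R}^d$. Put $\varphi_{y,k}=\alpha_2^{-1}\psi_{y,k}$. The choices are understood to be such that the integrals below make sense, and $\alpha_1,\alpha_2$ are large enough that $\int\varphi_{z,k}(x)d\mu(x)\le\frac32$ and $\int\varphi_{y,k}(z)d\mu(y)\le\frac32$ for all $z\in\operatorname{supp}(\mu)$, both integrals being $\ge\frac12$ if $z$ lies in a transit cube of generation $k$. **Operators.** If $Q_{x,k}=\mathbb{R}^d$ for some $x\in\operatorname{supp}(\mu)$, then $S_k:=0$. Otherwise $\widetilde S_kf(x)=\int\varphi_{y,k}(x)f(y)\,d\mu(y)+\max\big(0,\frac14-\int\varphi_{y,k}(x)\,d\mu(y)\big)f(x)$, $\widetilde S_k^*$ is its adjoint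 for $\langle f,g\rangle=\int fg\,d\mu$, $M_k$ and $W_k$ are the operators of multiplication by $m_k=1/\widetilde S_k1$ and $w_k=1/\widetilde S_k^*(1/\widetilde S_k1)$, and $S_k=M_k\widetilde S_kW_k\widetilde S_k^*M_k$.
   Formalization: In condition (1) on ψ_{y,k} the constant 4 is replaced by max(4, 4^n), a weaker requirement: for n ≥ 2 the printed bound contradicts condition (2) and differentiability near the face centres of Q^1_{y,k}, where |x−y|^{-n} is about 2^n ℓ(Q^1_{y,k})^{-n}. *)

theory Defs
  imports "HOL-Analysis.Analysis"
begin

section \<open>Measures\<close>

definition supp :: "'a::metric_space measure \<Rightarrow> 'a set" where
  "supp M = {x. \<forall>r>0. emeasure M (ball x r) > 0}"

section \<open>Cubes\<close>

text \<open>
  \<open>Transit z l\<close> is the closed cube with centre \<open>z\<close> and side length \<open>l\<close>; points (side length 0)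
  and the whole space (which counts as centred at every point) are admitted as cubes too.
\<close>

datatype 'a cube = Point 'a | Transit 'a real | Whole

primrec cube_set :: "'a::euclidean_space cube \<Rightarrow> 'a set" where
  "cube_set (Point x) = {x}"
| "cube_set (Transit z l) = cbox (z - (l / 2) *\<^sub>R One) (z + (l / 2) *\<^sub>R One)"
| "cube_set Whole = UNIV"

primrec side :: "'a cube \<Rightarrow> ereal" where
  "side (Point x) = 0"
| "side (Transit z l) = ereal l"
| "side Whole = \<infinity>"

text \<open>The value of \<open>centre Whole\<close> is never used: it only enters integrals over the empty set.\<close>

primrec centre :: "'a::zero cube \<Rightarrow> 'a" where
  "centre (Point x) = x"
| "centre (Transit z l) = z"
| "centre Whole = 0"

definition centred_at :: "'a::zero cube \<Rightarrow> 'a \<Rightarrow> bool" where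
  "centred_at Q x \<longleftrightarrow> Q = Whole \<or> centre Q = x"

definition concentric :: "'a::zero cube \<Rightarrow> 'a cube \<Rightarrow> bool" where
  "concentric Q R \<longleftrightarrow> (\<exists>x. centred_at Q x \<and> centred_at R x)"

primrec is_cube :: "'a::metric_space measure \<Rightarrow> 'a cube \<Rightarrow> bool" where
  "is_cube M (Point x) \<longleftrightarrow> x \<in> supp M"
| "is_cube M (Transit z l) \<longleftrightarrow> z \<in> supp M \<and> 0 < l"
| "is_cube M Whole \<longleftrightarrow> True"

primrec doubling :: "'a::euclidean_space measure \<Rightarrow> 'a cube \<Rightarrow> bool" where
  "doubling M (Point x) \<longleftrightarrow> True"
| "doubling M (Transit z l) \<longleftrightarrow>
     emeasure M (cube_set (Transit z (2 * l))) \<le> 2 ^ (DIM('a) + 1) * emeasure M (cube_set (Transit z l))"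
| "doubling M Whole \<longleftrightarrow> True"

text \<open>
  The smallest cube \<open>Q\<^sub>R\<close> concentric with \<open>Q\<close> and containing \<open>Q\<close> and \<open>R\<close>, as a set.  The closed
  cubes with a given centre form a chain that is closed under intersection, so the smallest one
  is the intersection of all of them.
\<close>

definition cube_hull :: "'a::euclidean_space cube \<Rightarrow> 'a cube \<Rightarrow> 'a set" where
  "cube_hull Q R =
     \<Inter> {cube_set P | P. concentric Q P \<and> cube_set Q \<subseteq> cube_set P \<and> cube_set R \<subseteq> cube_set P}"

definition delta_half :: "'a::euclidean_space measure \<Rightarrow> real \<Rightarrow> 'a cube \<Rightarrow> 'a cube \<Rightarrow> ennreal" where
  "delta_half M n Q R =
     (\<integral>\<^sup>+x \<in> cube_hull Q R - cube_set Q. ennreal (norm (x - centre Q) powr (- n)) \<partial>M)"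

definition delta :: "'a::euclidean_space measure \<Rightarrow> real \<Rightarrow> 'a cube \<Rightarrow> 'a cube \<Rightarrow> ereal" where
  "delta M n Q R = enn2ereal (max (delta_half M n Q R) (delta_half M n R Q))"

text \<open>The notations \<open>a = b \<plusminus> \<epsilon>\<close> and \<open>a \<le> b \<plusminus> \<epsilon>\<close>.\<close>

definition eq_pm :: "ereal \<Rightarrow> real \<Rightarrow> real \<Rightarrow> bool" where
  "eq_pm a b e \<longleftrightarrow> ereal (b - e) \<le> a \<and> a \<le> ereal (b + e)"

definition le_pm :: "ereal \<Rightarrow> real \<Rightarrow> real \<Rightarrow> bool" where
  "le_pm a b e \<longleftrightarrow> a \<le> ereal (b + e)"

text \<open>
  A locally finite Borel measure on a Euclidean space is automatically regular, so \<open>sets_M\<close> and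
  \<open>finite_compact\<close> say that \<open>M\<close> is a Radon measure.
\<close>

locale growth_measure =
  fixes M :: "'a::euclidean_space measure" and n C0 :: real
  assumes sets_M: "sets M = sets borel"
    and finite_compact: "\<And>K. compact K \<Longrightarrow> emeasure M K < \<infinity>"
    and growth_ball:
      "\<And>x r. x \<in> supp M \<Longrightarrow> 0 < r \<Longrightarrow> emeasure M (ball x r) \<le> ennreal (C0 * r powr n)"
    and growth_cube:
      "\<And>z l. is_cube M (Transit z l) \<Longrightarrow>
        emeasure M (cube_set (Transit z l)) \<le> ennreal (C0 * l powr n)"

section \<open>The constants\<close>

text \<open>
  \<open>\<bar>\<delta>(P,R) - \<delta>(P,Q) - \<delta>(Q,R)\<bar> \<le> \<epsilon>\<^sub>0\<close>, arranged so as to make sense for infinite values as well.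
\<close>

definition delta_additive :: "'a::euclidean_space measure \<Rightarrow> real \<Rightarrow> real \<Rightarrow> bool" where
  "delta_additive M n e0 \<longleftrightarrow>
     (\<forall>P Q R. is_cube M P \<and> is_cube M Q \<and> is_cube M R \<and>
        cube_set P \<subseteq> cube_set Q \<and> cube_set Q \<subseteq> cube_set R \<longrightarrow>
        delta M n P R \<le> delta M n P Q + delta M n Q R + ereal e0 \<and>
        delta M n P Q + delta M n Q R \<le> delta M n P R + ereal e0)"

definition doubling_cubes_exist ::
  "'a::euclidean_space measure \<Rightarrow> real \<Rightarrow> real \<Rightarrow> real \<Rightarrow> bool" where
  "doubling_cubes_exist M n g0 e1 \<longleftrightarrow>
     (\<forall>\<alpha> z l. g0 < \<alpha> \<and> is_cube M (Transit z l) \<longrightarrow>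
       (\<forall>x \<in> cube_set (Transit z l) \<inter> supp M.
          delta M n (Point x) (Transit z (2 * l)) > ereal \<alpha> \<longrightarrow>
          (\<exists>Q. is_cube M Q \<and> doubling M Q \<and> centred_at Q x \<and>
               cube_set Q \<subseteq> cube_set (Transit z (2 * l)) \<and>
               eq_pm (delta M n Q (Transit z (2 * l))) \<alpha> e1)) \<and>
       (delta M n (Transit z l) Whole > ereal \<alpha> \<longrightarrow>
          (\<exists>S. is_cube M S \<and> doubling M S \<and> concentric S (Transit z l) \<and>
               cube_set (Transit z l) \<subseteq> cube_set S \<and> side S \<ge> 2 * ereal l \<and>
               eq_pm (delta M n (Transit z l) S) \<alpha> e1)))"

definition sigma :: "real \<Rightarrow> real \<Rightarrow> real \<Rightarrow> real \<Rightarrow> real" where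
  "sigma n C0 e0 e1 = 100 * e0 + 100 * e1 + 12 powr (n + 1) * C0"

section \<open>Generations\<close>

definition stopping :: "'a::euclidean_space measure \<Rightarrow> real \<Rightarrow> 'a \<Rightarrow> bool" where
  "stopping M n x \<longleftrightarrow> x \<in> supp M \<and>
     (\<exists>z l. is_cube M (Transit z l) \<and> x \<in> cube_set (Transit z l) \<and>
            delta M n (Point x) (Transit z l) < \<infinity>)"

definition initial :: "'a::euclidean_space measure \<Rightarrow> real \<Rightarrow> bool" where
  "initial M n \<longleftrightarrow> (\<exists>z l. is_cube M (Transit z l) \<and> delta M n (Transit z l) Whole < \<infinity>)"

text \<open>
  \<open>generation M n e1 A R Q k\<close>: the cube \<open>Q\<close> has generation \<open>k\<close>.  Here \<open>R j\<close> stands for the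
  reference cube \<open>R\<^sub>-\<^sub>j\<close>, which is irrelevant if the whole space is an initial cube.
\<close>

definition generation ::
  "'a::euclidean_space measure \<Rightarrow> real \<Rightarrow> real \<Rightarrow> nat \<Rightarrow> (nat \<Rightarrow> 'a cube) \<Rightarrow> 'a cube \<Rightarrow> int \<Rightarrow> bool"
  where
  "generation M n e1 A R Q k \<longleftrightarrow> is_cube M Q \<and>
     (if initial M n then
        (case Q of
           Transit z l \<Rightarrow> doubling M Q \<and> 1 \<le> k \<and> eq_pm (delta M n Q Whole) (of_int k * real A) e1
         | Point x \<Rightarrow> stopping M n x \<and> 1 \<le> k \<and> le_pm (delta M n Q Whole) (of_int k * real A) e1
         | Whole \<Rightarrow> k \<le> 0)
      else
        (case Q of
           Transit z l \<Rightarrow> doubling M Q \<and>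
             (\<exists>j. cube_set Q \<subseteq> cube_set (R j) \<and>
                  eq_pm (delta M n Q (R j)) (of_int (int j + k) * real A) e1)
         | Point x \<Rightarrow> stopping M n x \<and>
             (\<exists>j. x \<in> cube_set (R j) \<and>
                  le_pm (delta M n Q (R j)) (of_int (int j + k) * real A) e1)
         | Whole \<Rightarrow> False))"

section \<open>Auxiliary cubes and bump functions\<close>

text \<open>Indices of the cubes \<open>Q\<^sup>1\<close>, \<open>Q\<^sup>1\<close>-hat, \<open>Q\<^sup>2\<close>, \<open>Q\<^sup>2\<close>-hat, \<open>Q\<^sup>3\<close>.\<close>

datatype aux_index = I1 | Ihat1 | I2 | Ihat2 | I3

primrec aux_dist :: "real \<Rightarrow> real \<Rightarrow> real \<Rightarrow> aux_index \<Rightarrow> real" where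
  "aux_dist \<alpha>1 \<alpha>2 \<sigma> I1 = \<alpha>1"
| "aux_dist \<alpha>1 \<alpha>2 \<sigma> Ihat1 = \<alpha>1 + \<sigma>"
| "aux_dist \<alpha>1 \<alpha>2 \<sigma> I2 = \<alpha>1 + \<alpha>2"
| "aux_dist \<alpha>1 \<alpha>2 \<sigma> Ihat2 = \<alpha>1 + \<alpha>2 + \<sigma>"
| "aux_dist \<alpha>1 \<alpha>2 \<sigma> I3 = \<alpha>1 + \<alpha>2 + 2 * \<sigma>"

text \<open>
  \<open>aux_cube M n e1 A y Qk Qp t P\<close>: \<open>P\<close> is admissible as the auxiliary cube with number \<open>t\<close>, where
  \<open>Qk\<close> and \<open>Qp\<close> are \<open>Q\<^sub>y\<^sub>,\<^sub>k\<close> and \<open>Q\<^sub>y\<^sub>,\<^sub>k\<^sub>-\<^sub>1\<close>.  In the last case the point \<open>y\<close> is itself a cube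
  centred at \<open>y\<close>, with the largest \<open>\<delta>\<close>-distance to \<open>Qp\<close> among those; hence a cube at
  \<open>\<delta>\<close>-distance \<open>A - t \<plusminus> \<epsilon>\<^sub>1\<close> fails to exist because \<open>\<delta>(y,Qp)\<close> is too small exactly if
  \<open>\<delta>(y,Qp) < A - t - \<epsilon>\<^sub>1\<close>.
\<close>

definition aux_cube ::
  "'a::euclidean_space measure \<Rightarrow> real \<Rightarrow> real \<Rightarrow> nat \<Rightarrow> 'a \<Rightarrow> 'a cube \<Rightarrow> 'a cube \<Rightarrow> real \<Rightarrow> 'a cube \<Rightarrow> bool"
  where
  "aux_cube M n e1 A y Qk Qp t P \<longleftrightarrow>
     (case Qk of
        Whole \<Rightarrow> P = Whole
      | Transit _ _ \<Rightarrow> is_cube M P \<and> doubling M P \<and> centred_at P y \<and>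
          cube_set Qk \<subseteq> cube_set P \<and> eq_pm (delta M n Qk P) t e1
      | Point _ \<Rightarrow>
          if Qp = Qk then P = Point y
          else (is_cube M P \<and> doubling M P \<and> centred_at P y \<and>
                cube_set P \<subseteq> cube_set Qp \<and> eq_pm (delta M n P Qp) (real A - t) e1) \<or>
               (P = Point y \<and> delta M n (Point y) Qp < ereal (real A - t - e1)))"

text \<open>\<open>inv_pow s p = s\<^sup>-\<^sup>p\<close> for \<open>s \<in> [0,\<infinity>]\<close>, with \<open>0\<^sup>-\<^sup>p = \<infinity>\<close> and \<open>\<infinity>\<^sup>-\<^sup>p = 0\<close>.\<close>

definition inv_pow :: "ereal \<Rightarrow> real \<Rightarrow> ereal" where
  "inv_pow s p =
     (if s = 0 then \<infinity> else if s = \<infinity> then 0 else ereal (real_of_ereal s powr (- p)))"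

text \<open>
  The conditions on the function \<open>\<psi> = \<psi>\<^sub>y\<^sub>,\<^sub>k\<close>; \<open>P i\<close> are the auxiliary cubes of \<open>Qk = Q\<^sub>y\<^sub>,\<^sub>k\<close>.

  The height \<open>max 4 (4\<^sup>n)\<close> in the first condition is the usual \<open>4\<close> if \<open>n \<le> 1\<close>.  The bound
  \<open>4 \<ell>(Q\<^sup>1)\<^sup>-\<^sup>n\<close> cannot be kept for all \<open>n\<close>: just outside the centre of a face of \<open>Q\<^sup>1\<close> the second
  condition prescribes values of \<open>\<psi>\<close> arbitrarily close to \<open>2\<^sup>n \<ell>(Q\<^sup>1)\<^sup>-\<^sup>n\<close>, so no differentiable
  \<open>\<psi>\<close> would exist if \<open>n \<ge> 2\<close>.  The requirement made here is the weaker one.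

  In the derivative bound nothing is required where the bound is infinite, i.e. at \<open>x = y\<close> if
  \<open>Q\<^sup>1 = {y}\<close>.
\<close>

definition bump ::
  "real \<Rightarrow> real \<Rightarrow> 'a::euclidean_space \<Rightarrow> 'a cube \<Rightarrow> (aux_index \<Rightarrow> 'a cube) \<Rightarrow> ('a \<Rightarrow> real) \<Rightarrow> bool"
  where
  "bump n C7 y Qk P \<psi> \<longleftrightarrow>
     (\<forall>x. 0 \<le> \<psi> x \<and>
          ereal (\<psi> x) \<le> min (ereal (max 4 (4 powr n)) * inv_pow (side (P I1)) n)
                             (inv_pow (ereal (norm (y - x))) n)) \<and>
     (\<forall>x \<in> cube_set (P Ihat2) - cube_set (P I1). \<psi> x = norm (x - y) powr (- n)) \<and>
     closure {x. \<psi> x \<noteq> 0} \<subseteq> cube_set (P I3) \<and>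
     (\<forall>x. let b = min (inv_pow (side (P I1)) (n + 1)) (inv_pow (ereal (norm (y - x))) (n + 1))
          in b < \<infinity> \<longrightarrow>
             (\<exists>D. (\<psi> has_derivative D) (at x) \<and> ereal (onorm D) \<le> ereal C7 * b)) \<and>
     (P Ihat2 = Point y \<or> Qk = Whole \<longrightarrow> (\<forall>x. \<psi> x = 0))"

section \<open>Operators\<close>

text \<open>In this section \<open>\<phi> y x\<close> stands for \<open>\<phi>\<^sub>y\<^sub>,\<^sub>k(x)\<close> with a fixed \<open>k\<close>.\<close>

definition S_tilde :: "'a measure \<Rightarrow> ('a \<Rightarrow> 'a \<Rightarrow> real) \<Rightarrow> ('a \<Rightarrow> real) \<Rightarrow> 'a \<Rightarrow> real" where
  "S_tilde M \<phi> f x =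
     (LINT y|M. \<phi> y x * f y) + max 0 (1 / 4 - (LINT y|M. \<phi> y x)) * f x"

text \<open>
  The adjoint of \<^term>\<open>S_tilde M \<phi>\<close> for the pairing \<open>\<langle>f,g\<rangle> = \<integral> f g d\<mu>\<close>, see lemma
  \<open>S_tilde_adjoint\<close> below.  Given by transposing the kernel, so that it applies to bounded
  functions as well (it is applied to the function \<open>1 / S_tilde 1\<close>, which need not be in \<open>L\<^sup>2\<close>).
\<close>

definition S_tilde_adj :: "'a measure \<Rightarrow> ('a \<Rightarrow> 'a \<Rightarrow> real) \<Rightarrow> ('a \<Rightarrow> real) \<Rightarrow> 'a \<Rightarrow> real" where
  "S_tilde_adj M \<phi> g x =
     (LINT y|M. \<phi> x y * g y) + max 0 (1 / 4 - (LINT y|M. \<phi> y x)) * g x"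

definition m_fun :: "'a measure \<Rightarrow> ('a \<Rightarrow> 'a \<Rightarrow> real) \<Rightarrow> 'a \<Rightarrow> real" where
  "m_fun M \<phi> x = 1 / S_tilde M \<phi> (\<lambda>_. 1) x"

definition w_fun :: "'a measure \<Rightarrow> ('a \<Rightarrow> 'a \<Rightarrow> real) \<Rightarrow> 'a \<Rightarrow> real" where
  "w_fun M \<phi> x = 1 / S_tilde_adj M \<phi> (\<lambda>z. 1 / S_tilde M \<phi> (\<lambda>_. 1) z) x"

definition mult_op :: "('a \<Rightarrow> real) \<Rightarrow> ('a \<Rightarrow> real) \<Rightarrow> 'a \<Rightarrow> real" where
  "mult_op h f = (\<lambda>x. h x * f x)"

definition S_op ::
  "'a::euclidean_space measure \<Rightarrow> ('a \<Rightarrow> int \<Rightarrow> 'a cube) \<Rightarrow> (int \<Rightarrow> 'a \<Rightarrow> 'a \<Rightarrow> real) \<Rightarrow>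
   int \<Rightarrow> ('a \<Rightarrow> real) \<Rightarrow> 'a \<Rightarrow> real" where
  "S_op M Q \<phi> k =
     (if \<exists>x \<in> supp M. Q x k = Whole then (\<lambda>f x. 0)
      else mult_op (m_fun M (\<phi> k)) \<circ> S_tilde M (\<phi> k) \<circ> mult_op (w_fun M (\<phi> k)) \<circ>
           S_tilde_adj M (\<phi> k) \<circ> mult_op (m_fun M (\<phi> k)))"

definition D_op ::
  "'a::euclidean_space measure \<Rightarrow> ('a \<Rightarrow> int \<Rightarrow> 'a cube) \<Rightarrow> (int \<Rightarrow> 'a \<Rightarrow> 'a \<Rightarrow> real) \<Rightarrow>
   int \<Rightarrow> ('a \<Rightarrow> real) \<Rightarrow> 'a \<Rightarrow> real" where
  "D_op M Q \<phi> k f = (\<lambda>x. S_op M Q \<phi> k f x - S_op M Q \<phi> (k - 1) f x)"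

text \<open>The squared \<open>L\<^sup>2(\<mu>)\<close>-norm (possibly infinite).\<close>

definition L2_sq :: "'a measure \<Rightarrow> ('a \<Rightarrow> real) \<Rightarrow> ennreal" where
  "L2_sq M f = (\<integral>\<^sup>+x. ennreal ((f x)\<^sup>2) \<partial>M)"

definition in_L2 :: "'a measure \<Rightarrow> ('a \<Rightarrow> real) \<Rightarrow> bool" where
  "in_L2 M f \<longleftrightarrow> f \<in> borel_measurable M \<and> L2_sq M f < \<infinity>"

section \<open>The construction\<close>

text \<open>
  All choices entering the definition of the operators: \<open>R j = R\<^sub>-\<^sub>j\<close>, \<open>Q x k = Q\<^sub>x\<^sub>,\<^sub>k\<close>, the
  auxiliary cubes \<open>Qa y k i\<close> of \<open>Q\<^sub>y\<^sub>,\<^sub>k\<close>, and \<open>\<psi> k y x = \<psi>\<^sub>y\<^sub>,\<^sub>k(x)\<close>.  The values for points outside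
  \<open>supp M\<close>, a null set, are irrelevant (say, \<open>\<psi> k y = 0\<close> there).  \<open>measurable_psi\<close> makes all
  integrals meaningful.
\<close>

locale approximation_of_identity = growth_measure M n C0
  for M :: "'a::euclidean_space measure" and n C0 :: real +
  fixes e0 e1 \<alpha>1 \<alpha>2 :: real and A :: nat and C7 :: real
    and R :: "nat \<Rightarrow> 'a cube"
    and Q :: "'a \<Rightarrow> int \<Rightarrow> 'a cube"
    and Qa :: "'a \<Rightarrow> int \<Rightarrow> aux_index \<Rightarrow> 'a cube"
    and \<psi> \<phi> :: "int \<Rightarrow> 'a \<Rightarrow> 'a \<Rightarrow> real"
  assumes pos: "0 < \<alpha>1" "0 < \<alpha>2" "0 < A"
    and reference_cube: "\<not> initial M n \<Longrightarrow>
      (\<exists>z l. R 0 = Transit z l) \<and> is_cube M (R 0) \<and> doubling M (R 0)"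
    and reference_cubes: "\<And>j. \<not> initial M n \<Longrightarrow> 1 \<le> j \<Longrightarrow>
      is_cube M (R j) \<and> doubling M (R j) \<and> concentric (R j) (R 0) \<and>
      cube_set (R 0) \<subseteq> cube_set (R j) \<and> eq_pm (delta M n (R 0) (R j)) (real j * real A) e1"
    and generation_Q: "\<And>x k. x \<in> supp M \<Longrightarrow>
      generation M n e1 A R (Q x k) k \<and> centred_at (Q x k) x"
    and aux_Q: "\<And>y k i. y \<in> supp M \<Longrightarrow>
      aux_cube M n e1 A y (Q y k) (Q y (k - 1)) (aux_dist \<alpha>1 \<alpha>2 (sigma n C0 e0 e1) i) (Qa y k i)"
    and bump_psi: "\<And>y k. y \<in> supp M \<Longrightarrow> bump n C7 y (Q y k) (Qa y k) (\<psi> k y)"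
    and measurable_psi: "\<And>k. (\<lambda>(y, x). \<psi> k y x) \<in> borel_measurable (M \<Otimes>\<^sub>M M)"
    and phi_eq: "\<phi> = (\<lambda>k y x. \<psi> k y x / \<alpha>2)"
    and phi_le: "\<And>k z. z \<in> supp M \<Longrightarrow>
      (\<integral>\<^sup>+x. ennreal (\<phi> k z x) \<partial>M) \<le> ennreal (3 / 2) \<and>
      (\<integral>\<^sup>+y. ennreal (\<phi> k y z) \<partial>M) \<le> ennreal (3 / 2)"
    and phi_ge: "\<And>k z c l. z \<in> supp M \<Longrightarrow> generation M n e1 A R (Transit c l) k \<Longrightarrow>
      z \<in> cube_set (Transit c l) \<Longrightarrow>
      ennreal (1 / 2) \<le> (\<integral>\<^sup>+x. ennreal (\<phi> k z x) \<partial>M) \<and>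
      ennreal (1 / 2) \<le> (\<integral>\<^sup>+y. ennreal (\<phi> k y z) \<partial>M)"


lemma abs_mult_le_sum_squares: "\<bar>a * b\<bar> \<le> a\<^sup>2 + b\<^sup>2" for a b :: real
proof -
  have "2 * (\<bar>a\<bar> * \<bar>b\<bar>) \<le> a\<^sup>2 + b\<^sup>2"
    using sum_squares_bound[of "\<bar>a\<bar>" "\<bar>b\<bar>"] by simp
  moreover have "0 \<le> \<bar>a\<bar> * \<bar>b\<bar>" by simp
  ultimately show ?thesis unfolding abs_mult by linarith
qed

context growth_measure
begin

lemma space_M: "space M = UNIV"
  using sets_eq_imp_space_eq[OF sets_M] by simp

lemma AE_in_supp: "AE x in M. x \<in> supp M"
proof -
  define F where "F = {ball x r | x r. emeasure M (ball x r) = 0}"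
  obtain G where G: "G \<subseteq> F" "countable G" "\<Union>G = \<Union>F"
    by (rule Lindelof[of F]) (auto simp: F_def)
  have "(\<Union>B\<in>G. B) \<in> null_sets M"
    using G by (intro null_sets_UN') (auto simp: F_def null_sets_def sets_M)
  moreover have "- supp M \<subseteq> \<Union>F"
  proof
    fix x assume "x \<in> - supp M"
    then obtain r where "r > 0" "emeasure M (ball x r) = 0"
      by (auto simp: supp_def not_less)
    then have "ball x r \<in> F" "x \<in> ball x r"
      by (auto simp: F_def)
    then show "x \<in> \<Union>F" by blast
  qed
  ultimately show ?thesis
    using G(3) by (intro AE_I'[of "\<Union>G"]) auto
qed

lemma sigma_finite_M: "sigma_finite_measure M"
proof
  show "\<exists>A. countable A \<and> A \<subseteq> sets M \<and> \<Union>A = space M \<and> (\<forall>a\<in>A. emeasure M a \<noteq> \<infinity>)"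
  proof (intro exI[of _ "range (\<lambda>i::nat. cball 0 (real i))"] conjI)
    show "\<Union>(range (\<lambda>i::nat. cball 0 (real i))) = space M"
      using real_arch_simple by (fastforce simp: space_M)
  qed (use finite_compact in \<open>auto simp: sets_M less_top[symmetric] less_imp_neq\<close>)
qed

end

context approximation_of_identity
begin

lemma phi_measurable: "(\<lambda>(y, x). \<phi> k y x) \<in> borel_measurable (M \<Otimes>\<^sub>M M)"
proof -
  have "(\<lambda>p. (case p of (y, x) \<Rightarrow> \<psi> k y x) / \<alpha>2) \<in> borel_measurable (M \<Otimes>\<^sub>M M)"
    using measurable_psi[of k] by measurable
  then show ?thesis by (simp add: phi_eq case_prod_beta')
qed

lemma phi_measurable_comp:
  assumes "u \<in> measurable N M" "v \<in> measurable N M"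
  shows "(\<lambda>w. \<phi> k (u w) (v w)) \<in> borel_measurable N"
  using measurable_compose[OF measurable_Pair[OF assms] phi_measurable[of k]] by simp

lemma phi_nonneg: "y \<in> supp M \<Longrightarrow> 0 \<le> \<phi> k y x"
  using bump_psi[of y k] pos by (auto simp: phi_eq bump_def)

lemma integrable_kernel:
  assumes f: "in_L2 M f" and g: "in_L2 M g"
  shows "integrable (M \<Otimes>\<^sub>M M) (\<lambda>(y, x). \<phi> k y x * f y * g x)"
proof -
  interpret sigma_finite_measure M by (rule sigma_finite_M)
  interpret pair_sigma_finite M M ..
  note [measurable (raw)] = phi_measurable_comp[of _ _ _ k]
  have [measurable]: "(\<lambda>x. \<phi> k y x) \<in> borel_measurable M"
    "(\<lambda>x. \<phi> k x y) \<in> borel_measurable M" for y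
    by (rule phi_measurable_comp; simp add: space_M)+
  have [measurable]: "f \<in> borel_measurable M" "g \<in> borel_measurable M"
    using f g by (auto simp: in_L2_def)
  have fin: "L2_sq M f < \<infinity>" "L2_sq M g < \<infinity>"
    using f g by (auto simp: in_L2_def)
  have "(\<integral>\<^sup>+p. ennreal (norm (case p of (y, x) \<Rightarrow> \<phi> k y x * f y * g x)) \<partial>(M \<Otimes>\<^sub>M M))
      = (\<integral>\<^sup>+y. \<integral>\<^sup>+x. ennreal (norm (\<phi> k y x * f y * g x)) \<partial>M \<partial>M)"
    using sigma_finite_measure.nn_integral_fst[OF sigma_finite_M,
      where f = "\<lambda>p. ennreal (norm (case p of (y, x) \<Rightarrow> \<phi> k y x * f y * g x))" and ?M1.0 = M]
    by simp
  also have "\<dots> \<le> (\<integral>\<^sup>+y. \<integral>\<^sup>+x. (ennreal (\<phi> k y x) * ennreal ((f y)\<^sup>2) +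
                               ennreal (\<phi> k y x) * ennreal ((g x)\<^sup>2)) \<partial>M \<partial>M)"
  proof (rule nn_integral_mono_AE)
    show "AE y in M. (\<integral>\<^sup>+x. ennreal (norm (\<phi> k y x * f y * g x)) \<partial>M) \<le>
      (\<integral>\<^sup>+x. (ennreal (\<phi> k y x) * ennreal ((f y)\<^sup>2) + ennreal (\<phi> k y x) * ennreal ((g x)\<^sup>2)) \<partial>M)"
      using AE_in_supp
    proof eventually_elim
      case (elim y)
      show ?case
      proof (rule nn_integral_mono)
        fix x
        have p: "0 \<le> \<phi> k y x" by (rule phi_nonneg[OF elim])
        have "\<bar>f y * g x\<bar> \<le> (f y)\<^sup>2 + (g x)\<^sup>2"
          by (rule abs_mult_le_sum_squares)
        then have "norm (\<phi> k y x * f y * g x) \<le> \<phi> k y x * ((f y)\<^sup>2 + (g x)\<^sup>2)"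
          using p by (simp add: abs_mult mult.assoc mult_left_mono)
        then have "ennreal (norm (\<phi> k y x * f y * g x)) \<le> ennreal (\<phi> k y x * ((f y)\<^sup>2 + (g x)\<^sup>2))"
          by (rule ennreal_leI)
        also have "\<dots> = ennreal (\<phi> k y x) * ennreal ((f y)\<^sup>2) + ennreal (\<phi> k y x) * ennreal ((g x)\<^sup>2)"
          using p by (simp add: ennreal_plus ennreal_mult distrib_left)
        finally show "ennreal (norm (\<phi> k y x * f y * g x)) \<le>
          ennreal (\<phi> k y x) * ennreal ((f y)\<^sup>2) + ennreal (\<phi> k y x) * ennreal ((g x)\<^sup>2)" .
      qed
    qed
  qed
  also have "\<dots> = (\<integral>\<^sup>+y. \<integral>\<^sup>+x. ennreal (\<phi> k y x) * ennreal ((f y)\<^sup>2) \<partial>M \<partial>M)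
      + (\<integral>\<^sup>+y. \<integral>\<^sup>+x. ennreal (\<phi> k y x) * ennreal ((g x)\<^sup>2) \<partial>M \<partial>M)"
  proof -
    have "(\<integral>\<^sup>+x. (ennreal (\<phi> k y x) * ennreal ((f y)\<^sup>2) + ennreal (\<phi> k y x) * ennreal ((g x)\<^sup>2)) \<partial>M)
        = (\<integral>\<^sup>+x. ennreal (\<phi> k y x) * ennreal ((f y)\<^sup>2) \<partial>M)
        + (\<integral>\<^sup>+x. ennreal (\<phi> k y x) * ennreal ((g x)\<^sup>2) \<partial>M)" for y
      by (intro nn_integral_add) simp_all
    then show ?thesis
      by (simp only:) (intro nn_integral_add; simp)
  qed
  also have "(\<integral>\<^sup>+y. \<integral>\<^sup>+x. ennreal (\<phi> k y x) * ennreal ((g x)\<^sup>2) \<partial>M \<partial>M)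
      = (\<integral>\<^sup>+x. \<integral>\<^sup>+y. ennreal (\<phi> k y x) * ennreal ((g x)\<^sup>2) \<partial>M \<partial>M)"
    by (rule Fubini') simp
  also have "\<dots> = (\<integral>\<^sup>+x. (\<integral>\<^sup>+y. ennreal (\<phi> k y x) \<partial>M) * ennreal ((g x)\<^sup>2) \<partial>M)"
    by (simp add: nn_integral_multc)
  also have "\<dots> \<le> (\<integral>\<^sup>+x. ennreal (3 / 2) * ennreal ((g x)\<^sup>2) \<partial>M)"
    using AE_in_supp by (intro nn_integral_mono_AE) (auto elim!: eventually_mono intro!: mult_right_mono simp: phi_le)
  also have "\<dots> = ennreal (3 / 2) * L2_sq M g"
    by (simp add: nn_integral_cmult L2_sq_def)
  also have "(\<integral>\<^sup>+y. \<integral>\<^sup>+x. ennreal (\<phi> k y x) * ennreal ((f y)\<^sup>2) \<partial>M \<partial>M)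
      = (\<integral>\<^sup>+y. (\<integral>\<^sup>+x. ennreal (\<phi> k y x) \<partial>M) * ennreal ((f y)\<^sup>2) \<partial>M)"
    by (simp add: nn_integral_multc)
  also have "\<dots> \<le> (\<integral>\<^sup>+y. ennreal (3 / 2) * ennreal ((f y)\<^sup>2) \<partial>M)"
    using AE_in_supp by (intro nn_integral_mono_AE) (auto elim!: eventually_mono intro!: mult_right_mono simp: phi_le)
  also have "\<dots> = ennreal (3 / 2) * L2_sq M f"
    by (simp add: nn_integral_cmult L2_sq_def)
  also have "ennreal (3 / 2) * L2_sq M f + ennreal (3 / 2) * L2_sq M g < \<infinity>"
    using fin by (simp add: ennreal_mult_less_top)
  finally have "(\<integral>\<^sup>+p. ennreal (norm (case p of (y, x) \<Rightarrow> \<phi> k y x * f y * g x)) \<partial>(M \<Otimes>\<^sub>M M)) < \<infinity>"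
    by (simp add: add_right_mono)
  then show ?thesis
    by (intro integrableI_bounded) simp_all
qed

lemma S_tilde_adjoint:
  assumes f: "in_L2 M f" and g: "in_L2 M g"
  shows "(LINT x|M. S_tilde M (\<phi> k) f x * g x) = (LINT x|M. f x * S_tilde_adj M (\<phi> k) g x)"
proof -
  interpret sigma_finite_measure M by (rule sigma_finite_M)
  interpret pair_sigma_finite M M ..
  note [measurable (raw)] = phi_measurable_comp[of _ _ _ k]
  have [measurable]: "(\<lambda>x. \<phi> k y x) \<in> borel_measurable M"
    "(\<lambda>x. \<phi> k x y) \<in> borel_measurable M" for y
    by (rule phi_measurable_comp; simp add: space_M)+
  have [measurable]: "f \<in> borel_measurable M" "g \<in> borel_measurable M"
    using f g by (auto simp: in_L2_def)
  define h where "h = (\<lambda>x. max 0 (1 / 4 - (LINT y|M. \<phi> k y x)))"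
  have [measurable]: "h \<in> borel_measurable M" unfolding h_def by measurable
  have h: "0 \<le> h x" "h x \<le> 1 / 4" for x
  proof -
    have "0 \<le> (LINT y|M. \<phi> k y x)"
      using AE_in_supp by (intro integral_nonneg_AE) (auto elim!: eventually_mono intro: phi_nonneg)
    then show "0 \<le> h x" "h x \<le> 1 / 4" by (simp_all add: h_def max_def)
  qed
  have sq: "integrable M (\<lambda>x. (u x)\<^sup>2)" if "in_L2 M u" for u
    using that by (intro integrableI_bounded) (auto simp: in_L2_def L2_sq_def)
  have fg: "integrable M (\<lambda>x. h x * f x * g x)"
  proof (rule Bochner_Integration.integrable_bound[of _ "\<lambda>x. (f x)\<^sup>2 + (g x)\<^sup>2"])
    show "AE x in M. norm (h x * f x * g x) \<le> norm ((f x)\<^sup>2 + (g x)\<^sup>2)"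
    proof (intro AE_I2)
      fix x
      have "\<bar>f x * g x\<bar> \<le> (f x)\<^sup>2 + (g x)\<^sup>2"
          by (rule abs_mult_le_sum_squares)
      moreover have "\<bar>h x\<bar> * \<bar>f x * g x\<bar> \<le> 1 * \<bar>f x * g x\<bar>"
        using h[of x] by (intro mult_right_mono) auto
      ultimately show "norm (h x * f x * g x) \<le> norm ((f x)\<^sup>2 + (g x)\<^sup>2)"
        by (simp add: abs_mult mult.assoc)
    qed
  qed (use f g sq in auto)
  note K = integrable_kernel[OF f g, of k]
  have K1: "integrable M (\<lambda>y. LINT x|M. \<phi> k y x * f y * g x)"
    using integrable_fst'[OF K] by simp
  have K2: "integrable M (\<lambda>x. LINT y|M. \<phi> k y x * f y * g x)"
    using integrable_snd[OF K] by simp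
  have "(LINT x|M. S_tilde M (\<phi> k) f x * g x)
      = (LINT x|M. (LINT y|M. \<phi> k y x * f y * g x) + h x * f x * g x)"
    by (simp add: S_tilde_def h_def distrib_right)
  also have "\<dots> = (LINT x|M. LINT y|M. \<phi> k y x * f y * g x) + (LINT x|M. h x * f x * g x)"
    by (rule Bochner_Integration.integral_add[OF K2 fg])
  also have "(LINT x|M. LINT y|M. \<phi> k y x * f y * g x) = (LINT y|M. LINT x|M. \<phi> k y x * f y * g x)"
    by (rule Fubini_integral[OF K])
  also have "\<dots> + (LINT x|M. h x * f x * g x)
      = (LINT y|M. (LINT x|M. \<phi> k y x * f y * g x) + h y * f y * g y)"
    by (rule Bochner_Integration.integral_add[OF K1 fg, symmetric])
  also have "\<dots> = (LINT y|M. f y * S_tilde_adj M (\<phi> k) g y)"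
  proof (intro Bochner_Integration.integral_cong refl)
    fix y
    have "(LINT x|M. \<phi> k y x * f y * g x) = (LINT x|M. f y * (\<phi> k y x * g x))"
      by (simp add: ac_simps)
    also have "\<dots> = f y * (LINT x|M. \<phi> k y x * g x)"
      by (rule integral_mult_right_zero)
    finally show "(LINT x|M. \<phi> k y x * f y * g x) + h y * f y * g y = f y * S_tilde_adj M (\<phi> k) g y"
      by (simp add: S_tilde_adj_def h_def algebra_simps)
  qed
  finally show ?thesis .
qed

end

end

theory Submission
  imports Defs
begin

text \<open>
  The operators \<open>S\<^sub>k\<close> behave like orthogonal projections onto an increasing sequence of subspaces,
  the functions that are smooth at the scale of the cubes of generation \<open>k\<close>.  For genuine nested
  projections the differences \<open>D\<^sub>k\<close> would be mutually orthogonal and both inequalities would be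
  equalities with \<open>C = 1\<close>.  Here the \<open>S\<^sub>k\<close> are self-adjoint and uniformly bounded, and
  \<open>S\<^sub>j S\<^sub>k = S\<^sub>k\<close> for \<open>j > k\<close> holds up to an error of norm \<open>O(2\<^sup>-\<^sup>(\<^sup>j\<^sup>-\<^sup>k\<^sup>)\<^sup>/\<^sup>2)\<close>.  This makes the \<open>D\<^sub>k\<close> almost
  orthogonal: \<open>\<parallel>D\<^sub>j D\<^sub>k\<parallel>\<close> decays geometrically in \<open>|j - k|\<close>.  The upper bound for
  \<open>\<Sum> \<parallel>D\<^sub>k f\<parallel>\<^sup>2\<close> follows from a Cauchy-Schwarz argument.  For the lower bound one expands
  \<open>\<parallel>f\<parallel>\<^sup>2 = \<parallel>\<Sum> D\<^sub>k f\<parallel>\<^sup>2\<close>: the pairs with \<open>|j - k| \<le> N\<close> contribute at most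
  \<open>(2 N + 1) \<Sum> \<parallel>D\<^sub>k f\<parallel>\<^sup>2\<close>, and the others at most \<open>\<parallel>f\<parallel>\<^sup>2 / 2\<close> if \<open>N\<close> is large.  This part is
  carried out for abstract operators in the locale \<open>almost_nested_projections\<close>.

  The near nestedness comes from two facts.  First, \<open>S\<^sub>j\<close> is a product of two Markov operators
  \<open>P\<close> and \<open>Q\<close> (integration against probability measures), so that \<open>g - S\<^sub>j g\<close> is an average of
  differences \<open>g x - g z\<close> over points \<open>x\<close>, \<open>z\<close> that lie in a common cube of generation \<open>j - 1\<close>
  (lemmas \<open>two_step_oscillation_bound\<close> and \<open>coupled_points\<close>).  Second, if \<open>g = S\<^sub>k f\<close>, these
  differences are controlled by those of the bump functions \<open>\<phi>\<^sub>y\<^sub>,\<^sub>k\<close>, whose \<open>L\<^sup>1\<close>-variation in \<open>y\<close>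
  between two such points is \<open>O(2\<^sup>-\<^sup>(\<^sup>j\<^sup>-\<^sup>k\<^sup>))\<close> (lemma \<open>psi_regularity\<close>).  Regularity in one
  variable is enough, because the Schur test gives a small norm as soon as the row sums are small
  and the column sums stay bounded.

  Geometry enters through levels.  Measuring \<open>\<delta>\<close> from a large cube \<open>T\<close>, cubes of generation \<open>k\<close> have
  level about \<open>k A\<close>, the level essentially does not increase when a cube is enlarged, and doubling
  the side length changes it by a bounded amount.  Hence a cube \<open>P\<close> of generation \<open>j - 1\<close> can be
  enlarged by a factor \<open>2\<^sup>j\<^sup>-\<^sup>k\<close> and still has a level above the one of the cubes \<open>Q\<^sup>1\<^sub>y\<^sub>,\<^sub>k\<close>, so \<open>Q\<^sup>1\<^sub>y\<^sub>,\<^sub>k\<close> must be either much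
  larger than \<open>P\<close> or far away from it (lemma \<open>early_aux_cube_large_or_far\<close>).  Levels also show that
  \<open>1 / w\<^sub>k\<close> is bounded below (lemma \<open>phi_row_or_column_large\<close>) and that cubes of high generation
  are small, which gives \<open>S\<^sub>k f \<longlonglongrightarrow> f\<close> as \<open>k \<longlonglongrightarrow> \<infinity>\<close>.
\<close>

section \<open>The Hilbert space of square integrable functions\<close>

definition ip :: "'a measure \<Rightarrow> ('a \<Rightarrow> real) \<Rightarrow> ('a \<Rightarrow> real) \<Rightarrow> real" where
  "ip M f g = (LINT x|M. f x * g x)"

definition nrm :: "'a measure \<Rightarrow> ('a \<Rightarrow> real) \<Rightarrow> real" where
  "nrm M f = sqrt (ip M f f)"

lemma in_L2_measurable [measurable_dest]: "in_L2 M f \<Longrightarrow> f \<in> borel_measurable M"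
  by (simp add: in_L2_def)

lemma in_L2_iff_integrable:
  "in_L2 M f \<longleftrightarrow> f \<in> borel_measurable M \<and> integrable M (\<lambda>x. (f x)\<^sup>2)"
proof
  assume "in_L2 M f"
  then show "f \<in> borel_measurable M \<and> integrable M (\<lambda>x. (f x)\<^sup>2)"
    by (auto simp: in_L2_def L2_sq_def intro!: integrableI_bounded)
next
  assume f: "f \<in> borel_measurable M \<and> integrable M (\<lambda>x. (f x)\<^sup>2)"
  then have "(\<integral>\<^sup>+x. ennreal (norm ((f x)\<^sup>2)) \<partial>M) < \<infinity>"
    by (auto simp: integrable_iff_bounded)
  with f show "in_L2 M f" by (simp add: in_L2_def L2_sq_def)
qed

lemma integrable_L2_product:
  assumes "in_L2 M f" "in_L2 M g"
  shows "integrable M (\<lambda>x. f x * g x)"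
proof (rule Bochner_Integration.integrable_bound[of _ "\<lambda>x. (f x)\<^sup>2 + (g x)\<^sup>2"])
  show "integrable M (\<lambda>x. (f x)\<^sup>2 + (g x)\<^sup>2)"
    using assms by (auto simp: in_L2_iff_integrable)
  show "(\<lambda>x. f x * g x) \<in> borel_measurable M"
    using assms by (auto simp: in_L2_def)
  show "AE x in M. norm (f x * g x) \<le> norm ((f x)\<^sup>2 + (g x)\<^sup>2)"
    using abs_mult_le_sum_squares by auto
qed

lemma in_L2_add:
  assumes "in_L2 M f" "in_L2 M g"
  shows "in_L2 M (\<lambda>x. f x + g x)"
proof -
  have "integrable M (\<lambda>x. (f x)\<^sup>2 + (g x)\<^sup>2 + 2 * (f x * g x))"
    using assms integrable_L2_product[OF assms] by (auto simp: in_L2_iff_integrable)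
  moreover have "(\<lambda>x. (f x)\<^sup>2 + (g x)\<^sup>2 + 2 * (f x * g x)) = (\<lambda>x. (f x + g x)\<^sup>2)"
    by (auto simp: power2_sum)
  ultimately show ?thesis using assms by (auto simp: in_L2_iff_integrable)
qed

lemma in_L2_cmult: "in_L2 M f \<Longrightarrow> in_L2 M (\<lambda>x. c * f x)"
  by (auto simp: in_L2_iff_integrable power_mult_distrib)

lemma in_L2_diff: "in_L2 M f \<Longrightarrow> in_L2 M g \<Longrightarrow> in_L2 M (\<lambda>x. f x - g x)"
  using in_L2_add[of M f "\<lambda>x. (-1) * g x"] in_L2_cmult[of M g "-1"] by simp

lemma in_L2_zero: "in_L2 M (\<lambda>x. 0)"
  by (simp add: in_L2_def L2_sq_def)

lemma in_L2_sum: "(\<And>k. k \<in> F \<Longrightarrow> in_L2 M (v k)) \<Longrightarrow> in_L2 M (\<lambda>x. \<Sum>k\<in>F. v k x)"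
  by (induction F rule: infinite_finite_induct) (auto intro: in_L2_add in_L2_zero)

lemma ip_sym: "ip M f g = ip M g f"
  by (simp add: ip_def mult.commute)

lemma ip_nonneg: "0 \<le> ip M f f"
  by (auto simp: ip_def intro!: integral_nonneg_AE)

lemma nrm_nonneg [simp]: "0 \<le> nrm M f"
  by (simp add: nrm_def ip_nonneg)

lemma nrm_square: "(nrm M f)\<^sup>2 = ip M f f"
  by (simp add: nrm_def ip_nonneg)

lemma L2_sq_eq_nrm: "in_L2 M f \<Longrightarrow> L2_sq M f = ennreal ((nrm M f)\<^sup>2)"
  unfolding L2_sq_def nrm_square ip_def
  by (subst nn_integral_eq_integral) (auto simp: in_L2_iff_integrable power2_eq_square)

lemma ip_diff_left:
  "in_L2 M f \<Longrightarrow> in_L2 M g \<Longrightarrow> in_L2 M h \<Longrightarrow> ip M (\<lambda>x. f x - g x) h = ip M f h - ip M g h"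
  by (simp add: ip_def left_diff_distrib integrable_L2_product)

lemma ip_add_left:
  "in_L2 M f \<Longrightarrow> in_L2 M g \<Longrightarrow> in_L2 M h \<Longrightarrow> ip M (\<lambda>x. f x + g x) h = ip M f h + ip M g h"
  by (simp add: ip_def distrib_right integrable_L2_product)

lemma ip_diff_right:
  "in_L2 M f \<Longrightarrow> in_L2 M g \<Longrightarrow> in_L2 M h \<Longrightarrow> ip M h (\<lambda>x. f x - g x) = ip M h f - ip M h g"
  by (simp add: ip_def right_diff_distrib integrable_L2_product)

lemma ip_add_right:
  "in_L2 M f \<Longrightarrow> in_L2 M g \<Longrightarrow> in_L2 M h \<Longrightarrow> ip M h (\<lambda>x. f x + g x) = ip M h f + ip M h g"
  by (simp add: ip_def distrib_left integrable_L2_product)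

lemma ip_cmult_left: "ip M (\<lambda>x. c * f x) h = c * ip M f h"
  by (simp add: ip_def mult.assoc)

lemma ip_sum_left:
  assumes "\<And>k. k \<in> F \<Longrightarrow> in_L2 M (v k)" "in_L2 M h"
  shows "ip M (\<lambda>x. \<Sum>k\<in>F. v k x) h = (\<Sum>k\<in>F. ip M (v k) h)"
  using assms by (simp add: ip_def sum_distrib_right integrable_L2_product)

lemma ip_sum_right:
  assumes "\<And>k. k \<in> F \<Longrightarrow> in_L2 M (v k)" "in_L2 M h"
  shows "ip M h (\<lambda>x. \<Sum>k\<in>F. v k x) = (\<Sum>k\<in>F. ip M h (v k))"
  using assms by (simp add: ip_def sum_distrib_left integrable_L2_product)

lemma ip_Cauchy_Schwarz:
  assumes "in_L2 M f" "in_L2 M g"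
  shows "\<bar>ip M f g\<bar> \<le> nrm M f * nrm M g"
proof -
  have i: "integrable M (\<lambda>x. \<bar>f x * g x\<bar>)"
    using integrable_L2_product[OF assms] by simp
  have [measurable]: "f \<in> borel_measurable M" "g \<in> borel_measurable M"
    using assms by (auto simp: in_L2_def)
  have "ennreal (LINT x|M. \<bar>f x * g x\<bar>) = (\<integral>\<^sup>+x. ennreal \<bar>f x\<bar> * ennreal \<bar>g x\<bar> \<partial>M)"
    by (subst nn_integral_eq_integral[OF i, symmetric]) (auto simp: abs_mult ennreal_mult)
  then have "ennreal ((LINT x|M. \<bar>f x * g x\<bar>)\<^sup>2) = (\<integral>\<^sup>+x. ennreal \<bar>f x\<bar> * ennreal \<bar>g x\<bar> \<partial>M)\<^sup>2"
    by (simp flip: ennreal_power)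
  also have "\<dots> \<le> (\<integral>\<^sup>+x. (ennreal \<bar>f x\<bar>)\<^sup>2 \<partial>M) * (\<integral>\<^sup>+x. (ennreal \<bar>g x\<bar>)\<^sup>2 \<partial>M)"
    by (rule Cauchy_Schwarz_nn_integral) auto
  also have "\<dots> = L2_sq M f * L2_sq M g"
    by (simp add: L2_sq_def ennreal_power)
  also have "\<dots> = ennreal ((nrm M f * nrm M g)\<^sup>2)"
    using assms by (simp add: L2_sq_eq_nrm power_mult_distrib ennreal_mult)
  finally have "(LINT x|M. \<bar>f x * g x\<bar>)\<^sup>2 \<le> (nrm M f * nrm M g)\<^sup>2"
    by simp
  then have "(LINT x|M. \<bar>f x * g x\<bar>) \<le> nrm M f * nrm M g"
    by (rule power2_le_imp_le) simp
  moreover have "\<bar>ip M f g\<bar> \<le> (LINT x|M. \<bar>f x * g x\<bar>)"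
    unfolding ip_def by (rule integral_abs_bound)
  ultimately show ?thesis by linarith
qed

lemma nrm_triangle:
  assumes "in_L2 M f" "in_L2 M g"
  shows "nrm M (\<lambda>x. f x + g x) \<le> nrm M f + nrm M g"
proof (rule power2_le_imp_le)
  have "(nrm M (\<lambda>x. f x + g x))\<^sup>2 = ip M f f + 2 * ip M f g + ip M g g"
    using assms in_L2_add[OF assms]
    by (simp add: nrm_square ip_add_left ip_add_right ip_sym[of M g f])
  also have "\<dots> \<le> (nrm M f + nrm M g)\<^sup>2"
    using ip_Cauchy_Schwarz[OF assms] by (simp add: power2_sum nrm_square abs_le_iff)
  finally show "(nrm M (\<lambda>x. f x + g x))\<^sup>2 \<le> (nrm M f + nrm M g)\<^sup>2" .
qed simp

lemma nrm_cmult: "nrm M (\<lambda>x. c * f x) = \<bar>c\<bar> * nrm M f"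
proof -
  have "ip M (\<lambda>x. c * f x) (\<lambda>x. c * f x) = c\<^sup>2 * ip M f f"
    unfolding ip_def by (simp add: power2_eq_square ac_simps)
  then show ?thesis by (simp add: nrm_def real_sqrt_mult)
qed

lemma nrm_triangle_diff:
  assumes "in_L2 M f" "in_L2 M g"
  shows "nrm M (\<lambda>x. f x - g x) \<le> nrm M f + nrm M g"
  using nrm_triangle[OF assms(1) in_L2_cmult[OF assms(2), of "-1"]] nrm_cmult[of M "-1" g] by simp

lemma nrm_le_by_duality:
  assumes "in_L2 M u" "0 \<le> c" "\<And>h. in_L2 M h \<Longrightarrow> \<bar>ip M u h\<bar> \<le> c * nrm M h"
  shows "nrm M u \<le> c"
proof (cases "nrm M u = 0")
  case True
  then show ?thesis using assms(2) by simp
next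
  case False
  then have "0 < nrm M u" using nrm_nonneg[of M u] by linarith
  moreover have "nrm M u * nrm M u \<le> c * nrm M u"
    using assms(3)[OF assms(1)] by (simp add: nrm_square[symmetric] power2_eq_square)
  ultimately show ?thesis by simp
qed

text \<open>
  Cauchy-Schwarz against a finite sum: the only way in which sums of vectors enter the argument.
\<close>

lemma sum_ip_le:
  assumes "in_L2 M f" "\<And>k. k \<in> F \<Longrightarrow> in_L2 M (v k)"
  shows "(\<Sum>k\<in>F. ip M f (v k))\<^sup>2 \<le> (nrm M f)\<^sup>2 * (\<Sum>k\<in>F. \<Sum>l\<in>F. ip M (v k) (v l))"
proof -
  let ?s = "\<lambda>x. \<Sum>k\<in>F. v k x"
  have s: "in_L2 M ?s" using assms(2) by (rule in_L2_sum)
  have "ip M f ?s = (\<Sum>k\<in>F. ip M f (v k))"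
    using assms by (simp add: ip_sum_right)
  moreover have "ip M ?s ?s = (\<Sum>k\<in>F. \<Sum>l\<in>F. ip M (v k) (v l))"
    using assms(2) s by (simp add: ip_sum_left ip_sum_right)
  moreover have "\<bar>ip M f ?s\<bar>\<^sup>2 \<le> (nrm M f * nrm M ?s)\<^sup>2"
    by (intro power_mono ip_Cauchy_Schwarz assms(1) s) simp
  ultimately show ?thesis by (simp add: power_mult_distrib nrm_square)
qed

section \<open>Geometric sums over the integers\<close>

lemma sum_geometric_nat_le:
  fixes r :: real
  assumes "finite F" "0 \<le> r" "r < 1"
  shows "(\<Sum>i\<in>F. r ^ i) \<le> 1 / (1 - r)"
proof -
  have "(\<Sum>i\<in>F. r ^ i) \<le> (\<Sum>i. r ^ i)"
    using assms by (intro sum_le_suminf summable_geometric) auto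
  then show ?thesis using assms by (simp add: suminf_geometric)
qed

lemma sum_geometric_int_le:
  fixes r :: real
  assumes F: "finite F" and r: "0 \<le> r" "r < 1"
  shows "(\<Sum>l\<in>F. r ^ nat \<bar>k - l\<bar>) \<le> 2 / (1 - r)"
proof -
  have part: "(\<Sum>l\<in>G. r ^ nat \<bar>k - l\<bar>) \<le> 1 / (1 - r)"
    if "G \<subseteq> F" "inj_on (\<lambda>l. nat \<bar>k - l\<bar>) G" for G
  proof -
    have "(\<Sum>l\<in>G. r ^ nat \<bar>k - l\<bar>) = (\<Sum>i\<in>(\<lambda>l. nat \<bar>k - l\<bar>) ` G. r ^ i)"
      using that by (simp add: sum.reindex)
    also have "\<dots> \<le> 1 / (1 - r)"
      using that F r by (intro sum_geometric_nat_le) (auto intro: finite_subset)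
    finally show ?thesis .
  qed
  have "(\<Sum>l\<in>F. r ^ nat \<bar>k - l\<bar>)
      = (\<Sum>l\<in>F \<inter> {..k}. r ^ nat \<bar>k - l\<bar>) + (\<Sum>l\<in>F - {..k}. r ^ nat \<bar>k - l\<bar>)"
    using F by (rule sum.Int_Diff)
  also have "\<dots> \<le> 1 / (1 - r) + 1 / (1 - r)"
    by (intro add_mono part) (auto simp: inj_on_def)
  finally show ?thesis by simp
qed

text \<open>The Schur test for a matrix with geometric decay off the diagonal.\<close>

lemma sum_geometric_Schur:
  fixes a b :: "int \<Rightarrow> real"
  assumes F: "finite F" and r: "0 \<le> r" "r < 1" and "\<And>k. 0 \<le> a k" "\<And>k. 0 \<le> b k"
  shows "(\<Sum>k\<in>F. \<Sum>l\<in>F. r ^ nat \<bar>k - l\<bar> * (a k * b l))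
    \<le> 1 / (1 - r) * ((\<Sum>k\<in>F. (a k)\<^sup>2) + (\<Sum>k\<in>F. (b k)\<^sup>2))"
proof -
  have "(\<Sum>k\<in>F. \<Sum>l\<in>F. r ^ nat \<bar>k - l\<bar> * (a k * b l))
    \<le> (\<Sum>k\<in>F. \<Sum>l\<in>F. r ^ nat \<bar>k - l\<bar> * (a k)\<^sup>2 / 2 + r ^ nat \<bar>k - l\<bar> * (b l)\<^sup>2 / 2)"
  proof (intro sum_mono)
    fix k l
    have "a k * b l \<le> ((a k)\<^sup>2 + (b l)\<^sup>2) / 2"
      using sum_squares_bound[of "a k" "b l"] by simp
    then have "r ^ nat \<bar>k - l\<bar> * (a k * b l) \<le> r ^ nat \<bar>k - l\<bar> * (((a k)\<^sup>2 + (b l)\<^sup>2) / 2)"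
      using r by (intro mult_left_mono) auto
    then show "r ^ nat \<bar>k - l\<bar> * (a k * b l)
      \<le> r ^ nat \<bar>k - l\<bar> * (a k)\<^sup>2 / 2 + r ^ nat \<bar>k - l\<bar> * (b l)\<^sup>2 / 2"
      by (simp add: distrib_left add_divide_distrib)
  qed
  also have "\<dots> = (\<Sum>k\<in>F. (\<Sum>l\<in>F. r ^ nat \<bar>k - l\<bar>) * (a k)\<^sup>2 / 2)
      + (\<Sum>l\<in>F. (\<Sum>k\<in>F. r ^ nat \<bar>l - k\<bar>) * (b l)\<^sup>2 / 2)"
    by (simp add: sum.distrib sum_distrib_right sum_divide_distrib)
       (subst sum.swap, simp add: abs_minus_commute)
  also have "\<dots> \<le> (\<Sum>k\<in>F. (2 / (1 - r)) * (a k)\<^sup>2 / 2) + (\<Sum>l\<in>F. (2 / (1 - r)) * (b l)\<^sup>2 / 2)"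
    using F r
    by (intro add_mono sum_mono divide_right_mono mult_right_mono sum_geometric_int_le) auto
  also have "\<dots> = 1 / (1 - r) * ((\<Sum>k\<in>F. (a k)\<^sup>2) + (\<Sum>k\<in>F. (b k)\<^sup>2))"
  proof -
    have "2 / (1 - r) * c / 2 = 1 / (1 - r) * c" for c :: real
      using r by (simp add: field_simps)
    then show ?thesis by (simp only: sum_distrib_left distrib_left)
  qed
  finally show ?thesis .
qed

section \<open>Square functions of almost orthogonal families\<close>

text \<open>
  If \<open>T\<^sub>l T\<^sub>k\<^sup>*\<close> decays geometrically in \<open>|k - l|\<close>, then with \<open>u\<^sub>k = T\<^sub>k f\<close> one has
  \<open>\<Sum> \<parallel>u\<^sub>k\<parallel>\<^sup>2 = \<langle>f, \<Sum> T\<^sub>k\<^sup>* u\<^sub>k\<rangle>\<close>, and the square of the norm of the sum on the right is at most a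
  constant times \<open>\<Sum> \<parallel>u\<^sub>k\<parallel>\<^sup>2\<close> again.
\<close>

lemma square_function_bound:
  fixes T T' :: "int \<Rightarrow> ('a \<Rightarrow> real) \<Rightarrow> 'a \<Rightarrow> real"
  assumes L2: "\<And>k f. in_L2 M f \<Longrightarrow> in_L2 M (T k f)" "\<And>k f. in_L2 M f \<Longrightarrow> in_L2 M (T' k f)"
    and adj: "\<And>k f g. in_L2 M f \<Longrightarrow> in_L2 M g \<Longrightarrow> ip M (T k f) g = ip M f (T' k g)"
    and decay: "\<And>k l u. in_L2 M u \<Longrightarrow> nrm M (T l (T' k u)) \<le> B * r ^ nat \<bar>k - l\<bar> * nrm M u"
    and r: "0 \<le> r" "r < 1" and B: "0 \<le> B"
    and F: "finite F" and f: "in_L2 M f"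
  shows "(\<Sum>k\<in>F. (nrm M (T k f))\<^sup>2) \<le> 2 * B / (1 - r) * (nrm M f)\<^sup>2"
proof -
  define X where "X = (\<Sum>k\<in>F. (nrm M (T k f))\<^sup>2)"
  have X0: "0 \<le> X" by (simp add: X_def sum_nonneg)
  have "X = (\<Sum>k\<in>F. ip M f (T' k (T k f)))"
    using f by (simp add: X_def nrm_square adj L2)
  then have "X\<^sup>2 \<le> (nrm M f)\<^sup>2 * (\<Sum>k\<in>F. \<Sum>l\<in>F. ip M (T' k (T k f)) (T' l (T l f)))"
    using f by (auto intro!: sum_ip_le L2)
  also have "\<dots> \<le> (nrm M f)\<^sup>2 * (\<Sum>k\<in>F. \<Sum>l\<in>F. B * (r ^ nat \<bar>k - l\<bar> * (nrm M (T k f) * nrm M (T l f))))"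
  proof (intro mult_left_mono sum_mono)
    fix k l
    have "ip M (T' k (T k f)) (T' l (T l f)) = ip M (T l (T' k (T k f))) (T l f)"
      using f by (simp add: adj L2)
    also have "\<dots> \<le> nrm M (T l (T' k (T k f))) * nrm M (T l f)"
      using f ip_Cauchy_Schwarz[of M "T l (T' k (T k f))" "T l f"] by (simp add: L2)
    also have "\<dots> \<le> (B * r ^ nat \<bar>k - l\<bar> * nrm M (T k f)) * nrm M (T l f)"
      using f by (intro mult_right_mono decay L2) auto
    finally show "ip M (T' k (T k f)) (T' l (T l f))
      \<le> B * (r ^ nat \<bar>k - l\<bar> * (nrm M (T k f) * nrm M (T l f)))" by (simp add: mult.assoc)
  qed simp
  also have "\<dots> \<le> (nrm M f)\<^sup>2 * (B * (1 / (1 - r) * (X + X)))"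
    unfolding sum_distrib_left[symmetric] X_def
    using F r B by (intro mult_left_mono sum_geometric_Schur) auto
  finally have "X * X \<le> (2 * B / (1 - r) * (nrm M f)\<^sup>2) * X"
    by (simp add: power2_eq_square field_simps)
  then have "X \<le> 2 * B / (1 - r) * (nrm M f)\<^sup>2" if "0 < X"
    using that by (rule mult_right_le_imp_le)
  moreover have "0 \<le> 2 * B / (1 - r) * (nrm M f)\<^sup>2" using r B by simp
  ultimately show ?thesis
    using X0 unfolding X_def[symmetric] by (cases "X = 0") auto
qed

text \<open>
  The inequality \<open>min (P\<^sup>2 d) t \<le> P sqrt (d t)\<close>, with a free weight \<open>s\<close> in place of the root.
\<close>

lemma min_bound_split:
  fixes x :: real
  assumes "x \<le> P\<^sup>2 * d" "x \<le> t" "0 < P" "0 < s" "0 \<le> d" "0 \<le> t"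
  shows "x \<le> P * (s * d + t / s)"
proof (cases "P \<le> s")
  case True
  have "P\<^sup>2 * d \<le> P * (s * d)"
    using True assms by (simp add: power2_eq_square mult.assoc mult_left_mono mult_right_mono)
  moreover have "0 \<le> P * (t / s)" using assms by simp
  ultimately show ?thesis using assms(1) by (simp add: distrib_left)
next
  case False
  have "s * t \<le> P * t" using False assms by (intro mult_right_mono) auto
  then have "t \<le> P * (t / s)" using assms(4) by (simp add: field_simps)
  moreover have "0 \<le> P * (s * d)" using assms by simp
  ultimately show ?thesis using assms(2) by (simp add: distrib_left)
qed

section \<open>Almost nested almost projections\<close>

text \<open>
  Abstract form of the theorem.  If the \<open>S\<^sub>k\<close> were orthogonal projections onto an increasing
  sequence of subspaces, then \<open>S\<^sub>j S\<^sub>k = S\<^sub>k\<close> for \<open>j \<ge> k\<close>; here this holds up to an error that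
  decays geometrically.  The exponent 8 leaves room for the roots taken in the proof.
\<close>

locale almost_nested_projections =
  fixes M :: "'a measure" and S :: "int \<Rightarrow> ('a \<Rightarrow> real) \<Rightarrow> 'a \<Rightarrow> real" and B C \<theta> :: real
  assumes S_L2: "\<And>k f. in_L2 M f \<Longrightarrow> in_L2 M (S k f)"
    and S_selfadjoint: "\<And>k f g. in_L2 M f \<Longrightarrow> in_L2 M g \<Longrightarrow> ip M (S k f) g = ip M f (S k g)"
    and S_bounded: "\<And>k f. in_L2 M f \<Longrightarrow> nrm M (S k f) \<le> B * nrm M f"
    and S_nested: "\<And>j k f. in_L2 M f \<Longrightarrow> k + 2 \<le> j \<Longrightarrow>
      nrm M (\<lambda>x. S j (S k f) x - S k f x) \<le> C * \<theta> ^ (8 * nat (j - k)) * nrm M f"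
    and S_top: "\<And>f. in_L2 M f \<Longrightarrow> (\<lambda>i. nrm M (\<lambda>x. S (int i) f x - f x)) \<longlonglongrightarrow> 0"
    and S_bot: "\<And>f. in_L2 M f \<Longrightarrow> (\<lambda>i. nrm M (S (- int i) f)) \<longlonglongrightarrow> 0"
    and B: "1 \<le> B" and C: "0 \<le> C" and \<theta>: "0 < \<theta>" "\<theta> < 1"
begin

definition D :: "int \<Rightarrow> ('a \<Rightarrow> real) \<Rightarrow> 'a \<Rightarrow> real" where
  "D k f = (\<lambda>x. S k f x - S (k - 1) f x)"

lemma D_L2: "in_L2 M f \<Longrightarrow> in_L2 M (D k f)"
  by (simp add: D_def in_L2_diff S_L2)

lemma D_selfadjoint: "in_L2 M f \<Longrightarrow> in_L2 M g \<Longrightarrow> ip M (D k f) g = ip M f (D k g)"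
  by (simp add: D_def ip_diff_left ip_diff_right S_L2 S_selfadjoint)

lemma D_bounded: "in_L2 M f \<Longrightarrow> nrm M (D k f) \<le> 2 * B * nrm M f"
  using nrm_triangle_diff[of M "S k f" "S (k - 1) f"] S_bounded[of f k] S_bounded[of f "k - 1"]
  by (simp add: D_def S_L2)

definition K where "K = (2 * C + 2 * B\<^sup>2) / \<theta> ^ 24"

lemma K_pos: "0 < K"
  using B C \<theta> by (simp add: K_def add_nonneg_pos)

text \<open>
  \<open>D\<^sub>j S\<^sub>k\<close> is the difference of \<open>S\<^sub>j S\<^sub>k - S\<^sub>k\<close> and \<open>S\<^sub>j\<^sub>-\<^sub>1 S\<^sub>k - S\<^sub>k\<close>.  Near the diagonal the trivial
  bound suffices; the factor \<open>\<theta>\<^sup>-\<^sup>2\<^sup>4\<close> in \<open>K\<close> pays for the values \<open>j - k \<le> 3\<close>.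
\<close>

lemma D_S_decay:
  assumes f: "in_L2 M f" and "k \<le> j"
  shows "nrm M (D j (S k f)) \<le> K * \<theta> ^ (8 * nat (j - k)) * nrm M f"
proof (cases "j \<le> k + 3")
  case True
  have "nrm M (D j (S k f)) \<le> 2 * B * (B * nrm M f)"
    using D_bounded[OF S_L2[OF f], of j k] mult_left_mono[OF S_bounded[OF f, of k], of "2 * B"] B
    by linarith
  also have "\<dots> = 2 * B\<^sup>2 / \<theta> ^ 24 * \<theta> ^ 24 * nrm M f"
    using \<theta> by (simp add: power2_eq_square)
  also have "\<dots> \<le> K * \<theta> ^ (8 * nat (j - k)) * nrm M f"
    unfolding K_def using \<theta> True assms(2) B C
    by (intro mult_right_mono mult_mono divide_right_mono power_decreasing) auto
  finally show ?thesis .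
next
  case False
  define i where "i = nat (j - 1 - k)"
  have i: "nat (j - k) = Suc i" using False by (simp add: i_def)
  let ?u = "\<lambda>x. S j (S k f) x - S k f x" and ?v = "\<lambda>x. S (j - 1) (S k f) x - S k f x"
  have uv: "in_L2 M ?u" "in_L2 M ?v" using f by (auto intro: in_L2_diff S_L2)
  have "D j (S k f) = (\<lambda>x. ?u x - ?v x)" by (auto simp: D_def)
  then have "nrm M (D j (S k f)) \<le> nrm M ?u + nrm M ?v"
    using nrm_triangle_diff[OF uv] by simp
  also have "\<dots> \<le> C * \<theta> ^ (8 * Suc i) * nrm M f + C * \<theta> ^ (8 * i) * nrm M f"
    using S_nested[OF f, of k j] S_nested[OF f, of k "j - 1"] False
    by (intro add_mono) (simp_all add: i flip: i_def)
  also have "\<dots> \<le> C * \<theta> ^ (8 * i) * nrm M f + C * \<theta> ^ (8 * i) * nrm M f"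
    using \<theta> C by (intro add_mono mult_right_mono mult_left_mono power_decreasing) auto
  also have "\<dots> = 2 * C / \<theta> ^ 8 * \<theta> ^ (8 * Suc i) * nrm M f"
    using \<theta> by (simp add: power_add)
  also have "\<dots> \<le> K * \<theta> ^ (8 * Suc i) * nrm M f"
    unfolding K_def using \<theta> B C
    by (intro mult_right_mono frac_le power_decreasing) auto
  finally show ?thesis by (simp only: i)
qed

text \<open>
  For \<open>j < k\<close> the adjoint \<open>D\<^sub>k D\<^sub>j\<close> has the same norm.
\<close>

lemma D_D_decay:
  assumes f: "in_L2 M f"
  shows "nrm M (D j (D k f)) \<le> 2 * K / \<theta> ^ 8 * \<theta> ^ (8 * nat \<bar>k - j\<bar>) * nrm M f"
proof -
  have main: "nrm M (D j (D k f)) \<le> 2 * K / \<theta> ^ 8 * \<theta> ^ (8 * nat (j - k)) * nrm M f"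
    if f: "in_L2 M f" and "k \<le> j" for f j k
  proof (rule nrm_le_by_duality)
    fix h assume h: "in_L2 M h"
    define i where "i = nat (j - k)"
    have i: "nat (j - (k - 1)) = Suc i" using that by (simp add: i_def)
    have "ip M (D j (D k f)) h = ip M (D k f) (D j h)"
      using f h by (simp add: D_selfadjoint D_L2)
    also have "\<dots> = ip M (S k f) (D j h) - ip M (S (k - 1) f) (D j h)"
      using f h by (subst D_def) (simp add: ip_diff_left S_L2 D_L2)
    also have "\<dots> = ip M (D j (S k f)) h - ip M (D j (S (k - 1) f)) h"
      using f h by (simp add: D_selfadjoint D_L2 S_L2)
    finally have "\<bar>ip M (D j (D k f)) h\<bar> \<le> nrm M (D j (S k f)) * nrm M h + nrm M (D j (S (k - 1) f)) * nrm M h"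
      using ip_Cauchy_Schwarz[of M "D j (S k f)" h] ip_Cauchy_Schwarz[of M "D j (S (k - 1) f)" h] f h
      by (simp add: D_L2 S_L2)
    also have "\<dots> \<le> K * \<theta> ^ (8 * i) * nrm M f * nrm M h + K * \<theta> ^ (8 * Suc i) * nrm M f * nrm M h"
      using D_S_decay[OF f, of k j] D_S_decay[OF f, of "k - 1" j] that
      by (intro add_mono mult_right_mono) (simp_all only: i i_def, simp_all)
    also have "\<dots> \<le> K * \<theta> ^ (8 * i) * nrm M f * nrm M h + K * \<theta> ^ (8 * i) * nrm M f * nrm M h"
      using \<theta> K_pos by (intro add_mono mult_right_mono mult_left_mono power_decreasing) auto
    also have "\<dots> = 2 * K / 1 * \<theta> ^ (8 * i) * nrm M f * nrm M h" by simp
    also have "\<dots> \<le> 2 * K / \<theta> ^ 8 * \<theta> ^ (8 * i) * nrm M f * nrm M h"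
      using \<theta> K_pos by (intro mult_right_mono frac_le) (auto intro: power_le_one)
    finally show "\<bar>ip M (D j (D k f)) h\<bar> \<le> 2 * K / \<theta> ^ 8 * \<theta> ^ (8 * nat (j - k)) * nrm M f * nrm M h"
      by (simp only: i_def)
  qed (use f K_pos \<theta> in \<open>simp_all add: D_L2\<close>)
  show ?thesis
  proof (cases "k \<le> j")
    case True
    then show ?thesis using main[OF f True] by simp
  next
    case False
    then have "j \<le> k" by simp
    show ?thesis
    proof (rule nrm_le_by_duality)
      fix h assume h: "in_L2 M h"
      have "ip M (D j (D k f)) h = ip M f (D k (D j h))"
        using f h by (simp add: D_selfadjoint D_L2)
      then have "\<bar>ip M (D j (D k f)) h\<bar> \<le> nrm M f * nrm M (D k (D j h))"
        using ip_Cauchy_Schwarz[of M f "D k (D j h)"] f h by (simp add: D_L2)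
      also have "\<dots> \<le> nrm M f * (2 * K / \<theta> ^ 8 * \<theta> ^ (8 * nat (k - j)) * nrm M h)"
        using main[OF h \<open>j \<le> k\<close>] by (intro mult_left_mono) auto
      also have "\<dots> = 2 * K / \<theta> ^ 8 * \<theta> ^ (8 * nat \<bar>k - j\<bar>) * nrm M f * nrm M h"
        using \<open>j \<le> k\<close> by (simp add: ac_simps)
      finally show "\<bar>ip M (D j (D k f)) h\<bar> \<le> 2 * K / \<theta> ^ 8 * \<theta> ^ (8 * nat \<bar>k - j\<bar>) * nrm M f * nrm M h" .
    qed (use f K_pos \<theta> in \<open>simp_all add: D_L2\<close>)
  qed
qed

definition K' where "K' = 2 * K / \<theta> ^ 8"

lemma K'_pos: "0 < K'"
  using K_pos \<theta> by (simp add: K'_def)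

lemma D_square_function:
  assumes "in_L2 M f" "finite F"
  shows "(\<Sum>k\<in>F. (nrm M (D k f))\<^sup>2) \<le> 2 * K' / (1 - \<theta> ^ 8) * (nrm M f)\<^sup>2"
proof (rule square_function_bound[where T' = D])
  show "nrm M (D l (D k u)) \<le> K' * (\<theta> ^ 8) ^ nat \<bar>k - l\<bar> * nrm M u" if "in_L2 M u" for k l u
    using D_D_decay[OF that, of l k] by (simp add: K'_def power_mult)
  show "\<theta> ^ 8 < 1" using \<theta> by (intro power_less_one_iff[THEN iffD2]) auto
qed (use assms \<theta> K'_pos in \<open>auto simp: D_L2 D_selfadjoint\<close>)

text \<open>
  The product \<open>D\<^sub>l\<^sub>+\<^sub>m D\<^sub>l D\<^sub>k D\<^sub>k\<^sub>+\<^sub>m\<close> is small because of the inner pair if \<open>|k - l|\<close> is large, and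
  because of the two outer pairs if \<open>|m|\<close> is large; the geometric mean of both bounds is used.
\<close>

lemma DD_square_function:
  assumes f: "in_L2 M f" and F: "finite F"
  shows "(\<Sum>k\<in>F. (nrm M (D (k + m) (D k f)))\<^sup>2)
    \<le> 2 * ((4 * B\<^sup>2 * K' + K'\<^sup>2) * \<theta> ^ (8 * nat \<bar>m\<bar>)) / (1 - \<theta> ^ 4) * (nrm M f)\<^sup>2"
proof (rule square_function_bound[where T' = "\<lambda>k g. D k (D (k + m) g)"])
  let ?L = "4 * B\<^sup>2 * K' + K'\<^sup>2"
  show "nrm M (D (l + m) (D l (D k (D (k + m) u))))
    \<le> ?L * \<theta> ^ (8 * nat \<bar>m\<bar>) * (\<theta> ^ 4) ^ nat \<bar>k - l\<bar> * nrm M u"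
    if u: "in_L2 M u" for k l u
  proof -
    let ?v = "D (k + m) u" and ?N = "nrm M u"
    have v: "in_L2 M ?v" using u by (rule D_L2)
    define p where "p = (\<theta> ^ 4) ^ nat \<bar>k - l\<bar>"
    define q where "q = \<theta> ^ (8 * nat \<bar>m\<bar>)"
    have p: "0 < p" "p\<^sup>2 = \<theta> ^ (8 * nat \<bar>k - l\<bar>)" and q: "0 < q"
      using \<theta> by (simp_all add: p_def q_def power_mult[symmetric] mult.commute)
    have "nrm M (D (l + m) (D l (D k ?v))) \<le> 2 * B * nrm M (D l (D k ?v))"
      by (rule D_bounded[OF D_L2[OF D_L2[OF v]]])
    also have "\<dots> \<le> 2 * B * (K' * p\<^sup>2 * nrm M ?v)"
      using D_D_decay[OF v, of l k] B by (intro mult_left_mono) (simp_all add: K'_def p)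
    also have "\<dots> \<le> 2 * B * (K' * p\<^sup>2 * (2 * B * ?N))"
      using D_bounded[OF u] B K'_pos by (intro mult_left_mono) auto
    also have "\<dots> = 4 * B\<^sup>2 * K' * ?N * p\<^sup>2"
      by (simp add: power2_eq_square)
    also have "\<dots> \<le> ?L * ?N * p\<^sup>2"
      by (intro mult_right_mono) auto
    finally have 1: "nrm M (D (l + m) (D l (D k ?v))) \<le> ?L * ?N * p\<^sup>2" .
    have "nrm M (D (l + m) (D l (D k ?v))) \<le> K' * q * nrm M (D k ?v)"
      using D_D_decay[OF D_L2[OF v], of "l + m" l k] by (simp add: K'_def q_def)
    also have "\<dots> \<le> K' * q * (K' * q * nrm M u)"
    proof (rule mult_left_mono)
      show "nrm M (D k ?v) \<le> K' * q * nrm M u"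
        using D_D_decay[OF u, of k "k + m"] by (simp add: K'_def q_def)
      show "0 \<le> K' * q" using K'_pos q by simp
    qed
    also have "\<dots> = K'\<^sup>2 * ?N * q\<^sup>2"
      by (simp add: power2_eq_square)
    also have "\<dots> \<le> ?L * ?N * q\<^sup>2"
      using K'_pos by (intro mult_right_mono) auto
    finally have 2: "nrm M (D (l + m) (D l (D k ?v))) \<le> ?L * ?N * q\<^sup>2" .
    have L: "0 \<le> ?L * ?N" using K'_pos by simp
    have "nrm M (D (l + m) (D l (D k ?v))) \<le> ?L * ?N * (p * q)"
    proof (cases "p \<le> q")
      case True
      then have "?L * ?N * p\<^sup>2 \<le> ?L * ?N * (p * q)"
        unfolding power2_eq_square[of p] using p L by (intro mult_left_mono) auto
      with 1 show ?thesis by linarith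
    next
      case False
      then have "?L * ?N * q\<^sup>2 \<le> ?L * ?N * (p * q)"
        unfolding power2_eq_square[of q] using q L by (intro mult_left_mono mult_right_mono) auto
      with 2 show ?thesis by linarith
    qed
    then show ?thesis by (simp add: p_def q_def ac_simps)
  qed
  show "\<theta> ^ 4 < 1" using \<theta> by (intro power_less_one_iff[THEN iffD2]) auto
  show "0 \<le> ?L * \<theta> ^ (8 * nat \<bar>m\<bar>)" using \<theta> K'_pos by auto
qed (use assms \<theta> K'_pos in \<open>auto simp: D_L2 D_selfadjoint\<close>)

text \<open>
  The contribution of the \<open>m\<close>-th off-diagonal to \<open>\<parallel>\<Sum> D\<^sub>k f\<parallel>\<^sup>2\<close>.  Pairing
  \<open>D\<^sub>l\<^sub>+\<^sub>m D\<^sub>k\<^sub>+\<^sub>m D\<^sub>k f\<close> with \<open>D\<^sub>l f\<close> shows that \<open>\<parallel>\<Sum> D\<^sub>k\<^sub>+\<^sub>m D\<^sub>k f\<parallel>\<^sup>2\<close> is controlled by square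
  functions; the first factor is small both because \<open>k - l\<close> is large and because the square
  function of \<open>D\<^sub>k\<^sub>+\<^sub>m D\<^sub>k\<close> is small, and the two gains are shared out.
\<close>

lemma off_diagonal_bound:
  obtains L where "0 < L"
    "\<And>f F m. in_L2 M f \<Longrightarrow> finite F \<Longrightarrow>
      \<bar>\<Sum>k\<in>F. ip M (D (k + m) f) (D k f)\<bar> \<le> L * \<theta> ^ nat \<bar>m\<bar> * (nrm M f)\<^sup>2"
proof -
  define c1 where "c1 = 2 * K' / (1 - \<theta> ^ 8)"
  define c2 where "c2 = 2 * (4 * B\<^sup>2 * K' + K'\<^sup>2) / (1 - \<theta> ^ 4)"
  define c3 where "c3 = 2 * B + K'"
  have th: "\<theta> ^ 4 < 1" "\<theta> ^ 8 < 1" using \<theta> by (intro power_less_one_iff[THEN iffD2]; simp)+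
  have c: "0 < c1" "0 < c2" "0 < c3"
    using K'_pos B th by (auto simp: c1_def c2_def c3_def intro!: add_pos_pos divide_pos_pos)
  define L2 where "L2 = c3 / (1 - \<theta> ^ 4) * (2 * (3 * c1 + c2))"
  have L2: "0 < L2" using c th by (simp add: L2_def)
  have main: "\<bar>\<Sum>k\<in>F. ip M (D (k + m) f) (D k f)\<bar> \<le> sqrt L2 * \<theta> ^ nat \<bar>m\<bar> * (nrm M f)\<^sup>2"
    if f: "in_L2 M f" and F: "finite F" for f F m
  proof -
    define \<delta> where "\<delta> = \<theta> ^ nat \<bar>m\<bar>"
    have \<delta>: "0 < \<delta>" "\<delta> \<le> 1" using \<theta> by (auto simp: \<delta>_def intro: power_le_one)
    define d where "d k = nrm M (D k f)" for k
    define t where "t k = nrm M (D (k + m) (D k f))" for k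
    define n2 where "n2 = (nrm M f)\<^sup>2"
    have dt: "0 \<le> d k" "0 \<le> t k" for k by (simp_all add: d_def t_def)
    have sd: "(\<Sum>k\<in>F. (d k)\<^sup>2) \<le> c1 * n2"
      using D_square_function[OF f F] by (simp add: d_def c1_def n2_def)
    have st: "(\<Sum>k\<in>F. (t k)\<^sup>2) \<le> c2 * \<delta> ^ 8 * n2"
    proof -
      have "2 * (L * \<theta> ^ (8 * nat \<bar>m\<bar>)) / x * y = 2 * L / x * \<delta> ^ 8 * y" for L x y :: real
        by (simp add: \<delta>_def mult.commute flip: power_mult)
      then show ?thesis
        using DD_square_function[OF f F, of m] by (simp only: t_def c2_def n2_def)
    qed
    have pair: "ip M (D (k + m) (D k f)) (D (l + m) (D l f))
      \<le> c3 * ((\<theta> ^ 4) ^ nat \<bar>k - l\<bar> * ((\<delta>\<^sup>2 * d k + t k / \<delta>\<^sup>2) * d l))" for k l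
    proof -
      let ?u = "D (k + m) (D k f)"
      have u: "in_L2 M ?u" using f by (intro D_L2)
      have "ip M ?u (D (l + m) (D l f)) = ip M (D (l + m) ?u) (D l f)"
        using f u by (simp add: D_L2 D_selfadjoint)
      also have "\<dots> \<le> nrm M (D (l + m) ?u) * d l"
        using ip_Cauchy_Schwarz[of M "D (l + m) ?u" "D l f"] f u by (simp add: d_def D_L2)
      finally have 1: "ip M ?u (D (l + m) (D l f)) \<le> nrm M (D (l + m) ?u) * d l" .
      have "nrm M (D (l + m) ?u) \<le> K' * \<theta> ^ (8 * nat \<bar>k - l\<bar>) * d k"
        using D_D_decay[OF D_L2[OF f], of "l + m" "k + m" k] by (simp add: K'_def d_def)
      also have "\<dots> \<le> c3 * \<theta> ^ (8 * nat \<bar>k - l\<bar>) * d k"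
        using B \<theta> by (intro mult_right_mono) (auto simp: c3_def d_def)
      also have "\<dots> = ((\<theta> ^ 4) ^ nat \<bar>k - l\<bar>)\<^sup>2 * (c3 * d k)"
        by (simp add: mult.commute flip: power_mult)
      finally have 2: "nrm M (D (l + m) ?u) \<le> ((\<theta> ^ 4) ^ nat \<bar>k - l\<bar>)\<^sup>2 * (c3 * d k)" .
      have "nrm M (D (l + m) ?u) \<le> 2 * B * t k"
        using D_bounded[OF u] by (simp add: t_def)
      also have "\<dots> \<le> c3 * t k"
        using K'_pos dt by (intro mult_right_mono) (auto simp: c3_def)
      finally have 3: "nrm M (D (l + m) ?u) \<le> c3 * t k" .
      have "nrm M (D (l + m) ?u) \<le> (\<theta> ^ 4) ^ nat \<bar>k - l\<bar> * (\<delta>\<^sup>2 * (c3 * d k) + (c3 * t k) / \<delta>\<^sup>2)"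
        using 2 3 \<theta> \<delta> c dt by (intro min_bound_split) auto
      then have "nrm M (D (l + m) ?u) * d l
          \<le> (\<theta> ^ 4) ^ nat \<bar>k - l\<bar> * (\<delta>\<^sup>2 * (c3 * d k) + (c3 * t k) / \<delta>\<^sup>2) * d l"
        using dt(1) by (rule mult_right_mono)
      also have "\<dots> = c3 * ((\<theta> ^ 4) ^ nat \<bar>k - l\<bar> * ((\<delta>\<^sup>2 * d k + t k / \<delta>\<^sup>2) * d l))"
        using \<delta> by (simp add: field_simps)
      finally show ?thesis using 1 by linarith
    qed
    have e: "(\<Sum>k\<in>F. (\<delta>\<^sup>2 * d k + t k / \<delta>\<^sup>2)\<^sup>2) \<le> 2 * (c1 + c2) * \<delta> ^ 4 * n2"
    proof -
      have "(\<delta>\<^sup>2 * d k + t k / \<delta>\<^sup>2)\<^sup>2 \<le> 2 * (\<delta> ^ 4 * (d k)\<^sup>2 + (t k)\<^sup>2 / \<delta> ^ 4)" for k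
        using sum_squares_bound[of "\<delta>\<^sup>2 * d k" "t k / \<delta>\<^sup>2"]
        by (simp add: power2_sum power_mult_distrib power_divide flip: power_mult)
      then have "(\<Sum>k\<in>F. (\<delta>\<^sup>2 * d k + t k / \<delta>\<^sup>2)\<^sup>2) \<le> (\<Sum>k\<in>F. 2 * (\<delta> ^ 4 * (d k)\<^sup>2 + (t k)\<^sup>2 / \<delta> ^ 4))"
        by (rule sum_mono)
      also have "\<dots> = 2 * (\<delta> ^ 4 * (\<Sum>k\<in>F. (d k)\<^sup>2) + (\<Sum>k\<in>F. (t k)\<^sup>2) / \<delta> ^ 4)"
        by (simp add: sum_distrib_left sum.distrib sum_divide_distrib distrib_left)
      also have "\<dots> \<le> 2 * (\<delta> ^ 4 * (c1 * n2) + (c2 * \<delta> ^ 8 * n2) / \<delta> ^ 4)"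
        using sd st \<delta> by (intro mult_left_mono add_mono divide_right_mono) auto
      also have "(c2 * \<delta> ^ 8 * n2) / \<delta> ^ 4 = c2 * \<delta> ^ 4 * n2"
        using \<delta> by (simp add: field_simps flip: power_add)
      finally show ?thesis by (simp add: algebra_simps)
    qed
    \<comment> \<open>The power \<open>\<delta>\<^sup>4\<close> gained in the first factor is split evenly between the two.\<close>
    define e' where "e' k = (\<delta>\<^sup>2 * d k + t k / \<delta>\<^sup>2) / \<delta>" for k
    define d' where "d' k = \<delta> * d k" for k
    have e'0: "0 \<le> e' k" "0 \<le> d' k" for k using dt \<delta> by (simp_all add: e'_def d'_def)
    have e'd': "(\<Sum>k\<in>F. (e' k)\<^sup>2) \<le> 2 * (c1 + c2) * \<delta>\<^sup>2 * n2" "(\<Sum>k\<in>F. (d' k)\<^sup>2) \<le> c1 * \<delta>\<^sup>2 * n2"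
    proof -
      have "(\<Sum>k\<in>F. (e' k)\<^sup>2) = (\<Sum>k\<in>F. (\<delta>\<^sup>2 * d k + t k / \<delta>\<^sup>2)\<^sup>2) / \<delta>\<^sup>2"
        by (simp add: e'_def power_divide sum_divide_distrib)
      also have "\<dots> \<le> (2 * (c1 + c2) * \<delta> ^ 4 * n2) / \<delta>\<^sup>2"
        using e by (rule divide_right_mono) simp
      also have "\<dots> = 2 * (c1 + c2) * \<delta>\<^sup>2 * n2"
        using \<delta> by (simp add: power2_eq_square power4_eq_xxxx)
      finally show "(\<Sum>k\<in>F. (e' k)\<^sup>2) \<le> 2 * (c1 + c2) * \<delta>\<^sup>2 * n2" .
      have "(\<Sum>k\<in>F. (d' k)\<^sup>2) = \<delta>\<^sup>2 * (\<Sum>k\<in>F. (d k)\<^sup>2)"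
        by (simp add: d'_def power_mult_distrib sum_distrib_left)
      also have "\<dots> \<le> \<delta>\<^sup>2 * (c1 * n2)" using sd by (rule mult_left_mono) simp
      finally show "(\<Sum>k\<in>F. (d' k)\<^sup>2) \<le> c1 * \<delta>\<^sup>2 * n2" by (simp add: ac_simps)
    qed
    have "(\<Sum>k\<in>F. \<Sum>l\<in>F. ip M (D (k + m) (D k f)) (D (l + m) (D l f)))
        \<le> (\<Sum>k\<in>F. \<Sum>l\<in>F. c3 * ((\<theta> ^ 4) ^ nat \<bar>k - l\<bar> * (e' k * d' l)))"
    proof (intro sum_mono)
      fix k l
      have "(\<delta>\<^sup>2 * d k + t k / \<delta>\<^sup>2) * d l = e' k * d' l" using \<delta> by (simp add: e'_def d'_def)
      then show "ip M (D (k + m) (D k f)) (D (l + m) (D l f))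
          \<le> c3 * ((\<theta> ^ 4) ^ nat \<bar>k - l\<bar> * (e' k * d' l))"
        using pair[of k l] by simp
    qed
    also have "\<dots> = c3 * (\<Sum>k\<in>F. \<Sum>l\<in>F. (\<theta> ^ 4) ^ nat \<bar>k - l\<bar> * (e' k * d' l))"
      by (simp add: sum_distrib_left)
    also have "\<dots> \<le> c3 * (1 / (1 - \<theta> ^ 4) * ((\<Sum>k\<in>F. (e' k)\<^sup>2) + (\<Sum>k\<in>F. (d' k)\<^sup>2)))"
      using F \<theta> th e'0 c by (intro mult_left_mono sum_geometric_Schur) auto
    also have "\<dots> \<le> c3 * (1 / (1 - \<theta> ^ 4) * (2 * (c1 + c2) * \<delta>\<^sup>2 * n2 + c1 * \<delta>\<^sup>2 * n2))"
      using e'd' c th by (intro mult_left_mono add_mono) auto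
    also have "\<dots> \<le> c3 * (1 / (1 - \<theta> ^ 4) * (2 * (3 * c1 + c2) * \<delta>\<^sup>2 * n2))"
      using c th by (intro mult_left_mono) (auto simp: algebra_simps n2_def)
    also have "\<dots> = L2 * \<delta>\<^sup>2 * n2"
      by (simp add: L2_def)
    finally have sq: "(\<Sum>k\<in>F. \<Sum>l\<in>F. ip M (D (k + m) (D k f)) (D (l + m) (D l f))) \<le> L2 * \<delta>\<^sup>2 * n2" .
    have "(\<Sum>k\<in>F. ip M (D (k + m) f) (D k f)) = (\<Sum>k\<in>F. ip M f (D (k + m) (D k f)))"
      using f by (simp add: D_L2 D_selfadjoint)
    then have "(\<Sum>k\<in>F. ip M (D (k + m) f) (D k f))\<^sup>2
        \<le> n2 * (\<Sum>k\<in>F. \<Sum>l\<in>F. ip M (D (k + m) (D k f)) (D (l + m) (D l f)))"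
      using sum_ip_le[of M f F "\<lambda>k. D (k + m) (D k f)"] f by (simp add: n2_def D_L2)
    also have "\<dots> \<le> n2 * (L2 * \<delta>\<^sup>2 * n2)"
      using sq by (rule mult_left_mono) (simp add: n2_def)
    also have "\<dots> = (sqrt L2 * \<delta> * n2)\<^sup>2"
      using L2 by (simp add: power_mult_distrib power2_eq_square)
    finally have "\<bar>\<Sum>k\<in>F. ip M (D (k + m) f) (D k f)\<bar> \<le> sqrt L2 * \<delta> * n2"
      using \<delta> L2 by (simp add: abs_le_square_iff[symmetric] n2_def abs_mult)
    then show ?thesis by (simp add: \<delta>_def n2_def)
  qed
  show ?thesis using that[of "sqrt L2"] main L2 by auto
qed

lemma diagonal_splitting:
  fixes a :: "int \<Rightarrow> int \<Rightarrow> real"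
  assumes N: "0 \<le> N" and F: "finite F"
  shows "(\<Sum>j\<in>F. \<Sum>k\<in>F. a j k)
    = (\<Sum>j\<in>F. \<Sum>k\<in>F. if \<bar>j - k\<bar> \<le> N then a j k else 0)
    + (\<Sum>m\<in>{m \<in> (\<lambda>(j, k). j - k) ` (F \<times> F). N < \<bar>m\<bar>}. \<Sum>k\<in>{k \<in> F. k + m \<in> F}. a (k + m) k)"
proof -
  let ?G = "{(j, k) \<in> F \<times> F. N < \<bar>j - k\<bar>}"
  have fin: "finite ?G" using F by (auto intro: finite_subset[of _ "F \<times> F"])
  have "(\<Sum>j\<in>F. \<Sum>k\<in>F. a j k) = (\<Sum>j\<in>F. \<Sum>k\<in>F. (if \<bar>j - k\<bar> \<le> N then a j k else 0) +
      (if N < \<bar>j - k\<bar> then a j k else 0))"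
    by (intro sum.cong) auto
  also have "\<dots> = (\<Sum>j\<in>F. \<Sum>k\<in>F. if \<bar>j - k\<bar> \<le> N then a j k else 0)
      + (\<Sum>(j, k)\<in>F \<times> F. if N < \<bar>j - k\<bar> then a j k else 0)"
    by (simp add: sum.distrib sum.cartesian_product)
  also have "(\<Sum>(j, k)\<in>F \<times> F. if N < \<bar>j - k\<bar> then a j k else 0) = (\<Sum>(j, k)\<in>?G. a j k)"
    using F by (intro sum.mono_neutral_cong_right) (auto split: if_splits)
  also have "\<dots> = (\<Sum>m\<in>(\<lambda>(j, k). j - k) ` ?G. \<Sum>p\<in>{p \<in> ?G. (\<lambda>(j, k). j - k) p = m}. case p of (j, k) \<Rightarrow> a j k)"
    using sum.image_gen[OF fin, of "\<lambda>(j, k). a j k" "\<lambda>(j, k). j - k"] .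
  also have "(\<lambda>(j, k). j - k) ` ?G = {m \<in> (\<lambda>(j, k). j - k) ` (F \<times> F). N < \<bar>m\<bar>}"
    by (auto simp: image_iff)
  also have "(\<Sum>m\<in>{m \<in> (\<lambda>(j, k). j - k) ` (F \<times> F). N < \<bar>m\<bar>}.
        \<Sum>p\<in>{p \<in> ?G. (\<lambda>(j, k). j - k) p = m}. case p of (j, k) \<Rightarrow> a j k)
      = (\<Sum>m\<in>{m \<in> (\<lambda>(j, k). j - k) ` (F \<times> F). N < \<bar>m\<bar>}. \<Sum>k\<in>{k \<in> F. k + m \<in> F}. a (k + m) k)"
  proof (rule sum.cong[OF refl])
    fix m assume m: "m \<in> {m \<in> (\<lambda>(j, k). j - k) ` (F \<times> F). N < \<bar>m\<bar>}"
    show "(\<Sum>p\<in>{p \<in> ?G. (\<lambda>(j, k). j - k) p = m}. case p of (j, k) \<Rightarrow> a j k)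
      = (\<Sum>k\<in>{k \<in> F. k + m \<in> F}. a (k + m) k)"
      using m by (intro sum.reindex_bij_witness[of _ "\<lambda>k. (k + m, k)" snd]) (auto simp: algebra_simps)
  qed
  finally show ?thesis .
qed

lemma near_diagonal_bound:
  fixes a :: "int \<Rightarrow> int \<Rightarrow> real"
  assumes F: "finite F" and a: "\<And>j k. a j k \<le> d j * d k"
  shows "(\<Sum>j\<in>F. \<Sum>k\<in>F. if \<bar>j - k\<bar> \<le> int N then a j k else 0) \<le> (2 * real N + 1) * (\<Sum>k\<in>F. (d k)\<^sup>2)"
proof -
  have card: "card {k \<in> F. \<bar>j - k\<bar> \<le> int N} \<le> 2 * N + 1" for j
  proof -
    have "card {k \<in> F. \<bar>j - k\<bar> \<le> int N} \<le> card {j - int N..j + int N}"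
      by (intro card_mono) auto
    then show ?thesis by simp
  qed
  have row: "(\<Sum>k\<in>F. if \<bar>j - k\<bar> \<le> int N then (d j)\<^sup>2 / 2 else 0) \<le> (2 * real N + 1) * ((d j)\<^sup>2 / 2)" for j
  proof -
    have "(\<Sum>k\<in>F. if \<bar>j - k\<bar> \<le> int N then (d j)\<^sup>2 / 2 else 0)
        = real (card {k \<in> F. \<bar>j - k\<bar> \<le> int N}) * ((d j)\<^sup>2 / 2)"
      using F by (simp add: sum.If_cases Int_def)
    also have "\<dots> \<le> (2 * real N + 1) * ((d j)\<^sup>2 / 2)"
      using card[of j] by (intro mult_right_mono) (linarith, simp)
    finally show ?thesis .
  qed
  have "(\<Sum>j\<in>F. \<Sum>k\<in>F. if \<bar>j - k\<bar> \<le> int N then a j k else 0)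
      \<le> (\<Sum>j\<in>F. \<Sum>k\<in>F. (if \<bar>j - k\<bar> \<le> int N then (d j)\<^sup>2 / 2 else 0) +
                         (if \<bar>k - j\<bar> \<le> int N then (d k)\<^sup>2 / 2 else 0))"
  proof (intro sum_mono)
    fix j k
    have "a j k \<le> (d j)\<^sup>2 / 2 + (d k)\<^sup>2 / 2"
      using a[of j k] sum_squares_bound[of "d j" "d k"] by (simp add: field_simps)
    then show "(if \<bar>j - k\<bar> \<le> int N then a j k else 0)
      \<le> (if \<bar>j - k\<bar> \<le> int N then (d j)\<^sup>2 / 2 else 0) + (if \<bar>k - j\<bar> \<le> int N then (d k)\<^sup>2 / 2 else 0)"
      by (simp add: abs_minus_commute)
  qed
  also have "\<dots> = (\<Sum>j\<in>F. \<Sum>k\<in>F. if \<bar>j - k\<bar> \<le> int N then (d j)\<^sup>2 / 2 else 0)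
      + (\<Sum>k\<in>F. \<Sum>j\<in>F. if \<bar>k - j\<bar> \<le> int N then (d k)\<^sup>2 / 2 else 0)"
    by (simp only: sum.distrib) (subst (2) sum.swap, rule refl)
  also have "\<dots> \<le> (\<Sum>j\<in>F. (2 * real N + 1) * ((d j)\<^sup>2 / 2)) + (\<Sum>j\<in>F. (2 * real N + 1) * ((d j)\<^sup>2 / 2))"
    by (intro add_mono sum_mono row)
  also have "\<dots> = (2 * real N + 1) * (\<Sum>k\<in>F. (d k)\<^sup>2)"
    unfolding sum_distrib_left sum.distrib[symmetric] by (intro sum.cong) auto
  finally show ?thesis .
qed

lemma sum_D_telescope: "(\<Sum>k\<in>{- int i..int i}. D k f x) = S (int i) f x - S (- int i - 1) f x"
proof -
  have "(\<Sum>k\<in>{- int i..- int i + int p}. D k f x) = S (- int i + int p) f x - S (- int i - 1) f x" for p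
  proof (induction p)
    case (Suc p)
    have "{- int i..- int i + int (Suc p)} = insert (- int i + int p + 1) {- int i..- int i + int p}"
      by auto
    then show ?case using Suc by (simp add: D_def algebra_simps)
  qed (simp add: D_def)
  from this[of "2 * i"] show ?thesis by simp
qed

lemma sum_far_geometric:
  assumes "finite G" "\<And>m. m \<in> G \<Longrightarrow> int N < \<bar>m\<bar>"
  shows "(\<Sum>m\<in>G. \<theta> ^ nat \<bar>m\<bar>) \<le> \<theta> ^ N * (2 / (1 - \<theta>))"
proof -
  let ?s = "\<lambda>m. if 0 < m then m - int N else m + int N"
  have "(\<Sum>m\<in>G. \<theta> ^ nat \<bar>m\<bar>) = (\<Sum>m\<in>G. \<theta> ^ N * \<theta> ^ (nat \<bar>m\<bar> - N))"
    proof (intro sum.cong refl)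
    fix m assume "m \<in> G"
    then have "nat \<bar>m\<bar> = N + (nat \<bar>m\<bar> - N)" using assms(2)[of m] by simp
    then show "\<theta> ^ nat \<bar>m\<bar> = \<theta> ^ N * \<theta> ^ (nat \<bar>m\<bar> - N)" by (metis power_add)
  qed
  also have "\<dots> = \<theta> ^ N * (\<Sum>m\<in>G. \<theta> ^ nat \<bar>0 - ?s m\<bar>)"
    unfolding sum_distrib_left
  proof (intro sum.cong refl)
    fix m assume "m \<in> G"
    then have "nat \<bar>m\<bar> - N = nat \<bar>0 - ?s m\<bar>" using assms(2)[of m] by auto
    then show "\<theta> ^ N * \<theta> ^ (nat \<bar>m\<bar> - N) = \<theta> ^ N * \<theta> ^ nat \<bar>0 - ?s m\<bar>" by simp
  qed
  also have "(\<Sum>m\<in>G. \<theta> ^ nat \<bar>0 - ?s m\<bar>) = (\<Sum>m\<in>?s ` G. \<theta> ^ nat \<bar>0 - m\<bar>)"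
  proof (subst sum.reindex)
    show "inj_on ?s G"
    proof (rule inj_onI)
      fix x y assume "x \<in> G" "y \<in> G" "?s x = ?s y"
      then show "x = y" using assms(2)[of x] assms(2)[of y] by (auto split: if_splits)
    qed
  qed simp
  also have "\<dots> \<le> 2 / (1 - \<theta>)"
    using assms(1) \<theta> by (intro sum_geometric_int_le) auto
  finally show ?thesis using \<theta> by simp
qed

text \<open>
  The last two parts are the upper and the lower square function estimate, stated with finite sums
  and an arbitrary common bound \<open>b\<close> for them so that no convergence has to be discussed.  For the
  lower estimate \<open>f\<close> is approximated by \<open>S\<^sub>i f - S\<^sub>-\<^sub>i\<^sub>-\<^sub>1 f = \<Sum> D\<^sub>k f\<close>, and in the expansion of the square
  of its norm the diagonals with \<open>|m| > N\<close> are absorbed into the left-hand side.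
\<close>

theorem square_function_equivalence:
  obtains c where "0 < c"
    "\<And>f F. in_L2 M f \<Longrightarrow> finite F \<Longrightarrow> (\<Sum>k\<in>F. (nrm M (D k f))\<^sup>2) \<le> c * (nrm M f)\<^sup>2"
    "\<And>f b. in_L2 M f \<Longrightarrow> (\<And>F. finite F \<Longrightarrow> (\<Sum>k\<in>F. (nrm M (D k f))\<^sup>2) \<le> b) \<Longrightarrow> (nrm M f)\<^sup>2 \<le> c * b"
proof -
  obtain L where L: "0 < L"
    "\<And>f F m. in_L2 M f \<Longrightarrow> finite F \<Longrightarrow>
      \<bar>\<Sum>k\<in>F. ip M (D (k + m) f) (D k f)\<bar> \<le> L * \<theta> ^ nat \<bar>m\<bar> * (nrm M f)\<^sup>2"
    using off_diagonal_bound by blast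
  have "(\<lambda>N. L * (\<theta> ^ N * (2 / (1 - \<theta>)))) \<longlonglongrightarrow> L * (0 * (2 / (1 - \<theta>)))"
    using \<theta> by (intro tendsto_intros LIMSEQ_power_zero) auto
  then have "eventually (\<lambda>N. L * (\<theta> ^ N * (2 / (1 - \<theta>))) < 1 / 2) sequentially"
    by (rule order_tendstoD) simp
  then obtain N where N: "L * (\<theta> ^ N * (2 / (1 - \<theta>))) < 1 / 2"
    by (auto simp: eventually_sequentially)
  define c where "c = 2 * K' / (1 - \<theta> ^ 8) + 2 * (2 * real N + 1)"
  have th: "\<theta> ^ 8 < 1" using \<theta> by (intro power_less_one_iff[THEN iffD2]) auto
  have c0: "0 \<le> 2 * K' / (1 - \<theta> ^ 8)" using K'_pos th by simp
  show ?thesis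
  proof (rule that[of c])
    show "0 < c" using c0 by (simp add: c_def add_nonneg_pos)
    show "(\<Sum>k\<in>F. (nrm M (D k f))\<^sup>2) \<le> c * (nrm M f)\<^sup>2" if "in_L2 M f" "finite F" for f F
    proof -
      have "2 * K' / (1 - \<theta> ^ 8) * (nrm M f)\<^sup>2 \<le> c * (nrm M f)\<^sup>2"
        by (intro mult_right_mono) (auto simp: c_def)
      with D_square_function[OF that] show ?thesis by linarith
    qed
    show "(nrm M f)\<^sup>2 \<le> c * b" if f: "in_L2 M f"
      and b: "\<And>F. finite F \<Longrightarrow> (\<Sum>k\<in>F. (nrm M (D k f))\<^sup>2) \<le> b" for f b
    proof -
      have b0: "0 \<le> b" using b[of "{}"] by simp
      define g where "g i = (\<lambda>x. \<Sum>k\<in>{- int i..int i}. D k f x)" for i :: nat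
      have g: "in_L2 M (g i)" for i unfolding g_def using f by (intro in_L2_sum D_L2)
      have bound: "(nrm M (g i))\<^sup>2 \<le> (2 * real N + 1) * b + (nrm M f)\<^sup>2 / 2" for i
      proof -
        let ?F = "{- int i..int i}" and ?a = "\<lambda>j k. ip M (D j f) (D k f)"
        let ?G = "{m \<in> (\<lambda>(j, k). j - k) ` (?F \<times> ?F). int N < \<bar>m\<bar>}"
        have "(nrm M (g i))\<^sup>2 = (\<Sum>j\<in>?F. \<Sum>k\<in>?F. ?a j k)"
          using f g[of i] unfolding nrm_square
          by (simp add: g_def ip_sum_left ip_sum_right D_L2)
        also have "\<dots> = (\<Sum>j\<in>?F. \<Sum>k\<in>?F. if \<bar>j - k\<bar> \<le> int N then ?a j k else 0)
            + (\<Sum>m\<in>?G. \<Sum>k\<in>{k \<in> ?F. k + m \<in> ?F}. ?a (k + m) k)"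
          by (rule diagonal_splitting) auto
        also have "(\<Sum>j\<in>?F. \<Sum>k\<in>?F. if \<bar>j - k\<bar> \<le> int N then ?a j k else 0)
            \<le> (2 * real N + 1) * (\<Sum>k\<in>?F. (nrm M (D k f))\<^sup>2)"
        proof (rule near_diagonal_bound)
          show "?a j k \<le> nrm M (D j f) * nrm M (D k f)" for j k
            using ip_Cauchy_Schwarz[of M "D j f" "D k f"] f by (simp add: D_L2)
        qed simp
        also have "\<dots> \<le> (2 * real N + 1) * b"
          by (intro mult_left_mono b) auto
        also have "(\<Sum>m\<in>?G. \<Sum>k\<in>{k \<in> ?F. k + m \<in> ?F}. ?a (k + m) k)
            \<le> (\<Sum>m\<in>?G. L * \<theta> ^ nat \<bar>m\<bar> * (nrm M f)\<^sup>2)"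
        proof (rule sum_mono)
          fix m
          have "finite {k \<in> ?F. k + m \<in> ?F}" by (rule finite_subset[of _ ?F]) auto
          from L(2)[OF f this, of m] show "(\<Sum>k\<in>{k \<in> ?F. k + m \<in> ?F}. ?a (k + m) k)
            \<le> L * \<theta> ^ nat \<bar>m\<bar> * (nrm M f)\<^sup>2" by linarith
        qed
        also have "\<dots> = L * (\<Sum>m\<in>?G. \<theta> ^ nat \<bar>m\<bar>) * (nrm M f)\<^sup>2"
          by (simp add: sum_distrib_left sum_distrib_right)
        also have "\<dots> \<le> L * (\<theta> ^ N * (2 / (1 - \<theta>))) * (nrm M f)\<^sup>2"
          using L by (intro mult_right_mono mult_left_mono sum_far_geometric) auto
        also have "\<dots> \<le> (1 / 2) * (nrm M f)\<^sup>2"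
          using N by (intro mult_right_mono) auto
        finally show ?thesis by simp
      qed
      have diff: "nrm M f \<le> nrm M (g i) + (nrm M (\<lambda>x. S (int i) f x - f x) + nrm M (S (- int (Suc i)) f))" for i
      proof -
        let ?u = "\<lambda>x. S (int i) f x - f x" and ?v = "S (- int (Suc i)) f"
        have uv: "in_L2 M ?u" "in_L2 M ?v" using f by (auto intro: S_L2 in_L2_diff)
        have "- int (Suc i) = - int i - 1" by simp
        then have "f = (\<lambda>x. g i x - (?u x - ?v x))"
          by (simp only:) (simp add: g_def sum_D_telescope)
        then have "nrm M f \<le> nrm M (g i) + nrm M (\<lambda>x. ?u x - ?v x)"
          using nrm_triangle_diff[OF g in_L2_diff[OF uv], of i] by simp
        also have "\<dots> \<le> nrm M (g i) + (nrm M ?u + nrm M ?v)"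
          using nrm_triangle_diff[OF uv] by simp
        finally show ?thesis .
      qed
      define s where "s = sqrt ((2 * real N + 1) * b + (nrm M f)\<^sup>2 / 2)"
      have "nrm M f \<le> s + (nrm M (\<lambda>x. S (int i) f x - f x) + nrm M (S (- int (Suc i)) f))" for i
        using diff[of i] real_le_rsqrt[OF bound[of i]] by (simp add: s_def)
      moreover have "(\<lambda>i. s + (nrm M (\<lambda>x. S (int i) f x - f x) + nrm M (S (- int (Suc i)) f)))
          \<longlonglongrightarrow> s + (0 + 0)"
        using f by (intro tendsto_intros S_top LIMSEQ_Suc[OF S_bot])
      ultimately have "nrm M f \<le> s"
        using LIMSEQ_le_const[of "\<lambda>i. s + (nrm M (\<lambda>x. S (int i) f x - f x) + nrm M (S (- int (Suc i)) f))" s "nrm M f"]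
        by auto
      then have "(nrm M f)\<^sup>2 \<le> s\<^sup>2" by (rule power_mono) simp
      also have "s\<^sup>2 = (2 * real N + 1) * b + (nrm M f)\<^sup>2 / 2"
        using b0 by (simp add: s_def)
      finally have "(nrm M f)\<^sup>2 \<le> 2 * (2 * real N + 1) * b" by argo
      also have "\<dots> \<le> c * b" using b0 c0 by (intro mult_right_mono) (auto simp: c_def)
      finally show ?thesis .
    qed
  qed
qed

end

section \<open>Positive kernels with a diagonal part\<close>

text \<open>
  The operator with kernel \<open>K\<close> and an additional multiplication by \<open>d\<close>: integration at \<open>x\<close> against
  the measure \<open>K x y d\<mu>(y) + d(x) \<delta>\<^sub>x\<close>.  Its counterpart \<open>nkop\<close> acts on functions with values in
  \<open>[0, \<infinity>]\<close>, where integrability is not an issue.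
\<close>

definition kop :: "'a measure \<Rightarrow> ('a \<Rightarrow> 'a \<Rightarrow> real) \<Rightarrow> ('a \<Rightarrow> real) \<Rightarrow> ('a \<Rightarrow> real) \<Rightarrow> 'a \<Rightarrow> real" where
  "kop M K d f x = (LINT y|M. K x y * f y) + d x * f x"

definition nkop :: "'a measure \<Rightarrow> ('a \<Rightarrow> 'a \<Rightarrow> real) \<Rightarrow> ('a \<Rightarrow> real) \<Rightarrow> ('a \<Rightarrow> ennreal) \<Rightarrow> 'a \<Rightarrow> ennreal" where
  "nkop M K d u x = (\<integral>\<^sup>+y. ennreal (K x y) * u y \<partial>M) + ennreal (d x) * u x"

text \<open>
  Cauchy-Schwarz in the plane, for the two parts (absolutely continuous and atomic) of the measures
  above.
\<close>

lemma ennreal_square_add_le: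
  fixes A1 A2 B1 B2 A B :: ennreal
  assumes "A\<^sup>2 \<le> A1 * A2" "B\<^sup>2 \<le> B1 * B2" "A1 + B1 \<le> ennreal a" "0 < a"
  shows "(A + B)\<^sup>2 \<le> ennreal a * (A2 + B2)"
proof (cases "A2 + B2 = top")
  case True
  then have "ennreal a * (A2 + B2) = top"
    using assms(4) by (simp only: ennreal_mult_eq_top_iff) simp
  then show ?thesis by simp
next
  case False
  then have f: "A2 < top" "B2 < top" by (auto simp: less_top)
  have "A1 + B1 < top" using assms(3) by (rule order.strict_trans1) simp
  then have "A1 < top" "B1 < top" by (auto simp: less_top)
  with f obtain a1 a2 b1 b2 where r: "A1 = ennreal a1" "A2 = ennreal a2" "B1 = ennreal b1" "B2 = ennreal b2"
    and nn: "0 \<le> a1" "0 \<le> a2" "0 \<le> b1" "0 \<le> b2"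
    by (metis ennreal_cases less_irrefl)
  have "A\<^sup>2 < top" "B\<^sup>2 < top"
    using assms(1,2) r nn by (auto simp: ennreal_mult[symmetric] intro: order.strict_trans1)
  then have "A \<noteq> top" "B \<noteq> top" by (auto simp: power2_eq_square)
  then obtain \<alpha> \<beta> where ab: "A = ennreal \<alpha>" "B = ennreal \<beta>" "0 \<le> \<alpha>" "0 \<le> \<beta>"
    by (metis ennreal_cases)
  have 1: "\<alpha>\<^sup>2 \<le> a1 * a2" "\<beta>\<^sup>2 \<le> b1 * b2" "a1 + b1 \<le> a"
    using assms r nn ab by (auto simp: ennreal_mult[symmetric] ennreal_power ennreal_plus[symmetric] simp del: ennreal_plus)
  have "(\<alpha> * \<beta>)\<^sup>2 \<le> (a1 * a2) * (b1 * b2)"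
    unfolding power_mult_distrib using 1 nn by (intro mult_mono) auto
  also have "\<dots> \<le> ((a1 * b2 + b1 * a2) / 2)\<^sup>2"
    using sum_squares_bound[of "a1 * b2" "b1 * a2"] by (simp add: power2_eq_square field_simps)
  finally have "\<alpha> * \<beta> \<le> (a1 * b2 + b1 * a2) / 2"
    by (rule power2_le_imp_le) (use nn in auto)
  then have "(\<alpha> + \<beta>)\<^sup>2 \<le> (a1 + b1) * (a2 + b2)"
    using 1 by (simp add: power2_sum algebra_simps)
  also have "\<dots> \<le> a * (a2 + b2)" using 1 nn by (intro mult_right_mono) auto
  finally have "ennreal ((\<alpha> + \<beta>)\<^sup>2) \<le> ennreal (a * (a2 + b2))" by (rule ennreal_leI)
  then show ?thesis
    using ab r nn assms(4) by (simp add: ennreal_mult ennreal_power[symmetric])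
qed

locale positive_kernel = sigma_finite_measure M
  for M :: "'a measure" +
  fixes K :: "'a \<Rightarrow> 'a \<Rightarrow> real" and d :: "'a \<Rightarrow> real" and X :: "'a set" and a b :: real
  assumes K_measurable: "(\<lambda>(x, y). K x y) \<in> borel_measurable (M \<Otimes>\<^sub>M M)"
    and d_measurable [measurable]: "d \<in> borel_measurable M"
    and AE_X: "AE x in M. x \<in> X"
    and X_space: "X \<subseteq> space M"
    and K_nonneg: "\<And>x y. x \<in> X \<Longrightarrow> y \<in> X \<Longrightarrow> 0 \<le> K x y"
    and d_nonneg: "\<And>x. x \<in> X \<Longrightarrow> 0 \<le> d x"
    \<comment> \<open>The hypotheses of the Schur test.\<close>
    and row: "\<And>x. x \<in> X \<Longrightarrow> (\<integral>\<^sup>+y. ennreal (K x y) \<partial>M) + ennreal (d x) \<le> ennreal a"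
    and col: "\<And>y. y \<in> X \<Longrightarrow> (\<integral>\<^sup>+x. ennreal (K x y) \<partial>M) + ennreal (d y) \<le> ennreal b"
    and a: "0 < a" and b: "0 < b"
begin

lemma K_measurable_comp [measurable (raw)]:
  assumes "u \<in> measurable N M" "v \<in> measurable N M"
  shows "(\<lambda>w. K (u w) (v w)) \<in> borel_measurable N"
  using measurable_compose[OF measurable_Pair[OF assms] K_measurable] by simp

lemma K_measurable1: "x \<in> space M \<Longrightarrow> (\<lambda>y. K x y) \<in> borel_measurable M"
  by (rule K_measurable_comp) auto

lemma nkop_measurable [measurable]:
  assumes [measurable]: "u \<in> borel_measurable M"
  shows "nkop M K d u \<in> borel_measurable M"
  unfolding nkop_def by measurable

lemma kop_measurable [measurable]:
  assumes [measurable]: "f \<in> borel_measurable M"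
  shows "kop M K d f \<in> borel_measurable M"
  unfolding kop_def by measurable

lemma nn_integral_nkop_le:
  assumes u [measurable]: "u \<in> borel_measurable M"
  shows "(\<integral>\<^sup>+x. nkop M K d u x \<partial>M) \<le> ennreal b * (\<integral>\<^sup>+y. u y \<partial>M)"
proof -
  interpret pair_sigma_finite M M ..
  have "(\<integral>\<^sup>+x. nkop M K d u x \<partial>M)
      = (\<integral>\<^sup>+x. (\<integral>\<^sup>+y. ennreal (K x y) * u y \<partial>M) \<partial>M) + (\<integral>\<^sup>+x. ennreal (d x) * u x \<partial>M)"
    unfolding nkop_def by (intro nn_integral_add) measurable
  also have "(\<integral>\<^sup>+x. (\<integral>\<^sup>+y. ennreal (K x y) * u y \<partial>M) \<partial>M) = (\<integral>\<^sup>+y. (\<integral>\<^sup>+x. ennreal (K x y) * u y \<partial>M) \<partial>M)"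
    by (rule Fubini') measurable
  also have "\<dots> = (\<integral>\<^sup>+y. (\<integral>\<^sup>+x. ennreal (K x y) \<partial>M) * u y \<partial>M)"
    by (intro nn_integral_cong nn_integral_multc) measurable
  also have "\<dots> + (\<integral>\<^sup>+x. ennreal (d x) * u x \<partial>M)
      = (\<integral>\<^sup>+y. ((\<integral>\<^sup>+x. ennreal (K x y) \<partial>M) + ennreal (d y)) * u y \<partial>M)"
    by (subst nn_integral_add[symmetric]) (measurable, simp add: distrib_right)
  also have "\<dots> \<le> (\<integral>\<^sup>+y. ennreal b * u y \<partial>M)"
    using AE_X by (intro nn_integral_mono_AE) (auto elim!: eventually_mono intro!: mult_right_mono col)
  also have "\<dots> = ennreal b * (\<integral>\<^sup>+y. u y \<partial>M)"
    by (rule nn_integral_cmult) measurable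
  finally show ?thesis .
qed

text \<open>Cauchy-Schwarz for the positive measure \<open>K x y d\<mu>(y) + d(x) \<delta>\<^sub>x\<close>.\<close>

lemma kop_square_le:
  assumes x: "x \<in> X" and f [measurable]: "f \<in> borel_measurable M"
  shows "ennreal ((kop M K d f x)\<^sup>2) \<le> ennreal a * nkop M K d (\<lambda>y. ennreal ((f y)\<^sup>2)) x"
proof -
  have xs: "x \<in> space M" using x X_space by auto
  note [measurable] = K_measurable1[OF xs]
  let ?A = "\<integral>\<^sup>+y. ennreal \<bar>K x y * f y\<bar> \<partial>M" and ?B = "ennreal (d x * \<bar>f x\<bar>)"
  have "ennreal \<bar>LINT y|M. K x y * f y\<bar> \<le> ?A"
    using integral_norm_bound_ennreal[of M "\<lambda>y. K x y * f y"]
    by (cases "integrable M (\<lambda>y. K x y * f y)") (auto simp: not_integrable_integral_eq)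
  then have "ennreal \<bar>LINT y|M. K x y * f y\<bar> + ennreal (d x * \<bar>f x\<bar>) \<le> ?A + ?B"
    by (rule add_right_mono)
  moreover have "ennreal \<bar>kop M K d f x\<bar> \<le> ennreal \<bar>LINT y|M. K x y * f y\<bar> + ennreal (d x * \<bar>f x\<bar>)"
    using d_nonneg[OF x]
    by (auto simp: kop_def abs_mult simp flip: ennreal_plus intro!: ennreal_leI order_trans[OF abs_triangle_ineq])
  ultimately have "ennreal \<bar>kop M K d f x\<bar> \<le> ?A + ?B" by (rule order_trans[rotated])
  then have "(ennreal \<bar>kop M K d f x\<bar>)\<^sup>2 \<le> (?A + ?B)\<^sup>2" by (rule power_mono) simp
  also have "\<dots> \<le> ennreal a * nkop M K d (\<lambda>y. ennreal ((f y)\<^sup>2)) x"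
    unfolding nkop_def
  proof (rule ennreal_square_add_le)
    have "?A = (\<integral>\<^sup>+y. ennreal (sqrt (K x y)) * ennreal (sqrt (K x y) * \<bar>f y\<bar>) \<partial>M)"
      using AE_X
    proof (intro nn_integral_cong_AE, eventually_elim)
      case (elim y)
      then have "0 \<le> K x y" using K_nonneg x by auto
      then show ?case by (simp add: ennreal_mult[symmetric] abs_mult flip: mult.assoc)
    qed
    then have "?A\<^sup>2 \<le> (\<integral>\<^sup>+y. (ennreal (sqrt (K x y)))\<^sup>2 \<partial>M) * (\<integral>\<^sup>+y. (ennreal (sqrt (K x y) * \<bar>f y\<bar>))\<^sup>2 \<partial>M)"
      by (simp only:) (rule Cauchy_Schwarz_nn_integral; measurable)
    also have "(\<integral>\<^sup>+y. (ennreal (sqrt (K x y)))\<^sup>2 \<partial>M) = (\<integral>\<^sup>+y. ennreal (K x y) \<partial>M)"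
      using AE_X
    proof (intro nn_integral_cong_AE, eventually_elim)
      case (elim y)
      then show ?case using K_nonneg[OF x] by (simp add: ennreal_power)
    qed
    also have "(\<integral>\<^sup>+y. (ennreal (sqrt (K x y) * \<bar>f y\<bar>))\<^sup>2 \<partial>M) = (\<integral>\<^sup>+y. ennreal (K x y) * ennreal ((f y)\<^sup>2) \<partial>M)"
      using AE_X
    proof (intro nn_integral_cong_AE, eventually_elim)
      case (elim y)
      then show ?case using K_nonneg[OF x] by (simp add: ennreal_power power_mult_distrib ennreal_mult)
    qed
    finally show "?A\<^sup>2 \<le> (\<integral>\<^sup>+y. ennreal (K x y) \<partial>M) * (\<integral>\<^sup>+y. ennreal (K x y) * ennreal ((f y)\<^sup>2) \<partial>M)" .
    show "?B\<^sup>2 \<le> ennreal (d x) * (ennreal (d x) * ennreal ((f x)\<^sup>2))"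
      using d_nonneg[OF x] by (simp add: power2_eq_square ac_simps flip: ennreal_mult)
  qed (use row[OF x] a in auto)
  finally show ?thesis by (simp add: ennreal_power)
qed

text \<open>The Schur test.\<close>

lemma L2_sq_kop_le:
  assumes f: "in_L2 M f"
  shows "L2_sq M (kop M K d f) \<le> ennreal (a * b) * L2_sq M f"
proof -
  have [measurable]: "f \<in> borel_measurable M" using f by (simp add: in_L2_def)
  have "L2_sq M (kop M K d f) \<le> (\<integral>\<^sup>+x. ennreal a * nkop M K d (\<lambda>y. ennreal ((f y)\<^sup>2)) x \<partial>M)"
    unfolding L2_sq_def using AE_X
    by (intro nn_integral_mono_AE) (auto elim!: eventually_mono intro!: kop_square_le)
  also have "\<dots> = ennreal a * (\<integral>\<^sup>+x. nkop M K d (\<lambda>y. ennreal ((f y)\<^sup>2)) x \<partial>M)"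
    by (rule nn_integral_cmult) measurable
  also have "\<dots> \<le> ennreal a * (ennreal b * L2_sq M f)"
    unfolding L2_sq_def by (intro mult_left_mono nn_integral_nkop_le) auto
  finally show ?thesis using a b by (simp add: ennreal_mult mult.assoc)
qed

lemma in_L2_kop: "in_L2 M f \<Longrightarrow> in_L2 M (kop M K d f)"
  using L2_sq_kop_le[of f] a b unfolding in_L2_def
  by (auto intro: order.strict_trans1 simp: ennreal_mult_less_top)

lemma integrable_row_of_square:
  assumes x: "x \<in> X" and f [measurable]: "f \<in> borel_measurable M"
    and fin: "(\<integral>\<^sup>+y. ennreal (K x y) * ennreal ((f y)\<^sup>2) \<partial>M) < \<infinity>"
  shows "integrable M (\<lambda>y. K x y * f y)"
proof (rule integrableI_bounded)
  have xs: "x \<in> space M" using x X_space by auto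
  note [measurable] = K_measurable1[OF xs]
  show "(\<lambda>y. K x y * f y) \<in> borel_measurable M" by measurable
  have "(\<integral>\<^sup>+y. ennreal (norm (K x y * f y)) \<partial>M)
      \<le> (\<integral>\<^sup>+y. ennreal (K x y) + ennreal (K x y) * ennreal ((f y)\<^sup>2) \<partial>M)"
    using AE_X
  proof (intro nn_integral_mono_AE, eventually_elim)
    case (elim y)
    then have K: "0 \<le> K x y" using K_nonneg x by auto
    have "\<bar>f y\<bar> \<le> 1 + (f y)\<^sup>2"
      using abs_mult_le_sum_squares[of 1 "f y"] by simp
    then have "\<bar>K x y * f y\<bar> \<le> K x y * (1 + (f y)\<^sup>2)"
      using K by (simp add: abs_mult mult_left_mono)
    then show ?case
      using K by (simp add: distrib_left ennreal_leI flip: ennreal_mult ennreal_plus)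
  qed
  also have "\<dots> = (\<integral>\<^sup>+y. ennreal (K x y) \<partial>M) + (\<integral>\<^sup>+y. ennreal (K x y) * ennreal ((f y)\<^sup>2) \<partial>M)"
    by (rule nn_integral_add) measurable
  also have "\<dots> < \<infinity>"
  proof -
    have "(\<integral>\<^sup>+y. ennreal (K x y) \<partial>M) \<le> ennreal a"
      using row[OF x] by (rule order_trans[rotated]) simp
    then show ?thesis using fin by (auto intro: order.strict_trans1)
  qed
  finally show "(\<integral>\<^sup>+y. ennreal (norm (K x y * f y)) \<partial>M) < \<infinity>" .
qed

lemma AE_integrable_row:
  assumes f: "in_L2 M f"
  shows "AE x in M. integrable M (\<lambda>y. K x y * f y)"
proof -
  have [measurable]: "f \<in> borel_measurable M" using f by (simp add: in_L2_def)
  have "(\<integral>\<^sup>+x. nkop M K d (\<lambda>y. ennreal ((f y)\<^sup>2)) x \<partial>M) \<le> ennreal b * L2_sq M f"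
    unfolding L2_sq_def by (rule nn_integral_nkop_le) measurable
  also have "\<dots> < \<infinity>" using f by (simp add: in_L2_def ennreal_mult_less_top)
  finally have fin: "(\<integral>\<^sup>+x. nkop M K d (\<lambda>y. ennreal ((f y)\<^sup>2)) x \<partial>M) < \<infinity>" .
  have "nkop M K d (\<lambda>y. ennreal ((f y)\<^sup>2)) \<in> borel_measurable M" by measurable
  then have "AE x in M. nkop M K d (\<lambda>y. ennreal ((f y)\<^sup>2)) x \<noteq> \<infinity>"
    using fin by (intro nn_integral_noteq_infinite) auto
  with AE_X show ?thesis
  proof eventually_elim
    case (elim x)
    then show ?case by (intro integrable_row_of_square) (auto simp: nkop_def less_top)
  qed
qed

text \<open>Jensen's inequality when the kernel is a probability measure for each \<open>x\<close>.\<close>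

lemma kop_Jensen:
  assumes x: "x \<in> X" and f [measurable]: "f \<in> borel_measurable M"
    and int: "integrable M (\<lambda>y. K x y * f y)"
    and mass: "(\<integral>\<^sup>+y. ennreal (K x y) \<partial>M) + ennreal (d x) = 1"
  shows "ennreal ((c - kop M K d f x)\<^sup>2) \<le> ennreal a * nkop M K d (\<lambda>y. ennreal ((c - f y)\<^sup>2)) x"
proof -
  have xs: "x \<in> space M" using x X_space by auto
  note [measurable] = K_measurable1[OF xs]
  have AEK: "AE y in M. 0 \<le> K x y"
    using AE_X by eventually_elim (use K_nonneg x in auto)
  have "(\<integral>\<^sup>+y. ennreal (K x y) \<partial>M) \<noteq> \<infinity>" using mass by auto
  then have iK: "integrable M (\<lambda>y. K x y)"
    using AEK by (intro integrableI_nonneg) (auto simp: less_top)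
  have "ennreal ((LINT y|M. K x y) + d x) = ennreal 1"
    using mass AEK d_nonneg[OF x]
    by (simp add: ennreal_plus integral_nonneg_AE nn_integral_eq_integral[OF iK, symmetric])
  then have one: "(LINT y|M. K x y) + d x = 1"
    using AEK d_nonneg[OF x] by (subst (asm) ennreal_inj) (auto simp: integral_nonneg_AE)
  have "kop M K d (\<lambda>y. c - f y) x = c * ((LINT y|M. K x y) + d x) - kop M K d f x"
    using iK int by (simp add: kop_def algebra_simps)
  then have "c - kop M K d f x = kop M K d (\<lambda>y. c - f y) x"
    by (simp add: one)
  then show ?thesis using kop_square_le[OF x, of "\<lambda>y. c - f y"] by simp
qed

end

text \<open>
  For two Markov kernels \<open>P\<close> and \<open>Q\<close>, the value at \<open>x\<close> of \<open>g - P Q g\<close> is an average of \<open>g x - g z\<close>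
  over the points \<open>z\<close> that can be reached from \<open>x\<close> by a step of \<open>P\<close> followed by a step of \<open>Q\<close>.
  So it suffices to control the oscillation of \<open>g\<close> between such points.
\<close>

lemma two_step_oscillation_bound:
  assumes P: "positive_kernel M KP dP X 1 bP" and Q: "positive_kernel M KQ dQ X 1 bQ"
    and massP: "\<And>x. x \<in> X \<Longrightarrow> (\<integral>\<^sup>+y. ennreal (KP x y) \<partial>M) + ennreal (dP x) = 1"
    and massQ: "\<And>x. x \<in> X \<Longrightarrow> (\<integral>\<^sup>+y. ennreal (KQ x y) \<partial>M) + ennreal (dQ x) = 1"
    and g: "in_L2 M g" and U [measurable]: "U \<in> borel_measurable M"
    and osc: "\<And>x y z. x \<in> X \<Longrightarrow> y \<in> X \<Longrightarrow> z \<in> X \<Longrightarrow> y = x \<or> KP x y \<noteq> 0 \<Longrightarrow> z = y \<or> KQ y z \<noteq> 0 \<Longrightarrow>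
      ennreal ((g x - g z)\<^sup>2) \<le> \<omega> * (U x + U z)"
  shows "L2_sq M (\<lambda>x. g x - kop M KP dP (kop M KQ dQ g) x) \<le> \<omega> * (1 + ennreal (bP * bQ)) * (\<integral>\<^sup>+x. U x \<partial>M)"
proof -
  interpret P: positive_kernel M KP dP X 1 bP by (rule P)
  interpret Q: positive_kernel M KQ dQ X 1 bQ by (rule Q)
  have [measurable]: "g \<in> borel_measurable M" using g by (simp add: in_L2_def)
  have Qg: "in_L2 M (kop M KQ dQ g)" using g by (rule Q.in_L2_kop)
  have [measurable]: "kop M KQ dQ g \<in> borel_measurable M" using Qg by (simp add: in_L2_def)
  let ?V = "\<lambda>x z. \<omega> * (U x + U z)"
  have step: "ennreal ((g x - kop M KP dP (kop M KQ dQ g) x)\<^sup>2) \<le> \<omega> * (U x + nkop M KP dP (nkop M KQ dQ U) x)"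
    if x: "x \<in> X" "integrable M (\<lambda>y. KP x y * kop M KQ dQ g y)" "integrable M (\<lambda>y. KQ x y * g y)" for x
  proof -
    have xs: "x \<in> space M" using x(1) P.X_space by auto
    note [measurable] = P.K_measurable1[OF xs]
    have inner: "ennreal ((g x - kop M KQ dQ g y)\<^sup>2) \<le> \<omega> * (U x + nkop M KQ dQ U y)"
      if y: "y \<in> X" "integrable M (\<lambda>z. KQ y z * g z)" and yx: "y = x \<or> KP x y \<noteq> 0" for y
    proof -
      have ys: "y \<in> space M" using y(1) P.X_space by auto
      note [measurable] = Q.K_measurable1[OF ys]
      have "ennreal ((g x - kop M KQ dQ g y)\<^sup>2) \<le> ennreal 1 * nkop M KQ dQ (\<lambda>z. ennreal ((g x - g z)\<^sup>2)) y"
        using y by (intro Q.kop_Jensen massQ) auto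
      also have "\<dots> \<le> (\<integral>\<^sup>+z. ennreal (KQ y z) * (\<omega> * (U x + U z)) \<partial>M) + ennreal (dQ y) * (\<omega> * (U x + U y))"
        unfolding nkop_def ennreal_1 mult_1
      proof (intro add_mono nn_integral_mono_AE)
        show "AE z in M. ennreal (KQ y z) * ennreal ((g x - g z)\<^sup>2) \<le> ennreal (KQ y z) * (\<omega> * (U x + U z))"
          using P.AE_X
        proof eventually_elim
          case (elim z)
          show ?case
          proof (cases "KQ y z = 0")
            case False
            then show ?thesis using osc[OF x(1) y(1) elim yx] by (intro mult_left_mono) auto
          qed simp
        qed
        show "ennreal (dQ y) * ennreal ((g x - g y)\<^sup>2) \<le> ennreal (dQ y) * (\<omega> * (U x + U y))"
          using osc[OF x(1) y(1) y(1) yx] by (intro mult_left_mono) auto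
      qed
      also have "\<dots> = \<omega> * (((\<integral>\<^sup>+z. ennreal (KQ y z) \<partial>M) + ennreal (dQ y)) * U x + nkop M KQ dQ U y)"
      proof -
        have "(\<integral>\<^sup>+z. ennreal (KQ y z) * (\<omega> * (U x + U z)) \<partial>M)
            = (\<integral>\<^sup>+z. \<omega> * (ennreal (KQ y z) * U x) + \<omega> * (ennreal (KQ y z) * U z) \<partial>M)"
          by (simp add: distrib_left ac_simps)
        also have "\<dots> = \<omega> * ((\<integral>\<^sup>+z. ennreal (KQ y z) \<partial>M) * U x) + \<omega> * (\<integral>\<^sup>+z. ennreal (KQ y z) * U z \<partial>M)"
          by (simp add: nn_integral_add nn_integral_cmult nn_integral_multc)
        finally show ?thesis by (simp add: nkop_def distrib_left distrib_right ac_simps)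
      qed
      also have "\<dots> = \<omega> * (U x + nkop M KQ dQ U y)" using massQ[OF y(1)] by simp
      finally show ?thesis .
    qed
    have "ennreal ((g x - kop M KP dP (kop M KQ dQ g) x)\<^sup>2)
        \<le> ennreal 1 * nkop M KP dP (\<lambda>y. ennreal ((g x - kop M KQ dQ g y)\<^sup>2)) x"
      using x by (intro P.kop_Jensen massP) auto
    also have "\<dots> \<le> (\<integral>\<^sup>+y. ennreal (KP x y) * (\<omega> * (U x + nkop M KQ dQ U y)) \<partial>M)
        + ennreal (dP x) * (\<omega> * (U x + nkop M KQ dQ U x))"
      unfolding nkop_def[of M KP] ennreal_1 mult_1
    proof (intro add_mono nn_integral_mono_AE)
      show "AE y in M. ennreal (KP x y) * ennreal ((g x - kop M KQ dQ g y)\<^sup>2)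
          \<le> ennreal (KP x y) * (\<omega> * (U x + nkop M KQ dQ U y))"
        using P.AE_X Q.AE_integrable_row[OF g]
      proof eventually_elim
        case (elim y)
        show ?case
        proof (cases "KP x y = 0")
          case False
          then show ?thesis using inner[of y] elim by (intro mult_left_mono) auto
        qed simp
      qed
      show "ennreal (dP x) * ennreal ((g x - kop M KQ dQ g x)\<^sup>2) \<le> ennreal (dP x) * (\<omega> * (U x + nkop M KQ dQ U x))"
        using inner[of x] x by (intro mult_left_mono) auto
    qed
    also have "\<dots> = \<omega> * (((\<integral>\<^sup>+z. ennreal (KP x z) \<partial>M) + ennreal (dP x)) * U x + nkop M KP dP (nkop M KQ dQ U) x)"
    proof -
      have "(\<integral>\<^sup>+y. ennreal (KP x y) * (\<omega> * (U x + nkop M KQ dQ U y)) \<partial>M)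
          = (\<integral>\<^sup>+y. \<omega> * (ennreal (KP x y) * U x) + \<omega> * (ennreal (KP x y) * nkop M KQ dQ U y) \<partial>M)"
        by (simp add: distrib_left ac_simps)
      also have "\<dots> = \<omega> * ((\<integral>\<^sup>+y. ennreal (KP x y) \<partial>M) * U x) + \<omega> * (\<integral>\<^sup>+y. ennreal (KP x y) * nkop M KQ dQ U y \<partial>M)"
        by (simp add: nn_integral_add nn_integral_cmult nn_integral_multc)
      finally show ?thesis by (simp add: nkop_def[of M KP] distrib_left distrib_right ac_simps)
    qed
    also have "\<dots> = \<omega> * (U x + nkop M KP dP (nkop M KQ dQ U) x)" using massP[OF x(1)] by simp
    finally show ?thesis .
  qed
  have "L2_sq M (\<lambda>x. g x - kop M KP dP (kop M KQ dQ g) x)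
      \<le> (\<integral>\<^sup>+x. \<omega> * (U x + nkop M KP dP (nkop M KQ dQ U) x) \<partial>M)"
    unfolding L2_sq_def using P.AE_X P.AE_integrable_row[OF Qg] Q.AE_integrable_row[OF g]
    by (intro nn_integral_mono_AE, eventually_elim) (rule step)
  also have "\<dots> = \<omega> * ((\<integral>\<^sup>+x. U x \<partial>M) + (\<integral>\<^sup>+x. nkop M KP dP (nkop M KQ dQ U) x \<partial>M))"
    by (simp add: nn_integral_cmult nn_integral_add)
  also have "\<dots> \<le> \<omega> * ((\<integral>\<^sup>+x. U x \<partial>M) + ennreal bP * (ennreal bQ * (\<integral>\<^sup>+x. U x \<partial>M)))"
    by (intro mult_left_mono add_left_mono order_trans[OF P.nn_integral_nkop_le] Q.nn_integral_nkop_le)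
       (auto intro: Q.nkop_measurable)
  finally show ?thesis
    using P.b Q.b by (simp add: ennreal_mult distrib_left distrib_right ac_simps)
qed

section \<open>Density of Lipschitz functions\<close>

lemma L2_dominated_limit:
  fixes s :: "nat \<Rightarrow> 'a \<Rightarrow> real"
  assumes f: "f \<in> borel_measurable M" and w: "in_L2 M w"
    and s: "\<And>i. s i \<in> borel_measurable M"
    and bound: "\<And>i x. x \<in> space M \<Longrightarrow> \<bar>s i x\<bar> \<le> w x"
    and lim: "\<And>x. x \<in> space M \<Longrightarrow> (\<lambda>i. s i x) \<longlonglongrightarrow> f x"
  shows "in_L2 M f" "\<And>i. in_L2 M (s i)" "(\<lambda>i. nrm M (\<lambda>x. s i x - f x)) \<longlonglongrightarrow> 0"
proof -
  have w2: "integrable M (\<lambda>x. (w x)\<^sup>2)" and [measurable]: "w \<in> borel_measurable M"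
    using w by (auto simp: in_L2_iff_integrable)
  note [measurable] = f s
  have fb: "\<bar>f x\<bar> \<le> w x" if "x \<in> space M" for x
    using lim[OF that] bound[OF that] by (intro LIMSEQ_le_const2[OF tendsto_rabs]) auto
  have L2: "in_L2 M g" if [measurable]: "g \<in> borel_measurable M" and "\<And>x. x \<in> space M \<Longrightarrow> \<bar>g x\<bar> \<le> w x" for g
    unfolding in_L2_iff_integrable
  proof (intro conjI Bochner_Integration.integrable_bound[OF w2] that(1))
    show "AE x in M. norm ((g x)\<^sup>2) \<le> norm ((w x)\<^sup>2)"
      using that(2) by (intro AE_I2) (simp flip: abs_le_square_iff add: order_trans[OF _ abs_ge_self])
  qed measurable
  show "in_L2 M f" "in_L2 M (s i)" for i using fb bound by (auto intro: L2)
  have "(\<lambda>i. LINT x|M. (s i x - f x)\<^sup>2) \<longlonglongrightarrow> (LINT x|M. 0)"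
  proof (rule integral_dominated_convergence)
    show "integrable M (\<lambda>x. (2 * w x)\<^sup>2)" using w2 by (simp add: power_mult_distrib)
    show "AE x in M. (\<lambda>i. (s i x - f x)\<^sup>2) \<longlonglongrightarrow> 0"
    proof (rule AE_I2)
      fix x assume "x \<in> space M"
      from tendsto_power[OF tendsto_diff[OF lim[OF this] tendsto_const[of "f x"]], of 2]
      show "(\<lambda>i. (s i x - f x)\<^sup>2) \<longlonglongrightarrow> 0" by simp
    qed
    show "AE x in M. norm ((s i x - f x)\<^sup>2) \<le> (2 * w x)\<^sup>2" for i
    proof (rule AE_I2)
      fix x assume x: "x \<in> space M"
      have "\<bar>s i x - f x\<bar> \<le> \<bar>2 * w x\<bar>" using bound[OF x, of i] fb[OF x] by linarith
      then show "norm ((s i x - f x)\<^sup>2) \<le> (2 * w x)\<^sup>2" by (simp add: abs_le_square_iff)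
    qed
  qed measurable
  then have "(\<lambda>i. sqrt (LINT x|M. (s i x - f x)\<^sup>2)) \<longlonglongrightarrow> sqrt 0"
    by (intro tendsto_real_sqrt) simp
  then show "(\<lambda>i. nrm M (\<lambda>x. s i x - f x)) \<longlonglongrightarrow> 0"
    by (simp add: nrm_def ip_def power2_eq_square)
qed

text \<open>
  Indicators of bounded closed sets are limits of Lipschitz functions of the distance to the set;
  a Dynkin system argument and simple functions do the rest.
\<close>

lemma (in growth_measure) L2_induct_Lipschitz [consumes 1, case_names Lipschitz add cmult lim]:
  assumes f: "in_L2 M f"
    and Lip: "\<And>f L B. in_L2 M f \<Longrightarrow> bounded B \<Longrightarrow> (\<And>x. x \<notin> B \<Longrightarrow> f x = 0) \<Longrightarrow>
      (\<And>x y. \<bar>f x - f y\<bar> \<le> L * dist x y) \<Longrightarrow> (\<And>x. \<bar>f x\<bar> \<le> 1) \<Longrightarrow> P f"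
    and add: "\<And>f g. in_L2 M f \<Longrightarrow> in_L2 M g \<Longrightarrow> P f \<Longrightarrow> P g \<Longrightarrow> P (\<lambda>x. f x + g x)"
    and cmult: "\<And>f c. in_L2 M f \<Longrightarrow> P f \<Longrightarrow> P (\<lambda>x. c * f x)"
    and lim: "\<And>f s. in_L2 M f \<Longrightarrow> (\<And>i. in_L2 M (s i)) \<Longrightarrow> (\<And>i. P (s i)) \<Longrightarrow>
      (\<lambda>i. nrm M (\<lambda>x. s i x - f x)) \<longlonglongrightarrow> 0 \<Longrightarrow> P f"
  shows "P f"
proof -
  note [simp] = space_M
  have borel [measurable]: "A \<in> sets M \<longleftrightarrow> A \<in> sets borel" for A by (simp add: sets_M)
  have meas: "g \<in> borel_measurable M" if "g \<in> borel_measurable borel" for g :: "'a \<Rightarrow> real"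
    using that by (simp add: measurable_cong_sets[OF sets_M refl])
  have indm: "(indicator A :: 'a \<Rightarrow> real) \<in> borel_measurable M" if "A \<in> sets borel" for A
    using that by (intro borel_measurable_indicator) (simp add: sets_M)
  have ind_L2: "in_L2 M (indicator A :: 'a \<Rightarrow> real)" if "A \<in> sets borel" "bounded A" for A
  proof -
    have "emeasure M A \<le> emeasure M (closure A)"
      using that by (intro emeasure_mono closure_subset) (simp add: sets_M)
    also have "\<dots> < \<infinity>" using that by (intro finite_compact) (simp add: compact_closure)
    finally have "emeasure M A < \<infinity>" .
    moreover have "ennreal ((indicator A x)\<^sup>2) = indicator A x" for x
      by (simp add: indicator_def)
    ultimately show ?thesis
      using that by (auto simp: in_L2_def L2_sq_def sets_M intro!: meas borel_measurable_indicator)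
  qed
  have zero: "P (\<lambda>x. 0)" by (rule Lip[where B = "{}" and L = 0]) (auto simp: in_L2_zero)
  have empty_ind: "indicator {} = (\<lambda>x :: 'a. 0 :: real)" by (simp add: fun_eq_iff)
  have sum: "P (\<lambda>x. \<Sum>i\<in>I. g i x)" if "\<And>i. i \<in> I \<Longrightarrow> P (g i)" "\<And>i. i \<in> I \<Longrightarrow> in_L2 M (g i)" for I and g :: "'b \<Rightarrow> 'a \<Rightarrow> real"
    using that
  proof (induction I rule: infinite_finite_induct)
    case (insert i I)
    then show ?case using add[of "g i" "\<lambda>x. \<Sum>i\<in>I. g i x"] in_L2_sum[of I M g] by simp
  qed (auto simp: zero)
  have diff: "P (\<lambda>x. f x - g x)" if "in_L2 M f" "in_L2 M g" "P f" "P g" for f g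
    using add[OF that(1) in_L2_cmult[OF that(2), of "-1"] that(3) cmult[OF that(2,4), of "-1"]] by simp
  have closed: "P (indicator A)" if A: "closed A" "bounded A" for A
  proof (cases "A = {}")
    case True
    then show ?thesis using zero empty_ind by simp
  next
    case False
    define s where "s i x = max 0 (1 - real (Suc i) * infdist x A)" for i x
    let ?N = "{x. infdist x A \<le> 1}"
    obtain e where e: "\<And>x. x \<in> A \<Longrightarrow> norm x \<le> e" using A(2) by (auto simp: bounded_iff)
    have bN: "bounded ?N"
      unfolding bounded_iff
    proof (intro exI[of _ "e + 2"] ballI)
      fix x assume "x \<in> ?N"
      then have "infdist x A < 2" by simp
      then obtain a where "a \<in> A" "dist x a < 2"
        using False by (auto simp: infdist_def cINF_less_iff split: if_splits)
      then show "norm x \<le> e + 2" using e[of a] norm_triangle_ineq2[of x a] by (simp add: dist_norm)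
    qed
    have lip: "\<bar>s i x - s i y\<bar> \<le> real (Suc i) * dist x y" for i x y
    proof -
      have "\<bar>infdist x A - infdist y A\<bar> \<le> dist x y"
        using infdist_triangle[of x A y] infdist_triangle[of y A x] by (simp add: dist_commute abs_le_iff)
      then have "real (Suc i) * \<bar>infdist x A - infdist y A\<bar> \<le> real (Suc i) * dist x y"
        by (rule mult_left_mono) simp
      moreover have "\<bar>s i x - s i y\<bar> \<le> \<bar>real (Suc i) * infdist x A - real (Suc i) * infdist y A\<bar>"
        unfolding s_def by linarith
      ultimately show ?thesis by (simp only: abs_mult abs_of_nat flip: right_diff_distrib)
    qed
    have sm: "s i \<in> borel_measurable borel" for i
      unfolding s_def by (intro borel_measurable_continuous_onI continuous_intros)
    have s1: "\<bar>s i x\<bar> \<le> 1" for i x unfolding s_def using infdist_nonneg[of x A] by auto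
    have s0: "s i x = 0" if "x \<notin> ?N" for i x
    proof -
      have "1 * 1 \<le> real (Suc i) * infdist x A" using that by (intro mult_mono) auto
      then show ?thesis by (simp add: s_def)
    qed
    have sN: "\<bar>s i x\<bar> \<le> indicator ?N x" for i x
      using s0[of x i] s1[of i x] by (cases "x \<in> ?N") auto
    have slim: "(\<lambda>i. s i x) \<longlonglongrightarrow> indicator A x" for x
    proof (cases "x \<in> A")
      case True
      then show ?thesis by (simp add: s_def)
    next
      case F: False
      then have p: "0 < infdist x A"
        using False A(1) infdist_nonneg[of x A] in_closed_iff_infdist_zero[of A x] by fastforce
      obtain k where k: "1 / infdist x A < real k" using reals_Archimedean2 by blast
      have "s i x = 0" if "k \<le> i" for i
      proof -
        have "1 / infdist x A \<le> real (Suc i)" using k that by simp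
        then have "1 \<le> real (Suc i) * infdist x A" using p by (simp add: field_simps)
        then show ?thesis by (simp add: s_def)
      qed
      then show ?thesis using F by (intro tendsto_eventually) (auto simp: eventually_sequentially intro!: exI[of _ k])
    qed
    have N: "in_L2 M (indicator ?N :: 'a \<Rightarrow> real)"
      using bN by (intro ind_L2 borel_closed) (auto intro!: closed_Collect_le continuous_intros)
    note dom = L2_dominated_limit[of "indicator A :: 'a \<Rightarrow> real" M "indicator ?N" s]
    have sL2: "in_L2 M (s i)" for i
      by (rule dom(2)[OF indm[OF borel_closed[OF A(1)]] N meas[OF sm] sN slim])
    show ?thesis
    proof (rule lim[where s = s])
      show "in_L2 M (indicator A)" using A by (intro ind_L2) auto
      show "in_L2 M (s i)" for i by (rule sL2)
      show "P (s i)" for i using bN s0 lip s1 by (intro Lip[OF sL2]) auto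
      show "(\<lambda>i. nrm M (\<lambda>x. s i x - indicator A x)) \<longlonglongrightarrow> 0"
        by (rule dom(3)[OF indm[OF borel_closed[OF A(1)]] N meas[OF sm] sN slim])
    qed
  qed
  have borel_bdd: "P (indicator (A \<inter> cball 0 r))" if "A \<in> sets borel" for A r
  proof -
    have "Int_stable (Collect (closed :: 'a set \<Rightarrow> bool))" by (auto simp: Int_stable_def)
    moreover have "Collect closed \<subseteq> Pow (UNIV :: 'a set)" by simp
    moreover have "A \<in> sigma_sets UNIV (Collect closed)" using that by (simp add: borel_eq_closed)
    ultimately show ?thesis
    proof (induction rule: sigma_sets_induct_disjoint)
      case (basic A)
      then show ?case by (intro closed) (auto simp: bounded_Int)
    next
      case empty
      then show ?case using zero empty_ind by simp
    next
      case (compl A)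
      then have "A \<in> sets borel" by (simp add: borel_eq_closed)
      then have "in_L2 M (indicator (A \<inter> cball 0 r) :: 'a \<Rightarrow> real)" "in_L2 M (indicator (cball 0 r) :: 'a \<Rightarrow> real)"
        by (auto intro!: ind_L2 simp: bounded_Int)
      moreover have "P (indicator (cball 0 r))" by (rule closed) auto
      ultimately have "P (\<lambda>x. indicator (cball 0 r) x - indicator (A \<inter> cball 0 r) x)"
        using compl by (intro diff)
      also have "(\<lambda>x. indicator (cball 0 r) x - indicator (A \<inter> cball 0 r) x) = (indicator ((UNIV - A) \<inter> cball 0 r) :: 'a \<Rightarrow> real)"
        by (auto simp: indicator_def)
      finally show ?case .
    next
      case (union A)
      then have A: "A i \<in> sets borel" for i by (auto simp: borel_eq_closed)
      have AL2: "in_L2 M (indicator (A i \<inter> cball 0 r) :: 'a \<Rightarrow> real)" for i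
        using A by (auto intro!: ind_L2 simp: bounded_Int)
      define s where "s k x = (\<Sum>i<k. indicator (A i \<inter> cball 0 r) x :: real)" for k :: nat and x
      have s: "s k x = indicator ((\<Union>i<k. A i) \<inter> cball 0 r) x" for k x
      proof -
        have "s k x = (\<Sum>i<k. indicator (A i) x) * indicator (cball 0 r) x"
          by (simp add: s_def indicator_inter_arith sum_distrib_right)
        also have "(\<Sum>i<k. indicator (A i) x :: real) = indicator (\<Union>i<k. A i) x"
          using union by (intro indicator_UN_disjoint[symmetric]) (auto intro: disjoint_family_on_mono)
        finally show ?thesis by (simp add: indicator_inter_arith)
      qed
      have slim: "(\<lambda>k. s k x) \<longlonglongrightarrow> indicator ((\<Union>i. A i) \<inter> cball 0 r) x" for x
      proof (cases "x \<in> (\<Union>i. A i)")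
        case True
        then obtain i where i: "x \<in> A i" by auto
        have "s k x = indicator ((\<Union>i. A i) \<inter> cball 0 r) x" if "Suc i \<le> k" for k
          using i that by (auto simp: s indicator_def)
        then show ?thesis by (intro tendsto_eventually) (auto simp: eventually_sequentially intro!: exI[of _ "Suc i"])
      next
        case False
        then show ?thesis by (simp add: s indicator_def)
      qed
      have N: "in_L2 M (indicator (cball 0 r) :: 'a \<Rightarrow> real)" by (intro ind_L2) auto
      have sm: "s k \<in> borel_measurable borel" for k 
        unfolding s_def using A by (intro borel_measurable_sum borel_measurable_indicator) auto
      show ?case
      proof (rule lim[where s = s])
        show "in_L2 M (indicator (\<Union> (range A) \<inter> cball 0 r))"
          using A by (intro ind_L2) (auto simp: bounded_Int)
        show "in_L2 M (s k)" for k unfolding s_def by (intro in_L2_sum AL2)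
        show "P (s k)" for k unfolding s_def using union AL2 by (intro sum) auto
        show "(\<lambda>i. nrm M (\<lambda>x. s i x - indicator (\<Union> (range A) \<inter> cball 0 r) x)) \<longlonglongrightarrow> 0"
        proof (rule L2_dominated_limit(3)[OF _ N meas[OF sm] _ slim])
          show "(indicator (\<Union> (range A) \<inter> cball 0 r) :: 'a \<Rightarrow> real) \<in> borel_measurable M"
            using A by (intro indm) auto
          show "\<bar>s i x\<bar> \<le> indicator (cball 0 r) x" for i x
            by (auto simp: s indicator_def)
        qed
      qed
    qed
  qed
  have fm: "f \<in> borel_measurable M" using f by (simp add: in_L2_def)
  obtain F where F: "\<And>i. simple_function M (F i)" "\<And>x. (\<lambda>i. F i x) \<longlonglongrightarrow> f x"
    "\<And>i x. norm (F i x) \<le> 2 * norm (f x)"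
    using borel_measurable_implies_sequence_metric[OF fm, of 0] by auto
  define s where "s i x = F i x * indicator (cball 0 (real i)) x" for i x
  have seq: "s i x =(\<Sum>y\<in>range (F i). y * indicator ((F i -` {y}) \<inter> cball 0 (real i)) x)" for i x
  proof -
    have "finite (range (F i))" using simple_functionD(1)[OF F(1)[of i]] by simp
    then have eq: "F i x = (\<Sum>y\<in>range (F i). y * indicator (F i -` {y}) x)"
      by (simp add: indicator_def if_distrib sum.delta cong: if_cong)
    show ?thesis
      unfolding s_def by (subst eq) (simp add: sum_distrib_right indicator_inter_arith mult.assoc)
  qed
  have Fset: "F i -` {y} \<in> sets borel" for i y
    using simple_functionD(2)[OF F(1)[of i], of "{y}"] by (simp add: sets_M)
  have piece: "in_L2 M (\<lambda>x. y * indicator ((F i -` {y}) \<inter> cball 0 (real i)) x)"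
    "P (\<lambda>x. y * indicator ((F i -` {y}) \<inter> cball 0 (real i)) x)" for i y
    using Fset by (auto intro!: cmult in_L2_cmult ind_L2 borel_bdd simp: bounded_Int)
  have sfun: "s i = (\<lambda>x. \<Sum>y\<in>range (F i). y * indicator ((F i -` {y}) \<inter> cball 0 (real i)) x)" for i
    using seq by auto
  show ?thesis
  proof (rule lim[OF f, where s = s])
    show sL2: "in_L2 M (s i)" for i unfolding sfun by (intro in_L2_sum piece)
    show "P (s i)" for i unfolding sfun by (intro sum piece)
    show "(\<lambda>i. nrm M (\<lambda>x. s i x - f x)) \<longlonglongrightarrow> 0"
    proof (rule L2_dominated_limit(3)[where w = "\<lambda>x. 2 * \<bar>f x\<bar>"])
      have "in_L2 M (\<lambda>x. \<bar>f x\<bar>)" using f by (auto simp: in_L2_def L2_sq_def)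
      then show "in_L2 M (\<lambda>x. 2 * \<bar>f x\<bar>)" by (rule in_L2_cmult)
      show "\<bar>s i x\<bar> \<le> 2 * \<bar>f x\<bar>" for i x using F(3)[of i x] by (auto simp: s_def indicator_def)
      show "(\<lambda>i. s i x) \<longlonglongrightarrow> f x" for x
      proof -
        have "indicator (cball 0 (real i)) x = (1::real)" if "nat \<lceil>norm x\<rceil> \<le> i" for i
          using that by (auto simp: indicator_def)
        then have "(\<lambda>i. indicator (cball 0 (real i)) x) \<longlonglongrightarrow> (1::real)"
          by (intro tendsto_eventually) (auto simp: eventually_sequentially intro!: exI[of _ "nat \<lceil>norm x\<rceil>"])
        from tendsto_mult[OF F(2)[of x] this] show ?thesis by (simp add: s_def)
      qed
      show "s i \<in> borel_measurable M" for i using sL2 by (simp add: in_L2_def)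
    qed (rule fm)
  qed
qed

section \<open>Cubes and the distance \<open>\<delta>\<close>\<close>

lemma mem_cube: "x \<in> cube_set (Transit z l) \<longleftrightarrow> infnorm (x - z) \<le> l / 2"
proof -
  have "x \<in> cube_set (Transit z l) \<longleftrightarrow> (\<forall>b\<in>Basis. \<bar>(x - z) \<bullet> b\<bar> \<le> l / 2)"
    unfolding cube_set.simps mem_box
  proof (intro ball_cong refl)
    fix b :: 'a assume b: "b \<in> Basis"
    have "(u - l / 2 \<le> v \<and> v \<le> u + l / 2) \<longleftrightarrow> \<bar>v - u\<bar> \<le> l / 2" for u v :: real
      by (rule iffI) linarith+
    then show "(z - (l / 2) *\<^sub>R One) \<bullet> b \<le> x \<bullet> b \<and> x \<bullet> b \<le> (z + (l / 2) *\<^sub>R One) \<bullet> b \<longleftrightarrow>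
        \<bar>(x - z) \<bullet> b\<bar> \<le> l / 2"
      using b by (simp add: inner_diff_left inner_add_left)
  qed
  also have "\<dots> \<longleftrightarrow> infnorm (x - z) \<le> l / 2"
    unfolding infnorm_Max by (subst Max_le_iff) auto
  finally show ?thesis .
qed

declare cube_set.simps(2) [simp del]

lemma infnorm_dist_triangle: "infnorm (x - z) \<le> infnorm (x - y) + infnorm (y - z)"
  using infnorm_triangle[of "x - y" "y - z"] by simp

lemma infnorm_dist_commute: "infnorm (x - y) = infnorm (y - x)"
  using infnorm_neg[of "x - y"] by simp

lemma cube_subset_same_centre: "l \<le> l' \<Longrightarrow> cube_set (Transit z l) \<subseteq> cube_set (Transit z l')"
  by (auto simp: mem_cube)

lemma cube_subset_transit:
  "infnorm (z - z') + l / 2 \<le> l' / 2 \<Longrightarrow> cube_set (Transit z l) \<subseteq> cube_set (Transit z' l')"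
proof
  fix x assume "infnorm (z - z') + l / 2 \<le> l' / 2" "x \<in> cube_set (Transit z l)"
  then show "x \<in> cube_set (Transit z' l')"
    using infnorm_dist_triangle[of x z' z] by (simp add: mem_cube)
qed

lemma centre_in_cube: "0 \<le> l \<Longrightarrow> z \<in> cube_set (Transit z l)"
  by (simp add: mem_cube infnorm_0)

lemma compact_cube: "compact (cube_set (Transit z l))"
  by (simp add: cube_set.simps(2))

lemma bounded_cube: "Q \<noteq> Whole \<Longrightarrow> bounded (cube_set Q)"
  by (cases Q) (auto simp: cube_set.simps(2))

lemma infnorm_One: "infnorm (One :: 'a::euclidean_space) = 1"
proof -
  have "(\<lambda>i. \<bar>(One :: 'a) \<bullet> i\<bar>) ` Basis = {1}"
    by (subst image_cong[of _ _ _ "\<lambda>_. 1"]) (auto simp: image_constant_conv)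
  then show ?thesis by (simp add: infnorm_Max)
qed

lemma cube_not_subset_point:
  assumes "0 < l" shows "\<not> cube_set (Transit z l) \<subseteq> {x}"
proof
  assume sub: "cube_set (Transit z l) \<subseteq> {x}"
  have "z \<in> cube_set (Transit z l)" "z + (l / 2) *\<^sub>R One \<in> cube_set (Transit z l)"
    using assms by (auto simp: mem_cube infnorm_mul infnorm_One infnorm_0)
  then have "z = x" "z + (l / 2) *\<^sub>R One = x" using sub by auto
  then have "(l / 2) *\<^sub>R (One :: 'a) = 0" by simp
  then have "infnorm ((l / 2) *\<^sub>R (One :: 'a)) = 0" by (simp only: infnorm_0)
  then show False using assms by (simp add: infnorm_mul infnorm_One)
qed

lemma concentric_refl: "concentric Q Q"
  by (auto simp: concentric_def centred_at_def)

lemma cube_hull_of_subset: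
  assumes "concentric Q P" "cube_set Q \<subseteq> cube_set P" "cube_set R \<subseteq> cube_set P"
  shows "cube_hull Q R \<subseteq> cube_set P"
  using assms by (auto simp: cube_hull_def)

lemma cube_hull_concentric:
  assumes "concentric Q R" "cube_set Q \<subseteq> cube_set R"
  shows "cube_hull Q R = cube_set R"
  using cube_hull_of_subset[OF assms order_refl] by (auto simp: cube_hull_def)

lemma delta_half_superset: "cube_set Q \<subseteq> cube_set R \<Longrightarrow> delta_half M n R Q = 0"
  using cube_hull_of_subset[OF concentric_refl, of R Q] by (simp add: delta_half_def Diff_eq_empty_iff[THEN iffD2])

lemma delta_of_subset: "cube_set Q \<subseteq> cube_set R \<Longrightarrow> delta M n Q R = enn2ereal (delta_half M n Q R)"
  by (simp add: delta_def delta_half_superset)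

lemma delta_nonneg [simp]: "0 \<le> delta M n Q R"
  by (simp add: delta_def)

lemma delta_self [simp]: "delta M n Q Q = 0"
  using delta_half_superset[of Q Q M n] by (simp add: delta_def zero_ennreal.rep_eq)

lemma centred_at_cases:
  assumes "centred_at Q x"
  obtains "Q = Whole" | "Q = Point x" | l where "Q = Transit x l"
  using assms by (cases Q) (auto simp: centred_at_def)

context growth_measure
begin

lemma cube_sets [measurable]: "cube_set Q \<in> sets M"
  by (cases Q) (auto simp: sets_M cube_set.simps(2))

lemma kernel_measurable [measurable]: "(\<lambda>x. ennreal (norm (x - z) powr q)) \<in> borel_measurable M"
  by (simp add: measurable_cong_sets[OF sets_M refl])

lemma infnorm_gt_outside_cube: "x \<notin> cube_set (Transit z l) \<Longrightarrow> l / 2 < norm (x - z)"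
  using infnorm_le_norm[of "x - z"] by (simp add: mem_cube)

lemma shell_integral_le:
  assumes z: "z \<in> supp M" and l: "0 < l" and q: "0 \<le> q"
  shows "(\<integral>\<^sup>+x \<in> cube_set (Transit z (2 * l)) - cube_set (Transit z l). ennreal (norm (x - z) powr (- q)) \<partial>M)
    \<le> ennreal (C0 * (2 * l) powr n * (l / 2) powr (- q))"
proof -
  have "(\<integral>\<^sup>+x \<in> cube_set (Transit z (2 * l)) - cube_set (Transit z l). ennreal (norm (x - z) powr (- q)) \<partial>M)
      \<le> (\<integral>\<^sup>+x. ennreal ((l / 2) powr (- q)) * indicator (cube_set (Transit z (2 * l))) x \<partial>M)"
  proof (rule nn_integral_mono)
    fix x
    show "ennreal (norm (x - z) powr (- q)) * indicator (cube_set (Transit z (2 * l)) - cube_set (Transit z l)) x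
      \<le> ennreal ((l / 2) powr (- q)) * indicator (cube_set (Transit z (2 * l))) x"
    proof (cases "x \<in> cube_set (Transit z l)")
      case False
      have "norm (x - z) powr (- q) \<le> (l / 2) powr (- q)"
        using infnorm_gt_outside_cube[OF False] l q by (intro powr_mono2') auto
      then show ?thesis by (auto simp: indicator_def ennreal_leI)
    qed simp
  qed
  also have "\<dots> = ennreal ((l / 2) powr (- q)) * emeasure M (cube_set (Transit z (2 * l)))"
    by (simp add: nn_integral_cmult_indicator)
  also have "\<dots> \<le> ennreal ((l / 2) powr (- q)) * ennreal (C0 * (2 * l) powr n)"
    using growth_cube[of z "2 * l"] z l by (intro mult_left_mono) auto
  also have "\<dots> = ennreal (C0 * (2 * l) powr n * (l / 2) powr (- q))"
    by (subst ennreal_mult'[symmetric]) (auto simp: mult.commute)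
  finally show ?thesis .
qed

definition kappa :: real where "kappa = 4 powr n * C0"

text \<open>Each doubling of the side length costs at most \<open>kappa\<close> in terms of \<open>\<delta>\<close>.\<close>

lemma dyadic_shells_integral_le:
  assumes z: "z \<in> supp M" and l: "0 < l" and n: "0 < n" and C0: "0 \<le> C0"
  shows "(\<integral>\<^sup>+x \<in> cube_set (Transit z (2 ^ p * l)) - cube_set (Transit z l). ennreal (norm (x - z) powr (- n)) \<partial>M)
    \<le> ennreal (real p * kappa)"
proof (induction p)
  case (Suc p)
  let ?f = "\<lambda>x. ennreal (norm (x - z) powr (- n))"
  let ?T = "\<lambda>i. cube_set (Transit z (2 ^ i * l))"
  have "(\<integral>\<^sup>+x \<in> ?T (Suc p) - cube_set (Transit z l). ?f x \<partial>M)
      \<le> (\<integral>\<^sup>+x. (?f x * indicator (?T p - cube_set (Transit z l)) x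
            + ?f x * indicator (?T (Suc p) - ?T p) x) \<partial>M)"
    by (intro nn_integral_mono) (auto simp: indicator_def)
  also have "\<dots> = (\<integral>\<^sup>+x \<in> ?T p - cube_set (Transit z l). ?f x \<partial>M) + (\<integral>\<^sup>+x \<in> ?T (Suc p) - ?T p. ?f x \<partial>M)"
    by (rule nn_integral_add) measurable
  also have "\<dots> \<le> ennreal (real p * kappa) + ennreal (C0 * (2 * (2 ^ p * l)) powr n * ((2 ^ p * l) / 2) powr (- n))"
    using shell_integral_le[of z "2 ^ p * l" n] z l n by (intro add_mono Suc.IH) (auto simp: mult.assoc)
  also have "C0 * (2 * (2 ^ p * l)) powr n * ((2 ^ p * l) / 2) powr (- n) = kappa"
  proof -
    have "(2 * (2 ^ p * l)) powr n = (4 * ((2 ^ p * l) / 2)) powr n"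
      by (simp add: mult.commute)
    also have "\<dots> = 4 powr n * ((2 ^ p * l) / 2) powr n"
      by (rule powr_mult)
    finally have "(2 * (2 ^ p * l)) powr n = 4 powr n * ((2 ^ p * l) / 2) powr n" .
    then show ?thesis using l by (simp add: kappa_def powr_minus field_simps)
  qed
  also have "ennreal (real p * kappa) + ennreal kappa = ennreal (real (Suc p) * kappa)"
    using C0 by (subst ennreal_plus[symmetric]) (auto simp: kappa_def algebra_simps)
  finally show ?case .
qed simp

lemma delta_transit_le:
  assumes z: "z \<in> supp M" and l: "0 < l" and n: "0 < n" and C0: "0 \<le> C0"
    and sub: "cube_set (Transit z l) \<subseteq> cube_set (Transit z' l')" and p: "2 * l' \<le> 2 ^ p * l"
  shows "delta M n (Transit z l) (Transit z' l') \<le> ereal (real p * kappa)"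
proof -
  have "z \<in> cube_set (Transit z' l')" using sub centre_in_cube[of l z] l by auto
  then have zz: "infnorm (z - z') \<le> l' / 2" by (simp only: mem_cube)
  then have "cube_set (Transit z' l') \<subseteq> cube_set (Transit z (2 ^ p * l))"
    using p by (intro cube_subset_transit) (simp add: infnorm_dist_commute[of z'])
  then have "cube_hull (Transit z l) (Transit z' l') \<subseteq> cube_set (Transit z (2 ^ p * l))"
    using sub by (intro cube_hull_of_subset) (auto simp: concentric_def centred_at_def)
  then have "delta_half M n (Transit z l) (Transit z' l') \<le>
      (\<integral>\<^sup>+x \<in> cube_set (Transit z (2 ^ p * l)) - cube_set (Transit z l). ennreal (norm (x - z) powr (- n)) \<partial>M)"
    unfolding delta_half_def by (intro nn_integral_mono) (auto simp: indicator_def)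
  also have "\<dots> \<le> ennreal (real p * kappa)" by (rule dyadic_shells_integral_le[OF z l n C0])
  finally have "enn2ereal (delta_half M n (Transit z l) (Transit z' l')) \<le> enn2ereal (ennreal (real p * kappa))"
    by (simp add: less_eq_ennreal.rep_eq)
  then show ?thesis using C0 by (simp add: delta_of_subset[OF sub] enn2ereal_ennreal kappa_def)
qed

text \<open>
  With one more power in the denominator the contributions of the dyadic shells decrease
  geometrically.
\<close>

lemma dyadic_tail_integral_le:
  assumes z: "z \<in> supp M" and l: "0 < l" and n: "0 < n" and C0: "0 \<le> C0"
  shows "(\<integral>\<^sup>+x \<in> - cube_set (Transit z l). ennreal (norm (x - z) powr (- (n + 1))) \<partial>M)
    \<le> ennreal (4 * kappa / l)"
proof -
  let ?f = "\<lambda>x. ennreal (norm (x - z) powr (- (n + 1)))"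
  let ?T = "\<lambda>i. cube_set (Transit z (2 ^ i * l))"
  have "(\<integral>\<^sup>+x \<in> - cube_set (Transit z l). ?f x \<partial>M) \<le> (\<integral>\<^sup>+x. (\<Sum>i. ?f x * indicator (?T (Suc i) - ?T i) x) \<partial>M)"
  proof (rule nn_integral_mono)
    fix x
    show "?f x * indicator (- cube_set (Transit z l)) x \<le> (\<Sum>i. ?f x * indicator (?T (Suc i) - ?T i) x)"
    proof (cases "x \<in> cube_set (Transit z l)")
      case False
      obtain i where "2 * infnorm (x - z) / l < 2 ^ i" using real_arch_pow[of 2 "2 * infnorm (x - z) / l"] by auto
      then have ex: "x \<in> ?T i" using l by (simp add: mem_cube field_simps)
      define j where "j = (LEAST i. x \<in> ?T i)"
      have j: "x \<in> ?T j" unfolding j_def using ex by (rule LeastI)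
      then have "j \<noteq> 0" using False by (intro notI) simp
      then obtain m where m: "j = Suc m" by (cases j) auto
      then have "x \<notin> ?T m" using not_less_Least[of m "\<lambda>i. x \<in> ?T i"] by (simp add: j_def)
      then have "?f x * indicator (- cube_set (Transit z l)) x \<le> (\<Sum>i\<in>{m}. ?f x * indicator (?T (Suc i) - ?T i) x)"
        using j m by (simp add: indicator_def)
      also have "\<dots> \<le> (\<Sum>i. ?f x * indicator (?T (Suc i) - ?T i) x)"
        by (intro sum_le_suminf) auto
      finally show ?thesis .
    qed simp
  qed
  also have "\<dots> = (\<Sum>i. \<integral>\<^sup>+x \<in> ?T (Suc i) - ?T i. ?f x \<partial>M)"
    by (rule nn_integral_suminf) measurable
  also have "\<dots> \<le> (\<Sum>i. ennreal (2 * kappa / l * (1 / 2) ^ i))"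
  proof (intro suminf_le allI)
    fix i
    let ?r = "2 ^ i * l"
    have "(\<integral>\<^sup>+x \<in> ?T (Suc i) - ?T i. ?f x \<partial>M) \<le> ennreal (C0 * (2 * ?r) powr n * (?r / 2) powr (- (n + 1)))"
      using shell_integral_le[of z ?r "n + 1"] z l n by (simp add: mult.assoc)
    also have "(2 * ?r) powr n = (4 * (?r / 2)) powr n" by (simp add: mult.commute)
    also have "(4 * (?r / 2)) powr n = 4 powr n * (?r / 2) powr n"
      by (rule powr_mult)
    also have "(?r / 2) powr (- (n + 1)) = (?r / 2) powr (- n) * (2 / ?r)"
    proof -
      have "(?r / 2) powr (- (n + 1)) = (?r / 2) powr (- n) * (?r / 2) powr (- 1)"
        by (subst powr_add[symmetric]) simp
      also have "(?r / 2) powr (- 1) = 2 / ?r"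
        using l by (simp add: powr_minus_divide)
      finally show ?thesis .
    qed
    also have "C0 * (4 powr n * (?r / 2) powr n) * ((?r / 2) powr (- n) * (2 / ?r)) = 2 * kappa / l * (1 / 2) ^ i"
      using l by (simp add: kappa_def powr_minus field_simps)
    finally show "(\<integral>\<^sup>+x \<in> ?T (Suc i) - ?T i. ?f x \<partial>M) \<le> ennreal (2 * kappa / l * (1 / 2) ^ i)" .
  qed auto
  also have "\<dots> = ennreal (\<Sum>i. 2 * kappa / l * (1 / 2) ^ i)"
    using l C0 by (intro suminf_ennreal2) (auto simp: kappa_def intro!: summable_mult summable_geometric)
  also have "(\<Sum>i. 2 * kappa / l * (1 / 2 :: real) ^ i) = 4 * kappa / l"
    by (subst suminf_mult) (auto simp: suminf_geometric intro!: summable_geometric)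
  finally show ?thesis .
qed

end

text \<open>Additivity of \<open>\<delta>\<close> along a chain of cubes, in the form of bounds on one term by the two others.\<close>

lemma delta_chain:
  assumes add: "delta_additive M n e0"
    and c: "is_cube M P" "is_cube M Q" "is_cube M R" "cube_set P \<subseteq> cube_set Q" "cube_set Q \<subseteq> cube_set R"
  shows delta_chain_mono: "delta M n Q R \<le> delta M n P R + ereal e0"
    and delta_chain_mono1: "delta M n P Q \<le> delta M n P R + ereal e0"
    and delta_add_le: "delta M n P Q \<le> ereal a \<Longrightarrow> delta M n Q R \<le> ereal b \<Longrightarrow> delta M n P R \<le> ereal (a + b + e0)"
    and delta_add_ge: "ereal a \<le> delta M n P Q \<Longrightarrow> ereal b \<le> delta M n Q R \<Longrightarrow> ereal (a + b - e0) \<le> delta M n P R"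
    and delta_inner_le: "delta M n P R \<le> ereal a \<Longrightarrow> ereal b \<le> delta M n Q R \<Longrightarrow> delta M n P Q \<le> ereal (a - b + e0)"
    and delta_inner_ge: "ereal a \<le> delta M n P R \<Longrightarrow> delta M n Q R \<le> ereal b \<Longrightarrow> ereal (a - b - e0) \<le> delta M n P Q"
    and delta_outer_le: "delta M n P R \<le> ereal a \<Longrightarrow> ereal b \<le> delta M n P Q \<Longrightarrow> delta M n Q R \<le> ereal (a - b + e0)"
    and delta_outer_ge: "ereal a \<le> delta M n P R \<Longrightarrow> delta M n P Q \<le> ereal b \<Longrightarrow> ereal (a - b - e0) \<le> delta M n Q R"
proof -
  have *: "delta M n P R \<le> delta M n P Q + delta M n Q R + ereal e0"
    "delta M n P Q + delta M n Q R \<le> delta M n P R + ereal e0"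
    using add c unfolding delta_additive_def by blast+
  have nn: "0 \<le> delta M n P R" "0 \<le> delta M n P Q" "0 \<le> delta M n Q R" by simp_all
  show "delta M n Q R \<le> delta M n P R + ereal e0" "delta M n P Q \<le> delta M n P R + ereal e0"
    using * nn by (cases rule: ereal3_cases[of "delta M n P Q" "delta M n Q R" "delta M n P R"]; simp)+
  show "delta M n P Q \<le> ereal a \<Longrightarrow> delta M n Q R \<le> ereal b \<Longrightarrow> delta M n P R \<le> ereal (a + b + e0)"
    and "ereal a \<le> delta M n P Q \<Longrightarrow> ereal b \<le> delta M n Q R \<Longrightarrow> ereal (a + b - e0) \<le> delta M n P R"
    and "delta M n P R \<le> ereal a \<Longrightarrow> ereal b \<le> delta M n Q R \<Longrightarrow> delta M n P Q \<le> ereal (a - b + e0)"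
    and "ereal a \<le> delta M n P R \<Longrightarrow> delta M n Q R \<le> ereal b \<Longrightarrow> ereal (a - b - e0) \<le> delta M n P Q"
    and "delta M n P R \<le> ereal a \<Longrightarrow> ereal b \<le> delta M n P Q \<Longrightarrow> delta M n Q R \<le> ereal (a - b + e0)"
    and "ereal a \<le> delta M n P R \<Longrightarrow> delta M n P Q \<le> ereal b \<Longrightarrow> ereal (a - b - e0) \<le> delta M n Q R"
    using * nn by (cases rule: ereal3_cases[of "delta M n P Q" "delta M n Q R" "delta M n P R"]; simp)+
qed

lemma delta_additive_nonneg: "delta_additive M n e0 \<Longrightarrow> 0 \<le> e0"
  unfolding delta_additive_def by (drule spec[of _ Whole], drule spec[of _ Whole], drule spec[of _ Whole]) simp

section \<open>Generations and levels\<close>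

text \<open>
  What the proof uses of \<open>\<alpha>\<^sub>1, \<alpha>\<^sub>2 \<lless> A\<close> and \<open>\<sigma> \<lless> \<alpha>\<^sub>2\<close>.  The first condition makes \<open>A\<close> larger than
  all distances of auxiliary cubes plus the accumulated errors, and larger than the cost of a
  few doublings of a cube; the second one leaves room for the lower bound of \<open>1 / w\<^sub>k\<close>.
\<close>

locale large_parameters = approximation_of_identity M n C0 e0 e1 \<alpha>1 \<alpha>2 A C7 R Q Qa \<psi> \<phi>
  for M :: "'a::euclidean_space measure" and n C0 e0 e1 \<alpha>1 \<alpha>2 :: real and A :: nat and C7 :: real
    and R :: "nat \<Rightarrow> 'a cube" and Q :: "'a \<Rightarrow> int \<Rightarrow> 'a cube"
    and Qa :: "'a \<Rightarrow> int \<Rightarrow> aux_index \<Rightarrow> 'a cube" and \<psi> \<phi> :: "int \<Rightarrow> 'a \<Rightarrow> 'a \<Rightarrow> real" +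
  assumes n_pos: "0 < n" and C0_pos: "0 < C0" and C7_pos: "0 < C7"
    and additive: "delta_additive M n e0" and e0_le_e1: "e0 \<le> e1"
    and A_large: "10 * kappa + 100 * e1 + \<alpha>1 + \<alpha>2 + 3 * sigma n C0 e0 e1 + 1 \<le> real A"
    and \<alpha>2_large: "16 * (sigma n C0 e0 e1 + 50 * e1 + 10 * kappa + 1) \<le> \<alpha>2"
begin

abbreviation "\<sigma> \<equiv> sigma n C0 e0 e1"
abbreviation "tdist \<equiv> aux_dist \<alpha>1 \<alpha>2 \<sigma>"

lemma e0_nonneg: "0 \<le> e0" using additive by (rule delta_additive_nonneg)
lemma e1_nonneg: "0 \<le> e1" using e0_nonneg e0_le_e1 by simp
lemma kappa_pos: "0 < kappa" using C0_pos by (simp add: kappa_def)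
lemma sigma_nonneg: "0 \<le> \<sigma>" using e0_nonneg e1_nonneg C0_pos by (simp add: sigma_def)

lemma tdist_bounds: "0 \<le> tdist i" "tdist i \<le> \<alpha>1 + \<alpha>2 + 2 * \<sigma>"
  using pos sigma_nonneg by (cases i; simp)+

lemmas parameter_facts = e0_nonneg e0_le_e1 e1_nonneg kappa_pos sigma_nonneg pos A_large \<alpha>2_large

text \<open>
  If the whole space is an initial cube, it is the only cube of generation \<open>k\<close> for each \<open>k \<le> 0\<close>, and
  \<open>S\<^sub>k\<close> vanishes; in all other cases the cubes of generation \<open>k\<close> are transit cubes and points.
\<close>

definition nontrivial :: "int \<Rightarrow> bool" where
  "nontrivial k \<longleftrightarrow> (initial M n \<longrightarrow> 1 \<le> k)"

lemma nontrivial_mono: "nontrivial k \<Longrightarrow> k \<le> j \<Longrightarrow> nontrivial j"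
  by (auto simp: nontrivial_def)

lemma generation_cube: "generation M n e1 A R P k \<Longrightarrow> is_cube M P"
  by (simp add: generation_def)

lemma generation_not_Whole: "generation M n e1 A R P k \<Longrightarrow> nontrivial k \<Longrightarrow> P \<noteq> Whole"
  by (auto simp: generation_def nontrivial_def split: if_splits)

lemma generation_nontrivial: "generation M n e1 A R P k \<Longrightarrow> P \<noteq> Whole \<Longrightarrow> nontrivial k"
  by (auto simp: generation_def nontrivial_def split: if_splits cube.splits)

lemma generation_Whole: "generation M n e1 A R Whole k \<Longrightarrow> initial M n \<and> k \<le> 0"
  by (auto simp: generation_def split: if_splits)

lemma delta_Whole_infinite:
  "\<not> initial M n \<Longrightarrow> is_cube M (Transit z l) \<Longrightarrow> delta M n (Transit z l) Whole = \<infinity>"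
  unfolding initial_def by (metis ereal_infty_less(1))

lemma eq_pm_finite: "eq_pm a b e \<Longrightarrow> a \<noteq> \<infinity>"
  by (auto simp: eq_pm_def)

text \<open>
  \<open>\<delta>(R\<^sub>0, R\<^sub>-\<^sub>j)\<close> grows like \<open>j A\<close>, whereas it would be essentially at most \<open>\<delta>(R\<^sub>0, R\<^sub>-\<^sub>i)\<close> if \<open>R\<^sub>-\<^sub>j\<close> were
  contained in \<open>R\<^sub>-\<^sub>i\<close>, and bounded if the side lengths were.
\<close>

lemma reference_cubes_exhaust:
  assumes ni: "\<not> initial M n"
  obtains zR r where "\<And>i. R i = Transit zR (r i)" "\<And>i. 0 < r i" "zR \<in> supp M"
    "\<And>i j. i \<le> j \<Longrightarrow> r i \<le> r j" "\<And>\<rho>. \<exists>i. \<rho> \<le> r i"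
    "\<And>i. eq_pm (delta M n (R 0) (R i)) (real i * real A) e1"
proof -
  obtain zR l0 where R0: "R 0 = Transit zR l0" and c0: "is_cube M (R 0)"
    using reference_cube[OF ni] by blast
  have l0: "0 < l0" "zR \<in> supp M" using c0 R0 by auto
  have cube: "is_cube M (R i) \<and> (\<exists>l. R i = Transit zR l)" and
    dist: "eq_pm (delta M n (R 0) (R i)) (real i * real A) e1" and
    sub: "cube_set (R 0) \<subseteq> cube_set (R i)" for i
  proof -
    have "(is_cube M (R i) \<and> (\<exists>l. R i = Transit zR l)) \<and> eq_pm (delta M n (R 0) (R i)) (real i * real A) e1
      \<and> cube_set (R 0) \<subseteq> cube_set (R i)"
    proof (cases "i = 0")
      case True
      then show ?thesis using R0 c0 e1_nonneg by (auto simp: eq_pm_def zero_ereal_def)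
    next
      case False
      then have *: "is_cube M (R i)" "concentric (R i) (R 0)" "cube_set (R 0) \<subseteq> cube_set (R i)"
        "eq_pm (delta M n (R 0) (R i)) (real i * real A) e1"
        using reference_cubes[OF ni, of i] by auto
      have "R i \<noteq> Whole"
        using eq_pm_finite[OF *(4)] delta_Whole_infinite[OF ni, of zR l0] c0 R0 by auto
      moreover have "R i \<noteq> Point x" for x
        using *(3) cube_not_subset_point[OF l0(1), of zR x] R0 by auto
      ultimately obtain z l where "R i = Transit z l" by (cases "R i") auto
      then have "R i = Transit zR l" using *(2) R0 by (auto simp: concentric_def centred_at_def)
      then show ?thesis using * by blast
    qed
    then show "is_cube M (R i) \<and> (\<exists>l. R i = Transit zR l)"
      "eq_pm (delta M n (R 0) (R i)) (real i * real A) e1" "cube_set (R 0) \<subseteq> cube_set (R i)" by auto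
  qed
  then obtain r where r: "\<And>i. R i = Transit zR (r i)" by metis
  have rpos: "0 < r i" for i using cube[of i] r[of i] by auto
  have mono: "r i \<le> r j" if "i < j" for i j
  proof (rule ccontr)
    assume "\<not> r i \<le> r j"
    then have "cube_set (R j) \<subseteq> cube_set (R i)" by (simp add: r cube_subset_same_centre)
    then have le: "delta M n (R 0) (R j) \<le> delta M n (R 0) (R i) + ereal e0"
      using cube sub by (intro delta_chain_mono1[OF additive]) auto
    have "ereal (real j * real A - e1) \<le> delta M n (R 0) (R j)" using dist[of j] by (simp add: eq_pm_def)
    also note le
    also have "delta M n (R 0) (R i) + ereal e0 \<le> ereal (real i * real A + e1) + ereal e0"
      using dist[of i] by (intro add_right_mono) (simp add: eq_pm_def)
    finally have "real j * real A \<le> real i * real A + 2 * e1 + e0" by simp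
    moreover have "real i * real A + real A \<le> real j * real A"
      using that mult_right_mono[of "real i + 1" "real j" "real A"] by (simp add: distrib_right)
    ultimately show False using parameter_facts by simp
  qed
  have unb: "\<exists>i. \<rho> \<le> r i" for \<rho>
  proof (rule ccontr)
    assume "\<not> (\<exists>i. \<rho> \<le> r i)"
    then have b: "r i < \<rho>" for i by (auto simp: not_le)
    obtain p where p: "2 * \<rho> / r 0 < 2 ^ p" using real_arch_pow[of 2 "2 * \<rho> / r 0"] by auto
    have bound: "real i * real A \<le> real p * kappa + e1" for i
    proof -
      have "2 * r i \<le> 2 ^ p * r 0"
        using p b[of i] rpos[of 0] by (simp add: field_simps)
      then have "delta M n (R 0) (R i) \<le> ereal (real p * kappa)"
        using sub[of i] rpos[of 0] l0 n_pos C0_pos unfolding r by (intro delta_transit_le) auto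
      moreover have "ereal (real i * real A - e1) \<le> delta M n (R 0) (R i)"
        using dist[of i] by (simp add: eq_pm_def)
      ultimately have "ereal (real i * real A - e1) \<le> ereal (real p * kappa)" by (rule order_trans[rotated])
      then show ?thesis by simp
    qed
    obtain i :: nat where "real p * kappa + e1 < real i" using reals_Archimedean2 by blast
    moreover have "real i * 1 \<le> real i * real A" using parameter_facts by (intro mult_left_mono) auto
    ultimately show False using bound[of i] by simp
  qed
  show ?thesis
  proof (rule that[of zR r])
    show "r i \<le> r j" if "i \<le> j" for i j using mono[of i j] that by (cases "i = j") auto
  qed (use r rpos l0 unb dist in auto)
qed

text \<open>
  A cube \<open>T\<close> from which levels are measured: \<open>\<delta>(P, T) - c\<close> is about \<open>k A\<close> for the cubes \<open>P\<close> of
  generation \<open>k\<close> contained in \<open>T\<close>.  It can be chosen to contain any given bounded set.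
\<close>

definition top_cube :: "'a cube \<Rightarrow> real \<Rightarrow> bool" where
  "top_cube T c \<longleftrightarrow> (if initial M n then T = Whole \<and> c = 0 else \<exists>i. T = R i \<and> c = real i * real A)"

lemma top_cube_is_cube: "top_cube T c \<Longrightarrow> is_cube M T"
proof (cases "initial M n")
  case False
  assume "top_cube T c"
  then obtain i where "T = R i" using False by (auto simp: top_cube_def)
  then show ?thesis
    using reference_cube[OF False] reference_cubes[OF False, of i] by (cases "i = 0") auto
qed (simp add: top_cube_def)

lemma top_cube_covers:
  assumes "bounded B"
  obtains T c where "top_cube T c" "B \<subseteq> cube_set T"
proof (cases "initial M n")
  case True
  then show ?thesis using that[of Whole 0] by (simp add: top_cube_def)
next
  case False
  obtain zR r where R: "\<And>i. R i = Transit zR (r i)" "\<And>\<rho>. \<exists>i. \<rho> \<le> r i"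
    using reference_cubes_exhaust[OF False] by metis
  obtain b where b: "\<And>x. x \<in> B \<Longrightarrow> norm x \<le> b" using assms by (auto simp: bounded_iff)
  obtain i where i: "2 * (b + norm zR) \<le> r i" using R(2) by blast
  have "B \<subseteq> cube_set (R i)"
  proof
    fix x assume "x \<in> B"
    then have "infnorm (x - zR) \<le> b + norm zR"
      using b[of x] infnorm_le_norm[of "x - zR"] norm_triangle_ineq4[of x zR] by linarith
    then show "x \<in> cube_set (R i)" using i by (simp add: R mem_cube)
  qed
  then show ?thesis using that[of "R i" "real i * real A"] False by (auto simp: top_cube_def)
qed

lemma reference_level:
  assumes ni: "\<not> initial M n" and "i \<le> j"
  shows "is_cube M (R i)" "cube_set (R i) \<subseteq> cube_set (R j)"
    "ereal ((real j - real i) * real A - 3 * e1) \<le> delta M n (R i) (R j)"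
    "delta M n (R i) (R j) \<le> ereal ((real j - real i) * real A + 3 * e1)"
proof -
  obtain zR r where R: "\<And>i. R i = Transit zR (r i)" "\<And>i. 0 < r i" "zR \<in> supp M"
    "\<And>i j. i \<le> j \<Longrightarrow> r i \<le> r j" "\<And>i. eq_pm (delta M n (R 0) (R i)) (real i * real A) e1"
    using reference_cubes_exhaust[OF ni] by metis
  have c: "is_cube M (R i)" "cube_set (R i) \<subseteq> cube_set (R j)" if "i \<le> j" for i j
    using R that by (auto intro!: cube_subset_same_centre simp del: cube_set.simps)
  show "is_cube M (R i)" "cube_set (R i) \<subseteq> cube_set (R j)" using c[OF assms(2)] by auto
  note ch = additive c(1)[of 0 0] c(1)[OF assms(2)] c(1)[of j j] c(2)[of 0 i] c(2)[OF assms(2)]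
  have "ereal ((real j * real A - e1) - (real i * real A + e1) - e0) \<le> delta M n (R i) (R j)"
    using R(5)[of i] R(5)[of j] ch by (intro delta_outer_ge[of M n e0 "R 0"]) (auto simp: eq_pm_def)
  then show "ereal ((real j - real i) * real A - 3 * e1) \<le> delta M n (R i) (R j)"
    using e0_le_e1 by (elim order_trans[rotated]) (simp add: algebra_simps)
  have "delta M n (R i) (R j) \<le> ereal ((real j * real A + e1) - (real i * real A - e1) + e0)"
    using R(5)[of i] R(5)[of j] ch by (intro delta_outer_le[of M n e0 "R 0"]) (auto simp: eq_pm_def)
  then show "delta M n (R i) (R j) \<le> ereal ((real j - real i) * real A + 3 * e1)"
    using e0_le_e1 by (elim order_trans) (simp add: algebra_simps)
qed

text \<open>
  Additivity of \<open>\<delta>\<close> along \<open>P\<close> and the two reference cubes: levels hardly depend on the reference.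
\<close>

lemma change_of_reference:
  assumes ni: "\<not> initial M n" and P: "is_cube M P" "cube_set P \<subseteq> cube_set (R i)" "cube_set P \<subseteq> cube_set (R j)"
  shows "delta M n P (R j) \<le> ereal (real j * real A + u) \<Longrightarrow> delta M n P (R i) \<le> ereal (real i * real A + u + 4 * e1)"
    and "ereal (real j * real A + u) \<le> delta M n P (R j) \<Longrightarrow> ereal (real i * real A + u - 4 * e1) \<le> delta M n P (R i)"
proof -
  have cR: "is_cube M (R i)" for i using reference_level(1)[OF ni, of i i] by simp
  assume up: "delta M n P (R j) \<le> ereal (real j * real A + u)"
  show "delta M n P (R i) \<le> ereal (real i * real A + u + 4 * e1)"
  proof (cases "i \<le> j")
    case True
    note rl = reference_level[OF ni True]
    have "delta M n P (R i) \<le> ereal ((real j * real A + u) - ((real j - real i) * real A - 3 * e1) + e0)"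
      using up rl P cR by (intro delta_inner_le[OF additive, of P "R i" "R j"]) auto
    then show ?thesis using e0_le_e1 by (elim order_trans) (simp add: algebra_simps)
  next
    case False
    then have ji: "j \<le> i" by simp
    note rl = reference_level[OF ni ji]
    have "delta M n P (R i) \<le> ereal ((real j * real A + u) + ((real i - real j) * real A + 3 * e1) + e0)"
      using up rl P cR by (intro delta_add_le[OF additive, of P "R j" "R i"]) auto
    then show ?thesis using e0_le_e1 by (elim order_trans) (simp add: algebra_simps)
  qed
next
  have cR: "is_cube M (R i)" for i using reference_level(1)[OF ni, of i i] by simp
  assume lo: "ereal (real j * real A + u) \<le> delta M n P (R j)"
  show "ereal (real i * real A + u - 4 * e1) \<le> delta M n P (R i)"
  proof (cases "i \<le> j")
    case True
    note rl = reference_level[OF ni True]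
    have "ereal ((real j * real A + u) - ((real j - real i) * real A + 3 * e1) - e0) \<le> delta M n P (R i)"
      using lo rl P cR by (intro delta_inner_ge[OF additive, of P "R i" "R j"]) auto
    then show ?thesis using e0_le_e1 by (elim order_trans[rotated]) (simp add: algebra_simps)
  next
    case False
    then have ji: "j \<le> i" by simp
    note rl = reference_level[OF ni ji]
    have "ereal ((real j * real A + u) + ((real i - real j) * real A - 3 * e1) - e0) \<le> delta M n P (R i)"
      using lo rl P cR by (intro delta_add_ge[OF additive, of P "R j" "R i"]) auto
    then show ?thesis using e0_le_e1 by (elim order_trans[rotated]) (simp add: algebra_simps)
  qed
qed

lemma generation_level_le:
  assumes gen: "generation M n e1 A R P k" and nt: "nontrivial k"
    and T: "top_cube T c" and sub: "cube_set P \<subseteq> cube_set T"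
  shows "delta M n P T \<le> ereal (of_int k * real A + c + 5 * e1)"
proof (cases "initial M n")
  case True
  then have "delta M n P T \<le> ereal (of_int k * real A + e1)" "c = 0"
    using gen T generation_not_Whole[OF gen nt]
    by (auto simp: generation_def top_cube_def eq_pm_def le_pm_def split: cube.splits)
  then show ?thesis using e1_nonneg by (elim order_trans) simp
next
  case False
  obtain i where i: "T = R i" "c = real i * real A" using T False by (auto simp: top_cube_def)
  obtain j where j: "cube_set P \<subseteq> cube_set (R j)" "delta M n P (R j) \<le> ereal (of_int (int j + k) * real A + e1)"
    using gen False by (auto simp: generation_def eq_pm_def le_pm_def split: cube.splits)
  have "delta M n P (R i) \<le> ereal (real i * real A + (of_int k * real A + e1) + 4 * e1)"
    using j sub i by (intro change_of_reference(1)[OF False generation_cube[OF gen], of i j]) (auto simp: algebra_simps)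
  then show ?thesis unfolding i by (elim order_trans) simp
qed

lemma generation_level_ge:
  assumes gen: "generation M n e1 A R (Transit z l) k"
    and T: "top_cube T c" and sub: "cube_set (Transit z l) \<subseteq> cube_set T"
  shows "ereal (of_int k * real A + c - 5 * e1) \<le> delta M n (Transit z l) T"
proof (cases "initial M n")
  case True
  then have "ereal (of_int k * real A - e1) \<le> delta M n (Transit z l) T" "c = 0"
    using gen T by (auto simp: generation_def top_cube_def eq_pm_def)
  then show ?thesis using e1_nonneg by (elim order_trans[rotated]) simp
next
  case False
  obtain i where i: "T = R i" "c = real i * real A" using T False by (auto simp: top_cube_def)
  obtain j where j: "cube_set (Transit z l) \<subseteq> cube_set (R j)"
    "ereal (of_int (int j + k) * real A - e1) \<le> delta M n (Transit z l) (R j)"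
    using gen False by (auto simp: generation_def eq_pm_def)
  have "ereal (real i * real A + (of_int k * real A - e1) - 4 * e1) \<le> delta M n (Transit z l) (R i)"
    using j sub i by (intro change_of_reference(2)[OF False generation_cube[OF gen], of i j]) (auto simp: algebra_simps)
  then show ?thesis unfolding i by (elim order_trans[rotated]) simp
qed

lemma phi_psi: "\<phi> k y x = \<psi> k y x / \<alpha>2"
  by (simp add: phi_eq)

lemma cube_eq_UNIV_iff: "cube_set P = UNIV \<longleftrightarrow> P = Whole"
  by (metis bounded_cube cube_set.simps(3) not_bounded_UNIV)

lemma Q_cases:
  assumes "y \<in> supp M" "nontrivial k"
  obtains "Q y k = Point y" | l where "Q y k = Transit y l" "0 < l"
proof -
  have g: "generation M n e1 A R (Q y k) k" "centred_at (Q y k) y"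
    using generation_Q[OF assms(1)] by auto
  then have "Q y k \<noteq> Whole" "is_cube M (Q y k)"
    using generation_not_Whole assms(2) generation_cube by blast+
  with g(2) that show ?thesis by (cases rule: centred_at_cases) auto
qed

lemma aux_cube_proper:
  assumes y: "y \<in> supp M" and k: "nontrivial k"
  shows "is_cube M (Qa y k i) \<and> centred_at (Qa y k i) y \<and> Qa y k i \<noteq> Whole"
proof -
  note aux = aux_Q[OF y, of k i]
  note g = generation_Q[OF y, of k]
  note tb = tdist_bounds[of i]
  show ?thesis
  proof (cases rule: Q_cases[OF y k])
    case 1
    show ?thesis
    proof (cases "Q y (k - 1) = Q y k")
      case True
      then have "Qa y k i = Point y" using aux 1 by (simp add: aux_cube_def)
      then show ?thesis using y by (simp add: centred_at_def)
    next
      case False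
      then consider "Qa y k i = Point y"
        | "is_cube M (Qa y k i)" "centred_at (Qa y k i) y" "cube_set (Qa y k i) \<subseteq> cube_set (Q y (k - 1))"
          "eq_pm (delta M n (Qa y k i) (Q y (k - 1))) (real A - tdist i) e1"
        using aux 1 by (auto simp: aux_cube_def)
      then show ?thesis
      proof cases
        case 1
        then show ?thesis using y by (simp add: centred_at_def)
      next
        case 2
        have "Qa y k i \<noteq> Whole"
        proof
          assume W: "Qa y k i = Whole"
          then have "Q y (k - 1) = Whole" using 2(3) cube_eq_UNIV_iff by auto
          then show False using 2(4) W parameter_facts tb by (simp add: eq_pm_def)
        qed
        then show ?thesis using 2 by simp
      qed
    qed
  next
    case (2 l)
    have a: "is_cube M (Qa y k i)" "centred_at (Qa y k i) y"
      "eq_pm (delta M n (Q y k) (Qa y k i)) (tdist i) e1"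
      using aux 2 by (auto simp: aux_cube_def)
    have "Qa y k i \<noteq> Whole"
    proof
      assume W: "Qa y k i = Whole"
      show False
      proof (cases "initial M n")
        case True
        then have "ereal (of_int k * real A - e1) \<le> delta M n (Q y k) Whole" "1 \<le> k"
          using g 2 by (auto simp: generation_def eq_pm_def)
        moreover have "delta M n (Q y k) Whole \<le> ereal (tdist i + e1)"
          using a W by (simp add: eq_pm_def)
        ultimately have "ereal (of_int k * real A - e1) \<le> ereal (tdist i + e1)" by (meson order_trans)
        moreover have "real A \<le> of_int k * real A"
          using \<open>1 \<le> k\<close> mult_right_mono[of 1 "of_int k" "real A"] by simp
        ultimately show False using parameter_facts tb by simp
      next
        case False
        then show False
          using a(3) W delta_Whole_infinite[OF False, of y l] y 2 eq_pm_finite by auto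
      qed
    qed
    then show ?thesis using a by simp
  qed
qed

lemma aux_cube_cases:
  assumes "y \<in> supp M" "nontrivial k"
  obtains "Qa y k i = Point y" | l where "Qa y k i = Transit y l" "0 < l"
  using aux_cube_proper[OF assms, of i] that by (cases "Qa y k i") (auto simp: centred_at_def)

text \<open>
  This includes the case that the previous cube is the whole space, which then is the cube from
  which levels are measured and has level \<open>0 = (k - 1) A\<close>.
\<close>

lemma previous_generation_bounds:
  assumes y: "y \<in> supp M" and k: "nontrivial k" and T: "top_cube T c"
    and sub: "cube_set (Q y (k - 1)) \<subseteq> cube_set T"
  shows "delta M n (Q y (k - 1)) T \<le> ereal ((of_int k - 1) * real A + c + 5 * e1)"
    and "Q y (k - 1) \<noteq> Point y \<Longrightarrow> ereal ((of_int k - 1) * real A + c - 5 * e1) \<le> delta M n (Q y (k - 1)) T"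
proof -
  note g = generation_Q[OF y, of "k - 1"]
  have *: "delta M n (Q y (k - 1)) T \<le> ereal ((of_int k - 1) * real A + c + 5 * e1) \<and>
    (Q y (k - 1) \<noteq> Point y \<longrightarrow> ereal ((of_int k - 1) * real A + c - 5 * e1) \<le> delta M n (Q y (k - 1)) T)"
  proof (cases "Q y (k - 1) = Whole")
    case True
    then have "initial M n" "k - 1 \<le> 0" using g generation_Whole[of "k - 1"] by auto
    then have "k = 1" "T = Whole" "c = 0" using k T by (auto simp: nontrivial_def top_cube_def)
    then show ?thesis using True e1_nonneg by simp
  next
    case False
    then have nt: "nontrivial (k - 1)" using g generation_nontrivial by blast
    have "delta M n (Q y (k - 1)) T \<le> ereal (of_int (k - 1) * real A + c + 5 * e1)"
      using g nt T sub by (intro generation_level_le) auto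
    moreover have "ereal (of_int (k - 1) * real A + c - 5 * e1) \<le> delta M n (Q y (k - 1)) T" if "Q y (k - 1) \<noteq> Point y"
    proof (cases rule: Q_cases[OF y nt])
      case 1
      then show ?thesis using that by simp
    next
      case (2 l)
      then show ?thesis using g T sub generation_level_ge[of y l "k - 1" T c] by simp
    qed
    ultimately show ?thesis by simp
  qed
  then show "delta M n (Q y (k - 1)) T \<le> ereal ((of_int k - 1) * real A + c + 5 * e1)"
    "Q y (k - 1) \<noteq> Point y \<Longrightarrow> ereal ((of_int k - 1) * real A + c - 5 * e1) \<le> delta M n (Q y (k - 1)) T"
    by auto
qed

text \<open>
  The auxiliary cube with number \<open>t\<close> has level about \<open>k A - t\<close>; if it degenerates to a point, its
  level is at most that, up to the same error.
\<close>

lemma aux_cube_level: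
  assumes y: "y \<in> supp M" and k: "nontrivial k" and T: "top_cube T c"
    and sub: "cube_set (Q y k) \<subseteq> cube_set T" "cube_set (Q y (k - 1)) \<subseteq> cube_set T" "cube_set (Qa y k i) \<subseteq> cube_set T"
  shows "delta M n (Qa y k i) T \<le> ereal (of_int k * real A - tdist i + c + 7 * e1)" (is ?U)
    and "Qa y k i \<noteq> Point y \<Longrightarrow> ereal (of_int k * real A - tdist i + c - 7 * e1) \<le> delta M n (Qa y k i) T" (is "_ \<Longrightarrow> ?L")
proof -
  note aux = aux_Q[OF y, of k i]
  note g = generation_Q[OF y]
  note tb = tdist_bounds[of i]
  note pc = aux_cube_proper[OF y k, of i]
  note cube = generation_cube[OF conjunct1[OF g[of k]]] generation_cube[OF conjunct1[OF g[of "k - 1"]]]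
    conjunct1[OF pc] top_cube_is_cube[OF T]
  note lev = previous_generation_bounds[OF y k T sub(2)]
  have "?U \<and> (Qa y k i \<noteq> Point y \<longrightarrow> ?L)"
  proof (cases rule: Q_cases[OF y k])
    case 1
    show ?thesis
    proof (cases "Q y (k - 1) = Q y k")
      case True
      then have P: "Qa y k i = Point y" using aux 1 by (simp add: aux_cube_def)
      have "delta M n (Point y) T \<le> ereal ((of_int k - 1) * real A + c + 5 * e1)"
        using lev(1) True 1 by simp
      also have "\<dots> \<le> ereal (of_int k * real A - tdist i + c + 7 * e1)"
        using tb parameter_facts by (simp add: algebra_simps)
      finally show ?thesis using P by simp
    next
      case False
      then have F: "Q y (k - 1) \<noteq> Point y" using 1 by simp
      from False consider "Qa y k i = Point y" "delta M n (Point y) (Q y (k - 1)) < ereal (real A - tdist i - e1)"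
        | "cube_set (Qa y k i) \<subseteq> cube_set (Q y (k - 1))"
          "eq_pm (delta M n (Qa y k i) (Q y (k - 1))) (real A - tdist i) e1"
        using aux 1 by (auto simp: aux_cube_def)
      then have "delta M n (Qa y k i) (Q y (k - 1)) \<le> ereal (real A - tdist i + e1) \<and>
        cube_set (Qa y k i) \<subseteq> cube_set (Q y (k - 1)) \<and>
        (Qa y k i \<noteq> Point y \<longrightarrow> ereal (real A - tdist i - e1) \<le> delta M n (Qa y k i) (Q y (k - 1)))"
      proof cases
        case 1
        have "y \<in> cube_set (Q y (k - 1))"
          using g[of "k - 1"] cube(2) by (cases "Q y (k - 1)") (auto simp: centred_at_def centre_in_cube)
        moreover have "delta M n (Point y) (Q y (k - 1)) \<le> ereal (real A - tdist i + e1)"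
          using less_imp_le[OF 1(2)] e1_nonneg by (elim order_trans) simp
        ultimately show ?thesis using 1 by simp
      qed (auto simp: eq_pm_def)
      then have U: "delta M n (Qa y k i) (Q y (k - 1)) \<le> ereal (real A - tdist i + e1)"
        and ps: "cube_set (Qa y k i) \<subseteq> cube_set (Q y (k - 1))"
        and L: "Qa y k i \<noteq> Point y \<Longrightarrow> ereal (real A - tdist i - e1) \<le> delta M n (Qa y k i) (Q y (k - 1))"
        by auto
      have "delta M n (Qa y k i) T \<le> ereal ((real A - tdist i + e1) + ((of_int k - 1) * real A + c + 5 * e1) + e0)"
        using cube ps sub U lev by (intro delta_add_le[OF additive, of _ "Q y (k - 1)"]) auto
      then have ?U using e0_le_e1 by (elim order_trans) (simp add: algebra_simps)
      moreover have ?L if "Qa y k i \<noteq> Point y"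
      proof -
        have "ereal ((real A - tdist i - e1) + ((of_int k - 1) * real A + c - 5 * e1) - e0) \<le> delta M n (Qa y k i) T"
          using cube ps sub L[OF that] lev(2)[OF F] by (intro delta_add_ge[OF additive, of _ "Q y (k - 1)"]) auto
        then show ?thesis using e0_le_e1 by (elim order_trans[rotated]) (simp add: algebra_simps)
      qed
      ultimately show ?thesis by simp
    qed
  next
    case (2 l)
    have a: "cube_set (Q y k) \<subseteq> cube_set (Qa y k i)" "eq_pm (delta M n (Q y k) (Qa y k i)) (tdist i) e1"
      using aux 2 by (auto simp: aux_cube_def)
    have l1: "delta M n (Q y k) T \<le> ereal (of_int k * real A + c + 5 * e1)"
      using g k T sub by (intro generation_level_le) auto
    have l2: "ereal (of_int k * real A + c - 5 * e1) \<le> delta M n (Q y k) T"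
      using g[of k] T sub generation_level_ge[of y l k T c] 2 by simp
    have "delta M n (Qa y k i) T \<le> ereal ((of_int k * real A + c + 5 * e1) - (tdist i - e1) + e0)"
      using cube a sub l1 by (intro delta_outer_le[OF additive, of "Q y k"]) (auto simp: eq_pm_def)
    then have ?U using e0_le_e1 by (elim order_trans) (simp add: algebra_simps)
    moreover have "ereal ((of_int k * real A + c - 5 * e1) - (tdist i + e1) - e0) \<le> delta M n (Qa y k i) T"
      using cube a sub l2 by (intro delta_outer_ge[OF additive, of "Q y k"]) (auto simp: eq_pm_def)
    then have ?L using e0_le_e1 by (elim order_trans[rotated]) (simp add: algebra_simps)
    ultimately show ?thesis by simp
  qed
  then show ?U "Qa y k i \<noteq> Point y \<Longrightarrow> ?L" by auto
qed

text \<open>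
  Everything that has to be contained in a cube from which the levels of the auxiliary cubes of
  \<open>Q\<^sub>y\<^sub>,\<^sub>k\<close> are to be measured.  The whole space is left out, to have a bounded set; it only occurs when
  levels are measured from the whole space anyway.
\<close>

definition hood :: "'a \<Rightarrow> int \<Rightarrow> 'a set" where
  "hood y k = cube_set (Q y k) \<union> (if Q y (k - 1) = Whole then {} else cube_set (Q y (k - 1))) \<union>
     (\<Union>i\<in>{I1, Ihat1, I2, Ihat2, I3}. cube_set (Qa y k i))"

lemma bounded_hood:
  assumes "y \<in> supp M" "nontrivial k"
  shows "bounded (hood y k)"
  unfolding hood_def
  using aux_cube_proper[OF assms] generation_not_Whole[OF conjunct1[OF generation_Q[OF assms(1)]] assms(2)]
  by (auto intro!: bounded_cube)

lemma top_cube_contains_hood: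
  assumes y: "y \<in> supp M" and T: "top_cube T c" and sub: "hood y k \<subseteq> cube_set T"
  shows "cube_set (Q y k) \<subseteq> cube_set T" "cube_set (Q y (k - 1)) \<subseteq> cube_set T"
    "cube_set (Qa y k i) \<subseteq> cube_set T"
proof -
  show "cube_set (Q y (k - 1)) \<subseteq> cube_set T"
  proof (cases "Q y (k - 1) = Whole")
    case True
    then have "initial M n" using generation_Q[OF y, of "k - 1"] generation_Whole by auto
    then show ?thesis using T by (simp add: top_cube_def)
  qed (use sub in \<open>auto simp: hood_def\<close>)
  show "cube_set (Qa y k i) \<subseteq> cube_set T"
    using sub by (cases i) (auto simp: hood_def)
qed (use sub in \<open>auto simp: hood_def\<close>)

lemma top_cube_covers_aux:
  assumes y: "y \<in> supp M" and k: "nontrivial k" and B: "bounded B"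
  obtains T c where "top_cube T c" "B \<subseteq> cube_set T" "cube_set (Q y k) \<subseteq> cube_set T"
    "cube_set (Q y (k - 1)) \<subseteq> cube_set T" "\<And>i. cube_set (Qa y k i) \<subseteq> cube_set T"
proof -
  have "bounded (B \<union> hood y k)" using B bounded_hood[OF y k] by simp
  then obtain T c where T: "top_cube T c" and sub: "B \<union> hood y k \<subseteq> cube_set T"
    by (rule top_cube_covers)
  have h: "hood y k \<subseteq> cube_set T" using sub by simp
  show ?thesis using that[OF T] sub top_cube_contains_hood[OF y T h] by blast
qed

text \<open>
  If \<open>\<phi>\<^sub>y\<^sub>,\<^sub>j(x) \<noteq> 0\<close>, then \<open>x\<close> lies in \<open>Q\<^sub>y\<^sub>,\<^sub>j\<^sub>-\<^sub>1\<close>, because the \<open>\<delta>\<close>-distance \<open>A\<close> between consecutive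
  generations is much larger than the one between \<open>Q\<^sub>y\<^sub>,\<^sub>j\<close> and \<open>Q\<^sup>3\<^sub>y\<^sub>,\<^sub>j\<close>.
\<close>

lemma psi_zero_outside: "y \<in> supp M \<Longrightarrow> x \<notin> cube_set (Qa y j I3) \<Longrightarrow> \<psi> j y x = 0"
  using bump_psi[of y j] closure_subset[of "{x. \<psi> j y x \<noteq> 0}"] unfolding bump_def by blast

lemma psi_support:
  assumes y: "y \<in> supp M" and j: "nontrivial (j - 1)" and nz: "\<psi> j y x \<noteq> 0"
  obtains l where "Q y (j - 1) = Transit y l" "generation M n e1 A R (Transit y l) (j - 1)"
    "0 < l" "x \<in> cube_set (Transit y l)"
proof -
  have j': "nontrivial j" using nontrivial_mono[OF j] by simp
  note g = generation_Q[OF y]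
  have x: "x \<in> cube_set (Qa y j I3)" using psi_zero_outside[OF y] nz by blast
  obtain T c where T: "top_cube T c" and sub: "cube_set (Q y j) \<subseteq> cube_set T"
    "cube_set (Q y (j - 1)) \<subseteq> cube_set T" "\<And>i. cube_set (Qa y j i) \<subseteq> cube_set T"
    by (rule top_cube_covers_aux[OF y j' bounded_empty]) blast
  note lev = previous_generation_bounds[OF y j' T sub(2)]
  note cube = generation_cube[OF conjunct1[OF g[of j]]] generation_cube[OF conjunct1[OF g[of "j - 1"]]]
    conjunct1[OF aux_cube_proper[OF y j', of I3]] top_cube_is_cube[OF T]
  have "Q y (j - 1) \<noteq> Point y"
  proof
    assume P: "Q y (j - 1) = Point y"
    show False
    proof (cases rule: Q_cases[OF y j'])
      case 1
      then have "Qa y j Ihat2 = Point y"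
        using aux_Q[OF y, of j Ihat2] P by (simp add: aux_cube_def)
      then show False using bump_psi[OF y, of j] nz by (simp add: bump_def)
    next
      case (2 l)
      have "ereal (of_int j * real A + c - 5 * e1) \<le> delta M n (Q y j) T"
        using generation_level_ge[of y l j T c] g[of j] 2 T sub by simp
      also have "\<dots> \<le> delta M n (Point y) T + ereal e0"
        using cube 2 P sub centre_in_cube[of l y] by (intro delta_chain_mono[OF additive]) auto
      also have "\<dots> \<le> ereal ((of_int j - 1) * real A + c + 5 * e1) + ereal e0"
        using lev(1) P by (intro add_right_mono) simp
      finally show False using parameter_facts by (simp add: algebra_simps)
    qed
  qed
  then obtain l where l: "Q y (j - 1) = Transit y l" "0 < l"
    using Q_cases[OF y j] by metis
  have "cube_set (Qa y j I3) \<subseteq> cube_set (Q y (j - 1))"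
  proof (cases rule: aux_cube_cases[OF y j', of I3])
    case 1
    then show ?thesis using l by (simp add: centre_in_cube)
  next
    case (2 l3)
    show ?thesis
    proof (cases "l3 \<le> l")
      case True
      then show ?thesis using l 2 by (simp add: cube_subset_same_centre)
    next
      case False
      then have "cube_set (Q y (j - 1)) \<subseteq> cube_set (Qa y j I3)" using l 2 by (simp add: cube_subset_same_centre)
      then have le: "delta M n (Qa y j I3) T \<le> delta M n (Q y (j - 1)) T + ereal e0"
        using cube sub by (intro delta_chain_mono[OF additive]) auto
      have "ereal (of_int j * real A - tdist I3 + c - 7 * e1) \<le> delta M n (Qa y j I3) T"
        using 2 by (intro aux_cube_level(2)[OF y j' T sub(1,2,3)]) auto
      also note le
      also have "delta M n (Q y (j - 1)) T + ereal e0 \<le> ereal ((of_int j - 1) * real A + c + 5 * e1) + ereal e0"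
        using lev(1) by (intro add_right_mono) simp
      finally show ?thesis using parameter_facts by (simp add: algebra_simps)
    qed
  qed
  then show ?thesis using that[of l] l x g[of "j - 1"] by auto
qed

text \<open>
  For \<open>k < i\<close> the cube \<open>Q\<^sub>x\<^sub>,\<^sub>k\<close> cannot be the point \<open>x\<close>, whose level would be at most \<open>k A\<close>, since \<open>x\<close> lies
  in a cube of level about \<open>i A\<close>.
\<close>

lemma in_earlier_generation:
  assumes x: "x \<in> supp M" and gen: "generation M n e1 A R (Transit z l) i" and xz: "x \<in> cube_set (Transit z l)"
    and k: "nontrivial k" "k \<le> i"
  obtains z' l' where "generation M n e1 A R (Transit z' l') k" "x \<in> cube_set (Transit z' l')"
proof (cases "i = k")
  case True
  then show ?thesis using that gen xz by blast
next
  case False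
  show ?thesis
  proof (cases rule: Q_cases[OF x k(1)])
    case 1
    obtain T c where T: "top_cube T c" and sub: "cube_set (Transit z l) \<subseteq> cube_set T"
      by (rule top_cube_covers[OF bounded_cube[of "Transit z l"]]) auto
    note g = generation_Q[OF x, of k]
    have "ereal (of_int i * real A + c - 5 * e1) \<le> delta M n (Transit z l) T"
      by (rule generation_level_ge[OF gen T sub])
    also have "\<dots> \<le> delta M n (Point x) T + ereal e0"
      using generation_cube[OF gen] x xz sub top_cube_is_cube[OF T]
      by (intro delta_chain_mono[OF additive]) auto
    also have "delta M n (Point x) T + ereal e0 \<le> ereal (of_int k * real A + c + 5 * e1) + ereal e0"
      using generation_level_le[of "Point x" k T c] g 1 k T sub xz by (intro add_right_mono) auto
    finally have "of_int i * real A \<le> of_int k * real A + 11 * e1" using e0_le_e1 by simp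
    moreover have "(of_int k + 1) * real A \<le> of_int i * real A"
      using False k by (intro mult_right_mono) auto
    ultimately show ?thesis using parameter_facts by (simp add: algebra_simps)
  next
    case (2 l')
    then show ?thesis using that[of x l'] generation_Q[OF x, of k] centre_in_cube[of l' x] by simp
  qed
qed

text \<open>
  A point \<open>u\<close> of a cube \<open>P\<close> of generation \<open>j - 1\<close> cannot be close to a small cube \<open>Q\<^sup>1\<^sub>y\<^sub>,\<^sub>k\<close> when
  \<open>k\<close> is much smaller than \<open>j\<close>: otherwise a moderate enlargement of \<open>P\<close> would contain
  \<open>Q\<^sup>1\<^sub>y\<^sub>,\<^sub>k\<close>, although its level exceeds that of \<open>Q\<^sup>1\<^sub>y\<^sub>,\<^sub>k\<close>.
\<close>

lemma early_aux_cube_large_or_far: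
  assumes y: "y \<in> supp M" and k: "nontrivial k" and kj: "k + 2 \<le> j"
    and gen: "generation M n e1 A R (Transit z l) (j - 1)" and u: "u \<in> cube_set (Transit z l)"
  shows "(\<exists>s. Qa y k I1 = Transit y s \<and> 2 ^ nat (j - k) * l / 4 \<le> s) \<or> 2 ^ nat (j - k) * l / 4 \<le> norm (u - y)"
proof (rule ccontr)
  define p where "p = nat (j - k)"
  define \<Lambda> where "\<Lambda> = 2 ^ p * l"
  assume "\<not> ?thesis"
  then have small: "\<And>s. Qa y k I1 = Transit y s \<Longrightarrow> s < \<Lambda> / 4" and near: "norm (u - y) < \<Lambda> / 4"
    by (auto simp: \<Lambda>_def p_def not_le)
  have cP: "is_cube M (Transit z l)" using generation_cube[OF gen] .
  then have l: "0 < l" "z \<in> supp M" by auto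
  have p: "2 \<le> p" "int p = j - k" using kj by (auto simp: p_def)
  have "(2::real) ^ 2 \<le> 2 ^ p" using p(1) by (intro power_increasing) auto
  then have lL: "4 * l \<le> \<Lambda>" using l by (simp add: \<Lambda>_def)
  let ?P = "Transit z l" and ?PL = "Transit z \<Lambda>"
  have PPL: "cube_set ?P \<subseteq> cube_set ?PL" using lL l by (intro cube_subset_same_centre) simp
  have zy: "infnorm (y - z) \<le> \<Lambda> / 4 + l / 2"
    using infnorm_dist_triangle[of y z u] infnorm_le_norm[of "u - y"] near u
    by (simp add: mem_cube infnorm_dist_commute[of y u])
  have QPL: "cube_set (Qa y k I1) \<subseteq> cube_set ?PL"
  proof (cases rule: aux_cube_cases[OF y k, of I1])
    case 1
    then show ?thesis using zy lL l by (simp add: mem_cube)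
  next
    case (2 s)
    then show ?thesis using small[OF 2(1)] zy lL l by (auto intro!: cube_subset_transit)
  qed
  have cPL: "is_cube M ?PL" using l lL by auto
  obtain T c where T: "top_cube T c" and PLT: "cube_set ?PL \<subseteq> cube_set T" and sub: "cube_set (Q y k) \<subseteq> cube_set T"
    "cube_set (Q y (k - 1)) \<subseteq> cube_set T" "\<And>i. cube_set (Qa y k i) \<subseteq> cube_set T"
    using top_cube_covers_aux[OF y k bounded_cube[of ?PL]] by (metis cube.distinct(5))
  have d1: "delta M n (Qa y k I1) T \<le> ereal (of_int k * real A - \<alpha>1 + c + 7 * e1)"
    using aux_cube_level(1)[OF y k T sub(1,2) sub(3)[of I1]] by simp
  have "delta M n ?PL T \<le> delta M n (Qa y k I1) T + ereal e0"
    using aux_cube_proper[OF y k, of I1] cPL top_cube_is_cube[OF T] QPL PLT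
    by (intro delta_chain_mono[OF additive]) auto
  also have "\<dots> \<le> ereal (of_int k * real A - \<alpha>1 + c + 7 * e1) + ereal e0"
    using d1 by (rule add_right_mono)
  finally have d2: "delta M n ?PL T \<le> ereal (of_int k * real A - \<alpha>1 + c + 7 * e1 + e0)" by simp
  have d3: "delta M n ?P ?PL \<le> ereal (real (Suc p) * kappa)"
    using l n_pos C0_pos PPL by (intro delta_transit_le) (auto simp: \<Lambda>_def)
  have "delta M n ?P T \<le> ereal (real (Suc p) * kappa + (of_int k * real A - \<alpha>1 + c + 7 * e1 + e0) + e0)"
    by (rule delta_add_le[OF additive cP cPL top_cube_is_cube[OF T] PPL PLT d3 d2])
  moreover have "ereal (of_int (j - 1) * real A + c - 5 * e1) \<le> delta M n ?P T"
    using generation_level_ge[OF gen T] PPL PLT by auto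
  ultimately have "ereal (of_int (j - 1) * real A + c - 5 * e1)
      \<le> ereal (real (Suc p) * kappa + (of_int k * real A - \<alpha>1 + c + 7 * e1 + e0) + e0)"
    by (rule order_trans[rotated])
  then have "(of_int (j - 1) - of_int k) * real A \<le> real (Suc p) * kappa + 14 * e1"
    using parameter_facts by (simp add: algebra_simps)
  moreover have "of_int (j - 1) - of_int k = real p - 1"
  proof -
    have "j = k + int p" using p by simp
    then show ?thesis by simp
  qed
  ultimately have "(real p - 1) * real A \<le> real (Suc p) * kappa + 14 * e1" by (simp only:)
  moreover have "(real p - 1) * (10 * kappa + 100 * e1) < (real p - 1) * real A"
    using p parameter_facts by (intro mult_strict_left_mono) auto
  moreover have "real (Suc p) * kappa \<le> (3 * (real p - 1)) * kappa"
    using p kappa_pos by (intro mult_right_mono) auto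
  moreover have "1 * (100 * e1) \<le> (real p - 1) * (100 * e1)"
    using p e1_nonneg by (intro mult_right_mono) auto
  moreover have "0 \<le> (real p - 1) * kappa" using p kappa_pos by simp
  ultimately show False
    using e1_nonneg kappa_pos
    unfolding of_nat_Suc distrib_left distrib_right left_diff_distrib right_diff_distrib by linarith
qed

end

lemma inv_pow_le:
  assumes "0 < a" "a \<le> s" "0 \<le> p"
  shows "inv_pow (ereal s) p \<le> ereal (a powr (- p))"
  using assms by (auto simp: inv_pow_def powr_mono2')

text \<open>
  A chain of sublevel sets of \<open>g\<close> need not have a largest member; a countable cofinal part of it
  is enough to pass to the union.
\<close>

lemma nn_integral_sublevel_union_le:
  fixes g :: "'a \<Rightarrow> real"
  assumes [measurable]: "g \<in> borel_measurable M" "f \<in> borel_measurable M"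
    and le: "\<And>y. y \<in> S \<Longrightarrow> (\<integral>\<^sup>+u. f u * indicator {u \<in> space M. g u \<le> g y} u \<partial>M) \<le> c"
  obtains V where "V \<in> sets M" "S \<inter> space M \<subseteq> V" "(\<integral>\<^sup>+u. f u * indicator V u \<partial>M) \<le> c"
proof (cases "S = {}")
  case True
  then show ?thesis using that[of "{}"] by simp
next
  case False
  then obtain y0 where y0: "y0 \<in> S" by auto
  obtain y where y: "\<And>i::nat. y i \<in> S" "\<And>u. u \<in> S \<Longrightarrow> \<exists>i. g u \<le> g (y i)"
  proof (cases "\<exists>m\<in>S. \<forall>u\<in>S. g u \<le> g m")
    case True
    then obtain m where "m \<in> S" "\<forall>u\<in>S. g u \<le> g m" by auto
    then show ?thesis using that[of "\<lambda>_. m"] by auto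
  next
    case no_max: False
    define q where "q i = real_of_rat (nat_to_rat_surj i)" for i
    define y where "y i = (if \<exists>v\<in>S. q i \<le> g v then SOME v. v \<in> S \<and> q i \<le> g v else y0)" for i
    have y: "y i \<in> S \<and> ((\<exists>v\<in>S. q i \<le> g v) \<longrightarrow> q i \<le> g (y i))" for i
    proof (cases "\<exists>v\<in>S. q i \<le> g v")
      case True
      then have "\<exists>v. v \<in> S \<and> q i \<le> g v" by auto
      from someI_ex[OF this] show ?thesis using True by (simp add: y_def)
    qed (simp add: y_def y0)
    show ?thesis
    proof (rule that[of y])
      fix u assume "u \<in> S"
      then obtain v where v: "v \<in> S" "g u < g v" using no_max by (auto simp: not_le)
      obtain r where r: "g u < of_rat r" "of_rat r < g v" using of_rat_dense[OF v(2)] by auto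
      obtain i where "r = nat_to_rat_surj i" using surj_nat_to_rat_surj by (metis surjD)
      then have "g u < q i" "q i < g v" using r by (auto simp: q_def)
      then show "\<exists>i. g u \<le> g (y i)" using y[of i] v by (intro exI[of _ i]) force
    qed (use y in auto)
  qed
  define W where "W i = {u \<in> space M. \<exists>j\<le>i. g u \<le> g (y j)}" for i
  have W [measurable]: "W i \<in> sets M" for i unfolding W_def by measurable
  have inc: "incseq W" by (rule incseq_SucI) (auto simp: W_def intro: le_SucI)
  have Wc: "(\<integral>\<^sup>+u. f u * indicator (W i) u \<partial>M) \<le> c" for i
  proof -
    have "Max ((\<lambda>j. g (y j)) ` {..i}) \<in> (\<lambda>j. g (y j)) ` {..i}" by (rule Max_in) auto
    then obtain j where j: "j \<le> i" and m: "Max ((\<lambda>j. g (y j)) ` {..i}) = g (y j)"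
      by (elim imageE) auto
    have j': "g (y j') \<le> g (y j)" if "j' \<le> i" for j'
      unfolding m[symmetric] using that by (intro Max_ge) auto
    have "(\<integral>\<^sup>+u. f u * indicator (W i) u \<partial>M) \<le> (\<integral>\<^sup>+u. f u * indicator {u \<in> space M. g u \<le> g (y j)} u \<partial>M)"
      using j' by (intro nn_integral_mono) (auto simp: W_def indicator_def intro: order_trans)
    also have "\<dots> \<le> c" using y(1) by (rule le)
    finally show ?thesis .
  qed
  show ?thesis
  proof (rule that[of "\<Union>i. W i"])
    show "S \<inter> space M \<subseteq> (\<Union>i. W i)"
    proof
      fix u assume u: "u \<in> S \<inter> space M"
      then obtain i where "g u \<le> g (y i)" using y(2)[of u] by auto
      then have "u \<in> W i" using u by (auto simp: W_def)
      then show "u \<in> (\<Union>i. W i)" by blast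
    qed
    have "(\<integral>\<^sup>+u. f u * indicator (\<Union>i. W i) u \<partial>M) = (\<integral>\<^sup>+u. (SUP i. f u * indicator (W i) u) \<partial>M)"
    proof (rule nn_integral_cong)
      fix u
      have "(SUP i. f u * indicator (W i) u) = f u * (SUP i. indicator (W i) u)"
        by (rule SUP_mult_left_ennreal[symmetric])
      also have "(SUP i. indicator (W i) u) = (indicator (\<Union>i. W i) u :: ennreal)"
        by (auto simp: indicator_def intro!: antisym SUP_least SUP_upper2)
      finally show "f u * indicator (\<Union>i. W i) u = (SUP i. f u * indicator (W i) u)" by simp
    qed
    also have "\<dots> = (SUP i. \<integral>\<^sup>+u. f u * indicator (W i) u \<partial>M)"
      using inc by (intro nn_integral_monotone_convergence_SUP)
        (auto simp: incseq_def le_fun_def indicator_def)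
    also have "\<dots> \<le> c" using Wc by (auto intro: SUP_least)
    finally show "(\<integral>\<^sup>+u. f u * indicator (\<Union>i. W i) u \<partial>M) \<le> c" .
  qed measurable
qed

context large_parameters begin

section \<open>Regularity of the bump functions\<close>

lemma psi_nonneg: "y \<in> supp M \<Longrightarrow> 0 \<le> \<psi> k y x"
  using bump_psi[of y k] by (auto simp: bump_def)

lemma psi_le: "y \<in> supp M \<Longrightarrow> x \<noteq> y \<Longrightarrow> \<psi> k y x \<le> norm (x - y) powr (- n)"
proof -
  assume "y \<in> supp M" "x \<noteq> y"
  then have "ereal (\<psi> k y x) \<le> inv_pow (ereal (norm (y - x))) n"
    using bump_psi[of y k] by (auto simp: bump_def)
  also have "\<dots> \<le> ereal (norm (x - y) powr (- n))"
    using \<open>x \<noteq> y\<close> n_pos by (intro inv_pow_le) (auto simp: norm_minus_commute)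
  finally show ?thesis by simp
qed

lemma psi_eq_on_shell:
  "y \<in> supp M \<Longrightarrow> x \<in> cube_set (Qa y k Ihat2) \<Longrightarrow> x \<notin> cube_set (Qa y k I1) \<Longrightarrow> \<psi> k y x = norm (x - y) powr (- n)"
  using bump_psi[of y k] by (auto simp: bump_def)

lemma psi_height_le:
  assumes y: "y \<in> supp M" and b: "0 < b"
    and large: "(\<exists>s. Qa y k I1 = Transit y s \<and> b \<le> s) \<or> b \<le> norm (x - y)"
  shows "\<psi> k y x \<le> max 4 (4 powr n) * b powr (- n)"
proof -
  let ?h = "max 4 (4 powr n)"
  have *: "ereal (\<psi> k y x) \<le> ereal ?h * inv_pow (side (Qa y k I1)) n"
    "ereal (\<psi> k y x) \<le> inv_pow (ereal (norm (y - x))) n"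
    using bump_psi[OF y, of k] by (auto simp: bump_def)
  show ?thesis
    using large
  proof
    assume "\<exists>s. Qa y k I1 = Transit y s \<and> b \<le> s"
    then obtain s where "Qa y k I1 = Transit y s" "b \<le> s" by auto
    then have "ereal ?h * inv_pow (side (Qa y k I1)) n \<le> ereal ?h * ereal (b powr (- n))"
      using inv_pow_le[of b s n] b n_pos by (intro ereal_mult_left_mono) (auto simp: max_def)
    with *(1) have "ereal (\<psi> k y x) \<le> ereal ?h * ereal (b powr (- n))" by (rule order_trans)
    then show ?thesis by (simp only: times_ereal.simps ereal_less_eq)
  next
    assume "b \<le> norm (x - y)"
    then have "ereal (\<psi> k y x) \<le> ereal (b powr (- n))"
      using order_trans[OF *(2) inv_pow_le[of b "norm (y - x)" n]] b n_pos by (simp add: norm_minus_commute)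
    moreover have "1 * b powr (- n) \<le> ?h * b powr (- n)" by (intro mult_right_mono) auto
    ultimately show ?thesis by simp
  qed
qed

text \<open>
  The derivative bound of \<open>\<psi>\<^sub>y\<^sub>,\<^sub>k\<close> is void only at \<open>y\<close> itself when \<open>Q\<^sup>1\<^sub>y\<^sub>,\<^sub>k\<close> is a point; the
  hypothesis keeps the segment away from this case.
\<close>

lemma psi_Lipschitz_on_segment:
  assumes y: "y \<in> supp M" and b: "0 < b"
    and large: "\<And>u. u \<in> closed_segment x x' \<Longrightarrow>
      (\<exists>s. Qa y k I1 = Transit y s \<and> b \<le> s) \<or> b \<le> norm (u - y)"
  shows "\<bar>\<psi> k y x - \<psi> k y x'\<bar> \<le> C7 * b powr (- (n + 1)) * norm (x - x')"
proof -
  have "\<exists>D. (\<psi> k y has_derivative D) (at u) \<and> onorm D \<le> C7 * b powr (- (n + 1))"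
    if u: "u \<in> closed_segment x x'" for u
  proof -
    let ?m = "min (inv_pow (side (Qa y k I1)) (n + 1)) (inv_pow (ereal (norm (y - u))) (n + 1))"
    have m: "?m \<le> ereal (b powr (- (n + 1)))"
      using large[OF u]
    proof
      assume "\<exists>s. Qa y k I1 = Transit y s \<and> b \<le> s"
      then obtain s where "Qa y k I1 = Transit y s" "b \<le> s" by auto
      then show ?thesis using inv_pow_le[of b s "n + 1"] b n_pos by (auto intro: min.coboundedI1)
    next
      assume "b \<le> norm (u - y)"
      then show ?thesis using inv_pow_le[of b "norm (y - u)" "n + 1"] b n_pos
        by (auto simp: norm_minus_commute intro: min.coboundedI2)
    qed
    then have "?m < \<infinity>" by (rule order.strict_trans1) simp
    then obtain D where D: "(\<psi> k y has_derivative D) (at u)" "ereal (onorm D) \<le> ereal C7 * ?m"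
      using bump_psi[OF y, of k] unfolding bump_def Let_def by blast
    have "ereal C7 * ?m \<le> ereal C7 * ereal (b powr (- (n + 1)))"
      using m C7_pos by (intro ereal_mult_left_mono) auto
    with D(2) have "ereal (onorm D) \<le> ereal C7 * ereal (b powr (- (n + 1)))" by (rule order_trans)
    then have "onorm D \<le> C7 * b powr (- (n + 1))" by (simp only: times_ereal.simps ereal_less_eq)
    then show ?thesis using D(1) by auto
  qed
  then obtain D where D: "\<And>u. u \<in> closed_segment x x' \<Longrightarrow> (\<psi> k y has_derivative D u) (at u)"
    "\<And>u. u \<in> closed_segment x x' \<Longrightarrow> onorm (D u) \<le> C7 * b powr (- (n + 1))"
    by metis
  have "norm (\<psi> k y x - \<psi> k y x') \<le> C7 * b powr (- (n + 1)) * norm (x - x')"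
    by (rule differentiable_bound[where S = "closed_segment x x'" and f' = D])
       (use D in \<open>auto simp del: minus_add_distrib intro: has_derivative_at_withinI\<close>)
  then show ?thesis by simp
qed

definition sdim :: real where "sdim = sqrt DIM('a)"

lemma sdim: "1 \<le> sdim" "norm x \<le> sdim * infnorm (x :: 'a)"
  using norm_le_infnorm[of x] DIM_positive[where 'a = 'a] by (auto simp: sdim_def mult.commute)

definition Creg :: real where
  "Creg = C7 * sdim * (4 * C0 * (16 * sdim) powr n + 2 powr (n + 1) * kappa)"

lemma Creg_pos: "0 < Creg"
  using C7_pos C0_pos kappa_pos sdim(1) by (auto simp: Creg_def intro!: mult_pos_pos add_pos_pos)

text \<open>
  The key estimate.  For \<open>y\<close> in a neighbourhood of \<open>P\<close> of size \<open>\<Lambda> = 2\<^sup>j\<^sup>-\<^sup>k l\<close> the difference is at most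
  \<open>|x - x'| \<Lambda>\<^sup>-\<^sup>n\<^sup>-\<^sup>1\<close> by the dichotomy for \<open>Q\<^sup>1\<^sub>y\<^sub>,\<^sub>k\<close>, and for other \<open>y\<close> at most
  \<open>|x - x'| |y - z|\<^sup>-\<^sup>n\<^sup>-\<^sup>1\<close>.  By the growth of \<open>\<mu>\<close> both parts integrate to \<open>|x - x'| / \<Lambda> \<le> 2\<^sup>-\<^sup>(\<^sup>j\<^sup>-\<^sup>k\<^sup>)\<close>,
  up to constants.
\<close>

lemma psi_regularity:
  assumes k: "nontrivial k" and kj: "k + 2 \<le> j"
    and gen: "generation M n e1 A R (Transit z l) (j - 1)"
    and x: "x \<in> cube_set (Transit z l)" "x' \<in> cube_set (Transit z l)"
  shows "(\<integral>\<^sup>+y. ennreal \<bar>\<psi> k y x - \<psi> k y x'\<bar> \<partial>M) \<le> ennreal (Creg / 2 ^ nat (j - k))"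
proof -
  define p where "p = nat (j - k)"
  define \<Lambda> where "\<Lambda> = 2 ^ p * l"
  have l: "0 < l" "z \<in> supp M" using generation_cube[OF gen] by auto
  have "2 \<le> p" using kj by (simp add: p_def)
  then have "(2::real) ^ 0 \<le> 2 ^ p" by (intro power_increasing) auto
  then have lL: "l \<le> \<Lambda>" "0 < \<Lambda>" using l by (auto simp: \<Lambda>_def)
  have seg: "closed_segment x x' \<subseteq> cube_set (Transit z l)"
    using x convex_contains_segment[of "cube_set (Transit z l)"] by (auto simp: cube_set.simps(2))
  have dich: "(\<exists>s. Qa y k I1 = Transit y s \<and> \<Lambda> / 4 \<le> s) \<or> \<Lambda> / 4 \<le> norm (u - y)"
    if "y \<in> supp M" "u \<in> cube_set (Transit z l)" for y u
    using early_aux_cube_large_or_far[OF that(1) k kj gen that(2)] by (simp add: \<Lambda>_def p_def)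
  have nxx: "norm (x - x') \<le> sdim * l"
  proof -
    have "infnorm (x - x') \<le> l"
      using infnorm_dist_triangle[of x x' z] x by (simp add: mem_cube infnorm_dist_commute[of z])
    then show ?thesis using sdim(2)[of "x - x'"] sdim(1) mult_left_mono[of _ l sdim] by (meson order_trans zero_le_one)
  qed
  let ?N = "cube_set (Transit z (4 * sdim * \<Lambda>))"
  define a where "a = C7 * (sdim * l)"
  have a: "0 \<le> a" using C7_pos sdim(1) l by (simp add: a_def)
  have near: "\<bar>\<psi> k y x - \<psi> k y x'\<bar> \<le> a * (\<Lambda> / 4) powr (- (n + 1))" if y: "y \<in> supp M" for y
  proof -
    have "\<bar>\<psi> k y x - \<psi> k y x'\<bar> \<le> C7 * (\<Lambda> / 4) powr (- (n + 1)) * norm (x - x')"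
      using y lL dich[OF y] seg by (intro psi_Lipschitz_on_segment) auto
    also have "\<dots> \<le> C7 * (\<Lambda> / 4) powr (- (n + 1)) * (sdim * l)"
      using nxx C7_pos by (intro mult_left_mono) auto
    finally show ?thesis by (simp add: a_def ac_simps)
  qed
  have far: "\<bar>\<psi> k y x - \<psi> k y x'\<bar> \<le> a * 2 powr (n + 1) * norm (y - z) powr (- (n + 1))"
    if y: "y \<in> supp M" "y \<notin> ?N" for y
  proof -
    have ny: "2 * sdim * \<Lambda> < norm (y - z)" using infnorm_gt_outside_cube[OF y(2)] by (simp add: ac_simps)
    have "0 < sdim * \<Lambda>" using sdim(1) lL by simp
    then have ny0: "0 < norm (y - z)" using ny by linarith
    have "norm (y - z) / 2 \<le> norm (u - y)" if "u \<in> closed_segment x x'" for u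
    proof -
      have "u \<in> cube_set (Transit z l)" using seg that by auto
      then have "infnorm (u - z) \<le> \<Lambda>" using lL l by (simp add: mem_cube)
      then have "norm (u - z) \<le> sdim * \<Lambda>"
        using sdim(2)[of "u - z"] sdim(1) mult_left_mono[of _ \<Lambda> sdim] by (meson order_trans zero_le_one)
      then show ?thesis using ny norm_triangle_ineq[of "y - u" "u - z"] by (simp add: norm_minus_commute)
    qed
    then have "\<bar>\<psi> k y x - \<psi> k y x'\<bar> \<le> C7 * (norm (y - z) / 2) powr (- (n + 1)) * norm (x - x')"
      using y ny0 by (intro psi_Lipschitz_on_segment) auto
    also have "\<dots> \<le> C7 * (norm (y - z) / 2) powr (- (n + 1)) * (sdim * l)"
      using nxx C7_pos by (intro mult_left_mono) auto
    also have "(norm (y - z) / 2) powr (- (n + 1)) = 2 powr (n + 1) * norm (y - z) powr (- (n + 1))"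
    proof -
      have "2 powr (- (n + 1)) = 1 / 2 powr (n + 1)" by (rule powr_minus_divide)
      then show ?thesis by (simp only: powr_divide) simp
    qed
    finally show ?thesis by (simp add: a_def ac_simps)
  qed
  have "(\<integral>\<^sup>+y. ennreal \<bar>\<psi> k y x - \<psi> k y x'\<bar> \<partial>M)
    \<le> (\<integral>\<^sup>+y. (ennreal (a * (\<Lambda> / 4) powr (- (n + 1))) * indicator ?N y +
             ennreal (a * 2 powr (n + 1)) * (ennreal (norm (y - z) powr (- (n + 1))) * indicator (- ?N) y)) \<partial>M)"
    using AE_in_supp
  proof (intro nn_integral_mono_AE, eventually_elim)
    case (elim y)
    show ?case
    proof (cases "y \<in> ?N")
      case True
      then show ?thesis using near[OF elim(2)] by (simp add: ennreal_leI)
    next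
      case False
      then show ?thesis using far[OF elim(2) False] a by (simp add: ennreal_leI flip: ennreal_mult)
    qed
  qed
  also have "\<dots> = ennreal (a * (\<Lambda> / 4) powr (- (n + 1))) * emeasure M ?N +
      ennreal (a * 2 powr (n + 1)) * (\<integral>\<^sup>+y \<in> - ?N. ennreal (norm (y - z) powr (- (n + 1))) \<partial>M)"
  proof -
    have [measurable]: "- ?N \<in> sets M" using cube_sets[of "Transit z (4 * sdim * \<Lambda>)"] by (simp add: sets_M)
    show ?thesis by (subst nn_integral_add) (simp_all add: nn_integral_cmult nn_integral_cmult_indicator)
  qed
  also have "\<dots> \<le> ennreal (a * (\<Lambda> / 4) powr (- (n + 1))) * ennreal (C0 * (4 * sdim * \<Lambda>) powr n) +
      ennreal (a * 2 powr (n + 1)) * ennreal (4 * kappa / (4 * sdim * \<Lambda>))"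
    using growth_cube[of z "4 * sdim * \<Lambda>"] l lL sdim(1) n_pos C0_pos
    by (intro add_mono mult_left_mono dyadic_tail_integral_le) auto
  also have "\<dots> = ennreal (a * (\<Lambda> / 4) powr (- (n + 1)) * (C0 * (4 * sdim * \<Lambda>) powr n) +
      a * 2 powr (n + 1) * (4 * kappa / (4 * sdim * \<Lambda>)))"
  proof -
    have "ennreal r * ennreal s + ennreal t * ennreal u = ennreal (r * s + t * u)"
      if "0 \<le> r" "0 \<le> s" "0 \<le> t" "0 \<le> u" for r s t u :: real
      using that by (simp add: ennreal_mult ennreal_plus)
    then show ?thesis using a C0_pos kappa_pos sdim(1) lL by auto
  qed
  also have "\<dots> \<le> ennreal (Creg / 2 ^ p)"
  proof (rule ennreal_leI)
    have e1: "(\<Lambda> / 4) powr (- (n + 1)) * (4 * sdim * \<Lambda>) powr n = 4 / \<Lambda> * (16 * sdim) powr n"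
    proof -
      have "(4 * sdim * \<Lambda>) powr n = ((\<Lambda> / 4) * (16 * sdim)) powr n" by (simp add: ac_simps)
      also have "\<dots> = (\<Lambda> / 4) powr n * (16 * sdim) powr n" by (rule powr_mult)
      finally have "(\<Lambda> / 4) powr (- (n + 1)) * (4 * sdim * \<Lambda>) powr n
          = ((\<Lambda> / 4) powr (- (n + 1)) * (\<Lambda> / 4) powr n) * (16 * sdim) powr n" by simp
      also have "(\<Lambda> / 4) powr (- (n + 1)) * (\<Lambda> / 4) powr n = (\<Lambda> / 4) powr (- 1)"
        by (subst powr_add[symmetric]) simp
      also have "(\<Lambda> / 4) powr (- 1) = 4 / \<Lambda>" using lL by (simp add: powr_minus_divide)
      finally show ?thesis .
    qed
    have "4 * kappa / (4 * sdim * \<Lambda>) \<le> kappa / \<Lambda>"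
      using kappa_pos sdim(1) lL by (simp add: field_simps)
    then have "a * 2 powr (n + 1) * (4 * kappa / (4 * sdim * \<Lambda>)) \<le> a * 2 powr (n + 1) * (kappa / \<Lambda>)"
      using a by (intro mult_left_mono) auto
    moreover have "a * (\<Lambda> / 4) powr (- (n + 1)) * (C0 * (4 * sdim * \<Lambda>) powr n) = a * C0 * (4 / \<Lambda> * (16 * sdim) powr n)"
      by (simp only: e1[symmetric]) (simp add: ac_simps)
    moreover have "a * C0 * (4 / \<Lambda> * (16 * sdim) powr n) + a * 2 powr (n + 1) * (kappa / \<Lambda>) = Creg / 2 ^ p"
      using l by (simp add: Creg_def a_def \<Lambda>_def field_simps)
    ultimately show "a * (\<Lambda> / 4) powr (- (n + 1)) * (C0 * (4 * sdim * \<Lambda>) powr n) +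
      a * 2 powr (n + 1) * (4 * kappa / (4 * sdim * \<Lambda>)) \<le> Creg / 2 ^ p" by linarith
  qed
  finally show ?thesis by (simp add: p_def)
qed

section \<open>Lower bound for the adjoint\<close>

lemma emeasure_point:
  assumes x: "x \<in> supp M"
  shows "emeasure M {x} = 0"
proof -
  have "emeasure M {x} \<le> ennreal e" if "0 < e" for e
  proof -
    define l where "l = (e / C0) powr (1 / n)"
    have l: "0 < l" "C0 * l powr n = e" using that C0_pos n_pos by (auto simp: l_def powr_powr)
    have "emeasure M {x} \<le> emeasure M (cube_set (Transit x l))"
      using l centre_in_cube[of l x] by (intro emeasure_mono) auto
    also have "\<dots> \<le> ennreal (C0 * l powr n)" using x l by (intro growth_cube) auto
    finally show ?thesis using l by simp
  qed
  then have "emeasure M {x} \<le> 0 + ennreal e" if "0 < e" for e using that by simp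
  then have "emeasure M {x} \<le> 0" by (rule ennreal_le_epsilon)
  then show ?thesis by simp
qed

lemma AE_neq: "x \<in> supp M \<Longrightarrow> AE y in M. y \<noteq> x"
  using emeasure_point[of x] by (intro AE_I'[of "{x}"]) (auto simp: null_sets_def sets_M)

lemma delta_concentric:
  assumes "centred_at P x" "centred_at P' x" "P \<noteq> Whole" "cube_set P \<subseteq> cube_set P'"
  shows "delta M n P P' = enn2ereal (\<integral>\<^sup>+u \<in> cube_set P' - cube_set P. ennreal (norm (u - x) powr (- n)) \<partial>M)"
proof -
  have "cube_hull P P' = cube_set P'"
    using assms by (intro cube_hull_concentric) (auto simp: concentric_def)
  moreover have "centre P = x" using assms by (auto simp: centred_at_def)
  ultimately show ?thesis using assms by (simp add: delta_of_subset delta_half_def)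
qed

text \<open>
  A point \<open>y\<close> with \<open>\<psi>\<^sub>y\<^sub>,\<^sub>k(x) \<noteq> 0\<close> lies in a cube centred at \<open>x\<close> of about the level of \<open>Q\<^sup>3\<^sub>y\<^sub>,\<^sub>k\<close>.
  Outside the cube \<open>B = Q\<^sup>2\<close>-hat of \<open>x\<close> there is little mass left at such levels.
\<close>

lemma shell_between_hat2_and_support:
  assumes x: "x \<in> supp M" and k: "nontrivial k"
    and y: "y \<in> supp M" "y \<noteq> x" "\<psi> k y x \<noteq> 0" "y \<notin> cube_set (Qa x k Ihat2)"
  shows "(\<integral>\<^sup>+u \<in> {u. infnorm (u - x) \<le> infnorm (y - x)} - cube_set (Qa x k Ihat2). ennreal (norm (u - x) powr (- n)) \<partial>M)
    \<le> ennreal (\<sigma> + 16 * e1 + 2 * kappa)"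
proof -
  let ?B = "Qa x k Ihat2"
  have xQ: "x \<in> cube_set (Qa y k I3)" using psi_zero_outside[OF y(1)] y(3) by blast
  obtain s where s: "Qa y k I3 = Transit y s" "0 < s"
    by (rule aux_cube_cases[OF y(1) k, of I3]) (use xQ y(2) in auto)
  let ?P = "Transit x (2 * s)"
  have xy: "infnorm (y - x) \<le> s / 2" using xQ s by (simp add: mem_cube infnorm_dist_commute)
  have QP: "cube_set (Transit y s) \<subseteq> cube_set ?P" using xy s by (intro cube_subset_transit) simp
  have yP: "y \<in> cube_set ?P" using QP centre_in_cube[of s y] s by auto
  note pB = aux_cube_proper[OF x k, of Ihat2]
  have BP: "cube_set ?B \<subseteq> cube_set ?P"
  proof (cases rule: aux_cube_cases[OF x k, of Ihat2])
    case 1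
    then show ?thesis using s by (simp add: centre_in_cube)
  next
    case (2 t)
    have "\<not> 2 * s \<le> t"
      using cube_subset_same_centre[of "2 * s" t x] yP y(4) 2 by auto
    then show ?thesis using 2 by (intro cube_subset_same_centre[of t "2 * s" x, folded 2(1)]) simp
  qed
  have "bounded (cube_set ?P \<union> hood x k \<union> hood y k)"
    using bounded_hood[OF x k] bounded_hood[OF y(1) k] bounded_cube[of ?P] by simp
  then obtain T c where T: "top_cube T c" and sub: "cube_set ?P \<union> hood x k \<union> hood y k \<subseteq> cube_set T"
    by (rule top_cube_covers)
  have sx: "hood x k \<subseteq> cube_set T" and sy: "hood y k \<subseteq> cube_set T" and sP: "cube_set ?P \<subseteq> cube_set T"
    using sub by auto
  note hx = top_cube_contains_hood[OF x T sx] and hy = top_cube_contains_hood[OF y(1) T sy]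
  have cP: "is_cube M ?P" using x s by simp
  note cube = cP top_cube_is_cube[OF T] conjunct1[OF pB] aux_cube_proper[OF y(1) k, of I3, THEN conjunct1, unfolded s(1)]
  have "ereal (of_int k * real A - tdist I3 + c - 7 * e1) \<le> delta M n (Transit y s) T"
    using aux_cube_level(2)[OF y(1) k T hy(1,2) hy(3)[of I3]] s by simp
  moreover have "delta M n (Transit y s) ?P \<le> ereal (real 2 * kappa)"
    using y s n_pos C0_pos QP by (intro delta_transit_le) auto
  ultimately have lo: "ereal ((of_int k * real A - tdist I3 + c - 7 * e1) - real 2 * kappa - e0) \<le> delta M n ?P T"
    using cube QP sP by (intro delta_outer_ge[OF additive, of "Transit y s"]) auto
  have up: "delta M n ?B T \<le> ereal (of_int k * real A - tdist Ihat2 + c + 7 * e1)"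
    by (rule aux_cube_level(1)[OF x k T hx(1,2) hx(3)])
  have "delta M n ?B ?P \<le> ereal ((of_int k * real A - tdist Ihat2 + c + 7 * e1)
      - ((of_int k * real A - tdist I3 + c - 7 * e1) - real 2 * kappa - e0) + e0)"
    by (rule delta_inner_le[OF additive cube(3) cP cube(2) BP sP up lo])
  also have "\<dots> \<le> ereal (\<sigma> + 16 * e1 + 2 * kappa)" using e0_le_e1 by simp
  finally have "delta M n ?B ?P \<le> ereal (\<sigma> + 16 * e1 + 2 * kappa)" .
  then have "enn2ereal (\<integral>\<^sup>+u \<in> cube_set ?P - cube_set ?B. ennreal (norm (u - x) powr (- n)) \<partial>M)
      \<le> ereal (\<sigma> + 16 * e1 + 2 * kappa)"
    using pB BP by (subst (asm) delta_concentric) (auto simp: centred_at_def)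
  also have "\<dots> = enn2ereal (ennreal (\<sigma> + 16 * e1 + 2 * kappa))"
    using parameter_facts by (subst enn2ereal_ennreal) auto
  finally have "(\<integral>\<^sup>+u \<in> cube_set ?P - cube_set ?B. ennreal (norm (u - x) powr (- n)) \<partial>M)
      \<le> ennreal (\<sigma> + 16 * e1 + 2 * kappa)" by (simp add: less_eq_ennreal.rep_eq)
  moreover have "{u. infnorm (u - x) \<le> infnorm (y - x)} \<subseteq> cube_set ?P"
    using xy s by (auto simp: mem_cube)
  then have "(\<integral>\<^sup>+u \<in> {u. infnorm (u - x) \<le> infnorm (y - x)} - cube_set ?B. ennreal (norm (u - x) powr (- n)) \<partial>M)
      \<le> (\<integral>\<^sup>+u \<in> cube_set ?P - cube_set ?B. ennreal (norm (u - x) powr (- n)) \<partial>M)"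
    by (intro nn_integral_mono) (auto simp: indicator_def)
  ultimately show ?thesis by (rule order_trans[rotated])
qed

text \<open>
  This bounds \<open>1 / w\<^sub>k\<close> from below: if the first integral is small, the diagonal part of the
  operator is at least \<open>1 / 8\<close>.  Suppose it is large.  The points \<open>y\<close> with \<open>\<psi>\<^sub>y\<^sub>,\<^sub>k(x) \<noteq> 0\<close> outside the
  cube \<open>B = Q\<^sup>2\<close>-hat of \<open>x\<close> contribute only \<open>O(\<sigma>)\<close>, and \<open>\<psi>\<^sub>y\<^sub>,\<^sub>k(x) \<le> |x - y|\<^sup>-\<^sup>n\<close>, so there is much
  \<open>\<delta>\<close>-mass around \<open>x\<close> in \<open>B\<close>.  Hence \<open>B\<close> is a genuine cube, and the part of this mass between \<open>Q\<^sup>1\<close>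
  and \<open>B\<close>, where \<open>\<psi>\<^sub>x\<^sub>,\<^sub>k(y) = |x - y|\<^sup>-\<^sup>n\<close>, is large as well.
\<close>

lemma phi_row_or_column_large:
  assumes x: "x \<in> supp M" and k: "nontrivial k"
  shows "(\<integral>\<^sup>+y. ennreal (\<phi> k y x) \<partial>M) \<le> ennreal (1 / 8) \<or> ennreal (1 / 16) \<le> (\<integral>\<^sup>+y. ennreal (\<phi> k x y) \<partial>M)"
proof (rule disjCI)
  assume "\<not> ennreal (1 / 16) \<le> (\<integral>\<^sup>+y. ennreal (\<phi> k x y) \<partial>M)"
  then have small: "(\<integral>\<^sup>+y. ennreal (\<phi> k x y) \<partial>M) < ennreal (1 / 16)" by simp
  show "(\<integral>\<^sup>+y. ennreal (\<phi> k y x) \<partial>M) \<le> ennreal (1 / 8)"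
  proof (rule ccontr)
    assume "\<not> ?thesis"
    then have large: "ennreal (1 / 8) < (\<integral>\<^sup>+y. ennreal (\<phi> k y x) \<partial>M)" by simp
    let ?f = "\<lambda>u. ennreal (norm (u - x) powr (- n))"
    let ?B = "Qa x k Ihat2"
    note g = generation_Q[OF x, of k]
    have Qx: "Q x k = Point x"
    proof (cases rule: Q_cases[OF x k])
      case (2 l)
      then have "ennreal (1 / 2) \<le> (\<integral>\<^sup>+y. ennreal (\<phi> k x y) \<partial>M)"
        using phi_ge[OF x, of x l k] g centre_in_cube[of l x] by auto
      also have "\<dots> < ennreal (1 / 16)" by (rule small)
      finally have "ennreal (1 / 2) < ennreal (1 / 16)" .
      then have "1 / 2 < (1 / 16 :: real)" by (subst (asm) ennreal_less_iff) auto
      then show ?thesis by simp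
    qed
    have psi_int: "(\<integral>\<^sup>+y. ennreal (\<psi> k x y) \<partial>M) < ennreal (\<alpha>2 / 16)"
    proof -
      have [measurable]: "(\<lambda>y. \<phi> k x y) \<in> borel_measurable M"
        by (rule phi_measurable_comp) (simp_all add: space_M)
      have "(\<integral>\<^sup>+y. ennreal (\<psi> k x y) \<partial>M) = (\<integral>\<^sup>+y. ennreal \<alpha>2 * ennreal (\<phi> k x y) \<partial>M)"
        using pos psi_nonneg[OF x] by (intro nn_integral_cong) (simp add: phi_psi flip: ennreal_mult)
      also have "\<dots> = ennreal \<alpha>2 * (\<integral>\<^sup>+y. ennreal (\<phi> k x y) \<partial>M)" by (rule nn_integral_cmult) measurable
      also have "\<dots> < ennreal \<alpha>2 * ennreal (1 / 16)"
        using small pos by (intro ennreal_mult_strict_left_mono) auto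
      finally show ?thesis using pos by (simp add: ennreal_mult[symmetric])
    qed
    have psi_int': "ennreal (\<alpha>2 / 8) < (\<integral>\<^sup>+y. ennreal (\<psi> k y x) \<partial>M)"
    proof -
      have [measurable]: "(\<lambda>y. \<phi> k y x) \<in> borel_measurable M"
        by (rule phi_measurable_comp) (simp_all add: space_M)
      have "(\<integral>\<^sup>+y. ennreal (\<psi> k y x) \<partial>M) = (\<integral>\<^sup>+y. ennreal \<alpha>2 * ennreal (\<phi> k y x) \<partial>M)"
        using AE_in_supp
      proof (intro nn_integral_cong_AE, eventually_elim)
        case (elim y)
        then show ?case using pos psi_nonneg[OF elim(2), of k x] by (simp add: phi_psi flip: ennreal_mult)
      qed
      also have "\<dots> = ennreal \<alpha>2 * (\<integral>\<^sup>+y. ennreal (\<phi> k y x) \<partial>M)" by (rule nn_integral_cmult) measurable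
      finally have *: "(\<integral>\<^sup>+y. ennreal (\<psi> k y x) \<partial>M) = ennreal \<alpha>2 * (\<integral>\<^sup>+y. ennreal (\<phi> k y x) \<partial>M)" .
      have "ennreal \<alpha>2 * ennreal (1 / 8) < ennreal \<alpha>2 * (\<integral>\<^sup>+y. ennreal (\<phi> k y x) \<partial>M)"
        using large pos by (intro ennreal_mult_strict_left_mono) auto
      then show ?thesis unfolding * using pos by (simp add: ennreal_mult[symmetric])
    qed
    have [measurable]: "(\<lambda>u. infnorm (u - x)) \<in> borel_measurable M"
      unfolding measurable_cong_sets[OF sets_M refl]
      by (intro borel_measurable_continuous_onI continuous_on_infnorm continuous_intros)
    define S where "S = {y \<in> supp M. y \<noteq> x \<and> \<psi> k y x \<noteq> 0 \<and> y \<notin> cube_set ?B}"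
    obtain V where V: "V \<in> sets M" "S \<inter> space M \<subseteq> V"
      "(\<integral>\<^sup>+u. ?f u * indicator (- cube_set ?B) u * indicator V u \<partial>M) \<le> ennreal (\<sigma> + 16 * e1 + 2 * kappa)"
    proof (rule nn_integral_sublevel_union_le[where M = M and g = "\<lambda>u. infnorm (u - x)" and
          f = "\<lambda>u. ?f u * indicator (- cube_set ?B) u" and S = S])
      have [measurable]: "- cube_set ?B \<in> sets M" using cube_sets[of ?B] by (simp add: sets_M)
      show "(\<lambda>u. ?f u * indicator (- cube_set ?B) u) \<in> borel_measurable M" by measurable
      show "(\<integral>\<^sup>+u. ?f u * indicator (- cube_set ?B) u * indicator {u \<in> space M. infnorm (u - x) \<le> infnorm (y - x)} u \<partial>M)
        \<le> ennreal (\<sigma> + 16 * e1 + 2 * kappa)" if "y \<in> S" for y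
      proof -
        have "(\<integral>\<^sup>+u. ?f u * indicator (- cube_set ?B) u * indicator {u \<in> space M. infnorm (u - x) \<le> infnorm (y - x)} u \<partial>M)
          = (\<integral>\<^sup>+u \<in> {u. infnorm (u - x) \<le> infnorm (y - x)} - cube_set ?B. ?f u \<partial>M)"
          by (intro nn_integral_cong) (auto simp: indicator_def space_M)
        also have "\<dots> \<le> ennreal (\<sigma> + 16 * e1 + 2 * kappa)"
          using that by (intro shell_between_hat2_and_support[OF x k]) (auto simp: S_def)
        finally show ?thesis .
      qed
    qed measurable
    have "(\<integral>\<^sup>+y. ennreal (\<psi> k y x) \<partial>M)
        \<le> (\<integral>\<^sup>+y. (?f y * indicator (- cube_set ?B) y * indicator V y + ?f y * indicator (cube_set ?B) y) \<partial>M)"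
      using AE_in_supp AE_neq[OF x]
    proof (intro nn_integral_mono_AE, eventually_elim)
      case (elim y)
      have "ennreal (\<psi> k y x) \<le> ?f y"
        using psi_le[OF elim(3), of x k] elim(4) by (simp add: ennreal_leI norm_minus_commute)
      moreover have "\<psi> k y x = 0" if "y \<notin> cube_set ?B" "y \<notin> V"
        using that V(2) elim by (auto simp: S_def space_M)
      ultimately show ?case by (auto simp: indicator_def)
    qed
    also have "\<dots> = (\<integral>\<^sup>+y. ?f y * indicator (- cube_set ?B) y * indicator V y \<partial>M) + (\<integral>\<^sup>+y \<in> cube_set ?B. ?f y \<partial>M)"
    proof -
      have [measurable]: "- cube_set ?B \<in> sets M" "V \<in> sets M" using cube_sets[of ?B] V by (simp_all add: sets_M)
      show ?thesis by (rule nn_integral_add) measurable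
    qed
    also have "\<dots> \<le> ennreal (\<sigma> + 16 * e1 + 2 * kappa) + (\<integral>\<^sup>+y \<in> cube_set ?B. ?f y \<partial>M)"
      by (intro add_right_mono V)
    also have "\<dots> \<le> ennreal (\<alpha>2 / 16) + (\<integral>\<^sup>+y \<in> cube_set ?B. ?f y \<partial>M)"
      using parameter_facts by (intro add_right_mono ennreal_leI) simp
    finally have total: "(\<integral>\<^sup>+y. ennreal (\<psi> k y x) \<partial>M) \<le> ennreal (\<alpha>2 / 16) + (\<integral>\<^sup>+y \<in> cube_set ?B. ?f y \<partial>M)" .
    have intB: "ennreal (\<alpha>2 / 16) \<le> (\<integral>\<^sup>+y \<in> cube_set ?B. ?f y \<partial>M)"
    proof (rule ccontr)
      assume "\<not> ?thesis"
      then have "(\<integral>\<^sup>+y \<in> cube_set ?B. ?f y \<partial>M) \<le> ennreal (\<alpha>2 / 16)" by simp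
      then have "ennreal (\<alpha>2 / 16) + (\<integral>\<^sup>+y \<in> cube_set ?B. ?f y \<partial>M) \<le> ennreal (\<alpha>2 / 16) + ennreal (\<alpha>2 / 16)"
        by (rule add_left_mono)
      also have "\<dots> = ennreal (\<alpha>2 / 8)" using pos by (simp flip: ennreal_plus)
      finally show False
        using psi_int' total by (meson not_less order_trans)
    qed
    have B_nonpoint: "?B \<noteq> Point x"
    proof
      assume "?B = Point x"
      then have "(\<integral>\<^sup>+y \<in> cube_set ?B. ?f y \<partial>M) = (\<integral>\<^sup>+y. 0 \<partial>M)"
        by (intro nn_integral_cong) (auto simp: indicator_def)
      then show False using intB pos by (simp add: ennreal_eq_0_iff)
    qed
    then obtain sB where B: "?B = Transit x sB" "0 < sB"
      using aux_cube_cases[OF x k, of Ihat2] by metis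
    have Qp: "Q x (k - 1) \<noteq> Q x k"
      using aux_Q[OF x, of k Ihat2] Qx B_nonpoint by (auto simp: aux_cube_def)
    have dB: "cube_set ?B \<subseteq> cube_set (Q x (k - 1))"
      "eq_pm (delta M n ?B (Q x (k - 1))) (real A - tdist Ihat2) e1"
      using aux_Q[OF x, of k Ihat2] Qx B_nonpoint Qp by (auto simp: aux_cube_def)
    let ?Q1 = "Qa x k I1"
    have psi_ge: "(\<integral>\<^sup>+u \<in> cube_set ?B - cube_set ?Q1. ?f u \<partial>M) \<le> (\<integral>\<^sup>+y. ennreal (\<psi> k x y) \<partial>M)"
      using psi_eq_on_shell[OF x, of _ k] by (intro nn_integral_mono) (auto simp: indicator_def)
    have "ennreal (\<alpha>2 / 16) \<le> (\<integral>\<^sup>+u \<in> cube_set ?B - cube_set ?Q1. ?f u \<partial>M)"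
    proof (cases rule: aux_cube_cases[OF x k, of I1])
      case 1
      have "(\<integral>\<^sup>+y \<in> cube_set ?B. ?f y \<partial>M) = (\<integral>\<^sup>+u \<in> cube_set ?B - cube_set ?Q1. ?f u \<partial>M)"
        using 1 by (intro nn_integral_cong) (auto simp: indicator_def)
      then show ?thesis using intB by simp
    next
      case (2 s1)
      have d1: "cube_set ?Q1 \<subseteq> cube_set (Q x (k - 1))"
        "eq_pm (delta M n ?Q1 (Q x (k - 1))) (real A - tdist I1) e1"
        using aux_Q[OF x, of k I1] Qx 2 Qp by (auto simp: aux_cube_def)
      have cube: "is_cube M ?Q1" "is_cube M ?B" "is_cube M (Q x (k - 1))"
        using aux_cube_proper[OF x k] generation_cube[OF conjunct1[OF generation_Q[OF x, of "k - 1"]]] by auto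
      have QB: "cube_set ?Q1 \<subseteq> cube_set ?B"
      proof (cases "s1 \<le> sB")
        case False
        then have "cube_set ?B \<subseteq> cube_set ?Q1" using 2 B by (simp add: cube_subset_same_centre)
        have "ereal (real A - tdist I1 - e1) \<le> delta M n ?Q1 (Q x (k - 1))" using d1 by (simp add: eq_pm_def)
        also have "\<dots> \<le> delta M n ?B (Q x (k - 1)) + ereal e0"
          by (rule delta_chain_mono[OF additive cube(2,1,3)]) fact+
        also have "\<dots> \<le> ereal (real A - tdist Ihat2 + e1) + ereal e0"
          using dB by (intro add_right_mono) (simp add: eq_pm_def)
        finally show ?thesis using parameter_facts by simp
      qed (use 2 B in \<open>simp add: cube_subset_same_centre\<close>)
      have "ereal ((real A - tdist I1 - e1) - (real A - tdist Ihat2 + e1) - e0) \<le> delta M n ?Q1 ?B"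
        using d1 dB cube QB by (intro delta_inner_ge[OF additive, of _ _ "Q x (k - 1)"]) (auto simp: eq_pm_def)
      then have "ereal (\<alpha>2 / 16) \<le> delta M n ?Q1 ?B"
        using parameter_facts by (elim order_trans[rotated]) simp
      also have "delta M n ?Q1 ?B = enn2ereal (\<integral>\<^sup>+u \<in> cube_set ?B - cube_set ?Q1. ?f u \<partial>M)"
        using aux_cube_proper[OF x k] QB by (intro delta_concentric) auto
      finally show ?thesis using pos by (simp add: less_eq_ennreal.rep_eq enn2ereal_ennreal)
    qed
    also note psi_ge
    also note psi_int
    finally show False by simp
  qed
qed

section \<open>Cubes of high generation are small\<close>

lemma reference_generation:
  assumes "\<not> initial M n"
  shows "generation M n e1 A R (R i) (- int i)"
proof -
  obtain zR r where R: "\<And>i. R i = Transit zR (r i)" using reference_cubes_exhaust[OF assms] by metis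
  have "is_cube M (R i)" "doubling M (R i)"
    using reference_cube[OF assms] reference_cubes[OF assms, of i] by (cases "i = 0"; force)+
  moreover have "eq_pm (delta M n (R i) (R i)) (of_int (int i + - int i) * real A) e1"
    using e1_nonneg by (simp add: eq_pm_def zero_ereal_def)
  ultimately show ?thesis
    using assms R[of i] unfolding generation_def by (auto intro!: exI[of _ i])
qed

text \<open>
  A large cube of generation \<open>j\<close> that meets \<open>B\<close> is comparable in size to a cube containing a fixed cube
  around \<open>B\<close>, so its level is bounded; but this level is about \<open>j A\<close>.
\<close>

lemma high_generation_small:
  assumes B: "bounded B" and \<eta>: "0 < \<eta>"
  obtains J where "\<And>j z l. J \<le> j \<Longrightarrow> generation M n e1 A R (Transit z l) j \<Longrightarrow>
    cube_set (Transit z l) \<inter> B \<noteq> {} \<Longrightarrow> l \<le> \<eta>"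
proof -
  obtain z0 l0 K where P0: "is_cube M (Transit z0 l0)" "B \<subseteq> cube_set (Transit z0 l0)"
    and K: "\<And>T c. top_cube T c \<Longrightarrow> cube_set (Transit z0 l0) \<subseteq> cube_set T \<Longrightarrow> delta M n (Transit z0 l0) T \<le> ereal (c + K)"
  proof (cases "initial M n")
    case True
    obtain z1 l1 where 1: "is_cube M (Transit z1 l1)" "delta M n (Transit z1 l1) Whole < \<infinity>"
      using True by (auto simp: initial_def)
    obtain b where b: "\<And>x. x \<in> B \<Longrightarrow> norm x \<le> b" using B by (auto simp: bounded_iff)
    let ?l = "max l1 (2 * (b + norm z1))"
    have "B \<subseteq> cube_set (Transit z1 ?l)"
    proof
      fix x assume "x \<in> B"
      then have "infnorm (x - z1) \<le> b + norm z1"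
        using b[of x] infnorm_le_norm[of "x - z1"] norm_triangle_ineq4[of x z1] by linarith
      then show "x \<in> cube_set (Transit z1 ?l)" by (simp add: mem_cube)
    qed
    moreover have c: "is_cube M (Transit z1 ?l)" using 1 by auto
    moreover have "delta M n (Transit z1 ?l) Whole \<le> delta M n (Transit z1 l1) Whole + ereal e0"
      using 1 c by (intro delta_chain_mono[OF additive] cube_subset_same_centre) auto
    then have fin: "delta M n (Transit z1 ?l) Whole < \<infinity>" using 1(2) by (auto intro: order.strict_trans1)
    then obtain K where "delta M n (Transit z1 ?l) Whole = ereal K"
      using delta_nonneg[of M n "Transit z1 ?l" Whole] by (cases "delta M n (Transit z1 ?l) Whole") auto
    ultimately show ?thesis using that[of z1 ?l K] True by (auto simp: top_cube_def)
  next
    case False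
    obtain T c where T: "top_cube T c" "B \<subseteq> cube_set T" by (rule top_cube_covers[OF B])
    then obtain i where i: "T = R i" using False by (auto simp: top_cube_def)
    obtain zR r where R: "\<And>i. R i = Transit zR (r i)" using reference_cubes_exhaust[OF False] by metis
    note g = reference_generation[OF False, of i, unfolded R[of i]]
    have nt: "nontrivial (- int i)" using False by (simp add: nontrivial_def)
    have "delta M n (Transit zR (r i)) T \<le> ereal (c + (- real i * real A + 5 * e1))"
      if "top_cube T c" "cube_set (Transit zR (r i)) \<subseteq> cube_set T" for T c
      using generation_level_le[OF g nt that] by (simp add: algebra_simps)
    then show ?thesis using that[of zR "r i"] generation_cube[OF g] T i R by auto
  qed
  have l0: "0 < l0" using P0 by simp
  obtain p where p: "2 + 4 * l0 / \<eta> < 2 ^ p" using real_arch_pow[of 2 "2 + 4 * l0 / \<eta>"] by auto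
  define b where "b = real p * kappa + K + 2 * e0 + 5 * e1"
  show ?thesis
  proof (rule that[of "max 0 (\<lceil>b\<rceil> + 1)"])
    fix j z l
    assume j: "max 0 (\<lceil>b\<rceil> + 1) \<le> j" and gen: "generation M n e1 A R (Transit z l) j"
      and meet: "cube_set (Transit z l) \<inter> B \<noteq> {}"
    show "l \<le> \<eta>"
    proof (rule ccontr)
      assume "\<not> l \<le> \<eta>"
      then have l: "\<eta> < l" by simp
      obtain v where v: "v \<in> cube_set (Transit z l)" "v \<in> cube_set (Transit z0 l0)" using meet P0(2) by auto
      let ?L = "l + 2 * l0"
      have "infnorm (z0 - z) \<le> l0 / 2 + l / 2"
        using infnorm_dist_triangle[of z0 z v] v by (simp add: mem_cube infnorm_dist_commute[of z0 v])
      then have s0: "cube_set (Transit z0 l0) \<subseteq> cube_set (Transit z ?L)"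
        by (intro cube_subset_transit) (simp add: field_simps)
      have s1: "cube_set (Transit z l) \<subseteq> cube_set (Transit z ?L)" using l0 by (intro cube_subset_same_centre) simp
      have c: "is_cube M (Transit z l)" using generation_cube[OF gen] .
      then have cL: "is_cube M (Transit z ?L)" using l0 by auto
      obtain T c where T: "top_cube T c" and sT: "cube_set (Transit z ?L) \<subseteq> cube_set T"
        by (rule top_cube_covers[OF bounded_cube[of "Transit z ?L"]]) auto
      have "delta M n (Transit z ?L) T \<le> delta M n (Transit z0 l0) T + ereal e0"
        by (rule delta_chain_mono[OF additive P0(1) cL top_cube_is_cube[OF T] s0 sT])
      also have "\<dots> \<le> ereal (c + K) + ereal e0"
        using s0 sT by (intro add_right_mono K[OF T]) auto
      finally have dL: "delta M n (Transit z ?L) T \<le> ereal (c + K + e0)" by simp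
      have "2 * ?L \<le> (2 + 4 * l0 / \<eta>) * l"
        using l l0 \<eta> mult_left_mono[of \<eta> l "4 * l0"] by (simp add: field_simps)
      also have "\<dots> \<le> 2 ^ p * l" using p l \<eta> by (intro mult_right_mono) auto
      finally have dl: "delta M n (Transit z l) (Transit z ?L) \<le> ereal (real p * kappa)"
        using c n_pos C0_pos s1 by (intro delta_transit_le) auto
      have "ereal (of_int j * real A + c - 5 * e1) \<le> delta M n (Transit z l) T"
        using s1 sT by (intro generation_level_ge[OF gen T]) auto
      also have "\<dots> \<le> ereal (real p * kappa + (c + K + e0) + e0)"
        by (rule delta_add_le[OF additive c cL top_cube_is_cube[OF T] s1 sT dl dL])
      finally have "of_int j * real A \<le> b" by (simp add: b_def)
      moreover have "of_int j * 1 \<le> of_int j * real A"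
        using j pos by (intro mult_left_mono) auto
      moreover have "b < of_int j" using j by linarith
      ultimately show False by simp
    qed
  qed
qed

end

section \<open>Limits of uniformly bounded self-adjoint operators\<close>

text \<open>
  The functions for which the conclusion holds form a closed subspace.  Linearity of \<open>T\<^sub>i\<close> up to null
  functions is a consequence of self-adjointness, so everything is tested against a third function.
\<close>

lemma (in growth_measure) strong_limit_by_density:
  fixes T :: "nat \<Rightarrow> ('a \<Rightarrow> real) \<Rightarrow> 'a \<Rightarrow> real"
  assumes L2: "\<And>i f. in_L2 M f \<Longrightarrow> in_L2 M (T i f)"
    and adj: "\<And>i f g. in_L2 M f \<Longrightarrow> in_L2 M g \<Longrightarrow> ip M (T i f) g = ip M f (T i g)"
    and bdd: "\<And>i f. in_L2 M f \<Longrightarrow> nrm M (T i f) \<le> B * nrm M f" and B: "0 \<le> B"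
    and Lip: "\<And>f L K. in_L2 M f \<Longrightarrow> bounded K \<Longrightarrow> (\<And>x. x \<notin> K \<Longrightarrow> f x = 0) \<Longrightarrow>
      (\<And>x y. \<bar>f x - f y\<bar> \<le> L * dist x y) \<Longrightarrow> (\<And>x. \<bar>f x\<bar> \<le> 1) \<Longrightarrow>
      (\<lambda>i. nrm M (\<lambda>x. T i f x - c * f x)) \<longlonglongrightarrow> 0"
    and f: "in_L2 M f"
  shows "(\<lambda>i. nrm M (\<lambda>x. T i f x - c * f x)) \<longlonglongrightarrow> 0"
proof -
  let ?D = "\<lambda>i f x. T i f x - c * f x"
  have DL2: "in_L2 M (?D i f)" if "in_L2 M f" for i f
    using that by (intro in_L2_diff L2 in_L2_cmult)
  have Dadj: "ip M (?D i f) g = ip M f (?D i g)" if "in_L2 M f" "in_L2 M g" for i f g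
    using that by (simp add: ip_diff_left ip_diff_right L2 in_L2_cmult ip_cmult_left adj)
      (simp add: ip_sym[of M f "\<lambda>x. c * g x"] ip_cmult_left ip_sym[of M g f])
  have Dbdd: "nrm M (?D i f) \<le> (B + \<bar>c\<bar>) * nrm M f" if "in_L2 M f" for i f
    using nrm_triangle_diff[OF L2[OF that, of i] in_L2_cmult[OF that, of c]] bdd[OF that, of i]
    by (simp add: nrm_cmult distrib_right)
  have Dsub: "nrm M (?D i (\<lambda>x. f x + g x)) \<le> nrm M (?D i f) + nrm M (?D i g)"
    if f: "in_L2 M f" and g: "in_L2 M g" for i f g
  proof (rule nrm_le_by_duality)
    fix h assume h: "in_L2 M h"
    have "ip M (?D i (\<lambda>x. f x + g x)) h = ip M (?D i f) h + ip M (?D i g) h"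
      by (simp only: Dadj[OF in_L2_add[OF f g] h] Dadj[OF f h] Dadj[OF g h] ip_add_left[OF f g DL2[OF h]])
    then show "\<bar>ip M (?D i (\<lambda>x. f x + g x)) h\<bar> \<le> (nrm M (?D i f) + nrm M (?D i g)) * nrm M h"
      using ip_Cauchy_Schwarz[OF DL2[OF f, of i] h] ip_Cauchy_Schwarz[OF DL2[OF g, of i] h]
      by (simp add: distrib_right)
  qed (use in_L2_add[OF f g] DL2 in auto)
  show ?thesis using f
  proof (induction rule: L2_induct_Lipschitz)
    case (Lipschitz f L B)
    then show ?case by (intro Lip[of f B L])
  next
    case (add f g)
    have "(\<lambda>i. nrm M (?D i f) + nrm M (?D i g)) \<longlonglongrightarrow> 0 + 0"
      using add by (intro tendsto_add)
    then have "(\<lambda>i. nrm M (?D i f) + nrm M (?D i g)) \<longlonglongrightarrow> 0" by simp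
    then show ?case
      by (rule tendsto_sandwich[OF always_eventually always_eventually tendsto_const, rotated -1])
         (use Dsub add in auto)
  next
    case (cmult f a)
    have le: "nrm M (?D i (\<lambda>x. a * f x)) \<le> \<bar>a\<bar> * nrm M (?D i f)" for i
    proof (rule nrm_le_by_duality)
      fix h assume h: "in_L2 M h"
      have "ip M (?D i (\<lambda>x. a * f x)) h = a * ip M (?D i f) h"
        by (simp only: Dadj[OF in_L2_cmult[OF cmult(1)] h] Dadj[OF cmult(1) h] ip_cmult_left)
      then show "\<bar>ip M (?D i (\<lambda>x. a * f x)) h\<bar> \<le> \<bar>a\<bar> * nrm M (?D i f) * nrm M h"
        using mult_left_mono[OF ip_Cauchy_Schwarz[OF DL2[OF cmult(1), of i] h], of "\<bar>a\<bar>"]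
        by (simp add: abs_mult mult.assoc)
    qed (use in_L2_cmult[OF cmult(1)] DL2 in auto)
    have "(\<lambda>i. \<bar>a\<bar> * nrm M (?D i f)) \<longlonglongrightarrow> \<bar>a\<bar> * 0"
      using cmult by (intro tendsto_mult_left)
    then have "(\<lambda>i. \<bar>a\<bar> * nrm M (?D i f)) \<longlonglongrightarrow> 0" by simp
    then show ?case
      by (rule tendsto_sandwich[OF always_eventually always_eventually tendsto_const, rotated -1])
         (use le in auto)
  next
    case (lim f s)
    have le: "nrm M (?D i f) \<le> nrm M (?D i (s l)) + (B + \<bar>c\<bar>) * nrm M (\<lambda>x. s l x - f x)" for i l
    proof -
      let ?e = "\<lambda>x. (-1) * (s l x - f x)"
      have e: "in_L2 M ?e" using lim by (intro in_L2_cmult in_L2_diff) auto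
      have "(\<lambda>x. s l x + ?e x) = f" by auto
      then have "nrm M (?D i f) \<le> nrm M (?D i (s l)) + nrm M (?D i ?e)"
        using Dsub[OF lim(2)[of l] e, of i] by simp
      also have "nrm M (?D i ?e) \<le> (B + \<bar>c\<bar>) * nrm M ?e" by (rule Dbdd[OF e])
      also have "nrm M ?e = nrm M (\<lambda>x. s l x - f x)" using nrm_cmult[of M "-1" "\<lambda>x. s l x - f x"] by simp
      finally show ?thesis by simp
    qed
    show ?case
    proof (rule LIMSEQ_I)
      fix r :: real assume r: "0 < r"
      have "(\<lambda>l. (B + \<bar>c\<bar>) * nrm M (\<lambda>x. s l x - f x)) \<longlonglongrightarrow> (B + \<bar>c\<bar>) * 0"
        using lim(3) by (intro tendsto_mult_left)
      then have "eventually (\<lambda>l. (B + \<bar>c\<bar>) * nrm M (\<lambda>x. s l x - f x) < r / 2) sequentially"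
        using r by (intro order_tendstoD(2)) auto
      then obtain l where l: "(B + \<bar>c\<bar>) * nrm M (\<lambda>x. s l x - f x) < r / 2"
        by (auto simp: eventually_sequentially)
      have "eventually (\<lambda>i. nrm M (?D i (s l)) < r / 2) sequentially"
        using lim(4)[of l] r by (intro order_tendstoD(2)) auto
      then obtain N where "\<And>i. N \<le> i \<Longrightarrow> nrm M (?D i (s l)) < r / 2"
        by (auto simp: eventually_sequentially)
      then show "\<exists>N. \<forall>i\<ge>N. norm (nrm M (?D i f) - 0) < r"
        using le[of _ l] l by (intro exI[of _ N] allI impI) (smt (verit) field_sum_of_halves nrm_nonneg real_norm_def)
    qed
  qed
qed

lemma in_L2_mult_bounded:
  assumes h: "h \<in> borel_measurable M" "AE x in M. \<bar>h x\<bar> \<le> c" and f: "in_L2 M f"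
  shows "in_L2 M (\<lambda>x. h x * f x)"
  unfolding in_L2_iff_integrable
proof
  have [measurable]: "f \<in> borel_measurable M" "h \<in> borel_measurable M" using f h by (auto simp: in_L2_def)
  show "(\<lambda>x. h x * f x) \<in> borel_measurable M" by measurable
  show "integrable M (\<lambda>x. (h x * f x)\<^sup>2)"
  proof (rule Bochner_Integration.integrable_bound)
    show "integrable M (\<lambda>x. c\<^sup>2 * (f x)\<^sup>2)" using f by (auto simp: in_L2_iff_integrable)
    show "AE x in M. norm ((h x * f x)\<^sup>2) \<le> norm (c\<^sup>2 * (f x)\<^sup>2)"
      using h(2)
    proof eventually_elim
      case (elim x)
      then have "(h x)\<^sup>2 \<le> c\<^sup>2" by (simp flip: abs_le_square_iff)
      then show ?case by (simp add: power_mult_distrib mult_right_mono)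
    qed
  qed measurable
qed

context large_parameters begin

section \<open>The two Markov factors of \<open>S\<^sub>k\<close>\<close>

definition h :: "int \<Rightarrow> 'a \<Rightarrow> real" where "h k x = max 0 (1 / 4 - (LINT y|M. \<phi> k y x))"
abbreviation m where "m k \<equiv> m_fun M (\<phi> k)"
abbreviation w where "w k \<equiv> w_fun M (\<phi> k)"

lemma phi_section_measurable [measurable]:
  "(\<lambda>y. \<phi> k y x) \<in> borel_measurable M" "(\<lambda>y. \<phi> k x y) \<in> borel_measurable M"
  by (rule phi_measurable_comp; simp add: space_M)+

lemma h_measurable [measurable]: "h k \<in> borel_measurable M"
proof -
  interpret sigma_finite_measure M by (rule sigma_finite_M)
  note [measurable (raw)] = phi_measurable_comp[of _ _ _ k]
  show ?thesis unfolding h_def by measurable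
qed

lemma S_tilde_one: "S_tilde M (\<phi> k) (\<lambda>_. 1) x = (LINT y|M. \<phi> k y x) + h k x"
  by (simp add: S_tilde_def h_def)

lemma m_eq: "m k x = 1 / ((LINT y|M. \<phi> k y x) + h k x)"
  by (simp add: m_fun_def S_tilde_one)

lemma w_eq: "w k x = 1 / ((LINT y|M. \<phi> k x y * m k y) + h k x * m k x)"
  unfolding w_fun_def S_tilde_adj_def h_def m_fun_def by simp

lemma m_measurable [measurable]: "m k \<in> borel_measurable M"
proof -
  interpret sigma_finite_measure M by (rule sigma_finite_M)
  note [measurable (raw)] = phi_measurable_comp[of _ _ _ k]
  have "(\<lambda>x. 1 / ((LINT y|M. \<phi> k y x) + h k x)) \<in> borel_measurable M" by measurable
  then show ?thesis by (simp add: m_eq[abs_def])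
qed

lemma w_measurable [measurable]: "w k \<in> borel_measurable M"
proof -
  interpret sigma_finite_measure M by (rule sigma_finite_M)
  note [measurable (raw)] = phi_measurable_comp[of _ _ _ k]
  have "(\<lambda>x. 1 / ((LINT y|M. \<phi> k x y * m k y) + h k x * m k x)) \<in> borel_measurable M" by measurable
  then show ?thesis by (simp add: w_eq[abs_def])
qed

lemma AE_phi_nonneg: "x \<in> supp M \<Longrightarrow> AE y in M. 0 \<le> \<phi> k y x" "x \<in> supp M \<Longrightarrow> AE y in M. 0 \<le> \<phi> k x y"
  by (rule eventually_mono[OF AE_in_supp], rule phi_nonneg) (auto intro: phi_nonneg)

lemma integrable_phi:
  assumes "x \<in> supp M"
  shows "integrable M (\<lambda>y. \<phi> k y x)" "integrable M (\<lambda>y. \<phi> k x y)"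
proof -
  have fin: "u \<le> ennreal (3 / 2) \<Longrightarrow> u < \<infinity>" for u by (erule order.strict_trans1) simp
  show "integrable M (\<lambda>y. \<phi> k y x)"
    by (rule integrableI_nonneg[OF phi_section_measurable(1) AE_phi_nonneg(1)[OF assms]
          fin[OF conjunct2[OF phi_le[OF assms]]]])
  show "integrable M (\<lambda>y. \<phi> k x y)"
    by (rule integrableI_nonneg[OF phi_section_measurable(2) AE_phi_nonneg(2)[OF assms]
          fin[OF conjunct1[OF phi_le[OF assms]]]])
qed

lemma nn_integral_phi:
  assumes "x \<in> supp M"
  shows "(\<integral>\<^sup>+y. ennreal (\<phi> k y x) \<partial>M) = ennreal (LINT y|M. \<phi> k y x)"
    "(\<integral>\<^sup>+y. ennreal (\<phi> k x y) \<partial>M) = ennreal (LINT y|M. \<phi> k x y)"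
  by (rule nn_integral_eq_integral[OF integrable_phi(1)[OF assms] AE_phi_nonneg(1)[OF assms]]
        nn_integral_eq_integral[OF integrable_phi(2)[OF assms] AE_phi_nonneg(2)[OF assms]])+

lemma LINT_phi_bounds:
  assumes "x \<in> supp M"
  shows "0 \<le> (LINT y|M. \<phi> k y x)" "0 \<le> (LINT y|M. \<phi> k x y)"
    "(LINT y|M. \<phi> k y x) \<le> 3 / 2" "(LINT y|M. \<phi> k x y) \<le> 3 / 2"
proof -
  show nn: "0 \<le> (LINT y|M. \<phi> k y x)" "0 \<le> (LINT y|M. \<phi> k x y)"
    by (rule integral_nonneg_AE[OF AE_phi_nonneg(1)[OF assms]] integral_nonneg_AE[OF AE_phi_nonneg(2)[OF assms]])+
  show "(LINT y|M. \<phi> k y x) \<le> 3 / 2" "(LINT y|M. \<phi> k x y) \<le> 3 / 2"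
    using phi_le[OF assms, of k] unfolding nn_integral_phi[OF assms] by (simp_all add: ennreal_le_iff del: ennreal_plus)
qed

lemma h_bounds: "x \<in> supp M \<Longrightarrow> 0 \<le> h k x \<and> h k x \<le> 1 / 4"
  using LINT_phi_bounds(1)[of x k] by (simp add: h_def max_def)

lemma m_bounds:
  assumes "x \<in> supp M"
  shows "2 / 3 \<le> m k x" "m k x \<le> 4" "m k x * ((LINT y|M. \<phi> k y x) + h k x) = 1"
proof -
  have s: "1 / 4 \<le> (LINT y|M. \<phi> k y x) + h k x" "(LINT y|M. \<phi> k y x) + h k x \<le> 3 / 2"
    using LINT_phi_bounds[OF assms, of k] by (auto simp: h_def max_def)
  then show "2 / 3 \<le> m k x" "m k x \<le> 4" "m k x * ((LINT y|M. \<phi> k y x) + h k x) = 1"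
    by (auto simp: m_eq field_simps)
qed

lemma integrable_phi_m:
  assumes "x \<in> supp M"
  shows "integrable M (\<lambda>y. \<phi> k x y * m k y)"
proof (rule Bochner_Integration.integrable_bound[of _ "\<lambda>y. 4 * \<phi> k x y"])
  show "integrable M (\<lambda>y. 4 * \<phi> k x y)" using integrable_phi[OF assms, of k] by simp
  show "AE y in M. norm (\<phi> k x y * m k y) \<le> norm (4 * \<phi> k x y)"
    using AE_in_supp
  proof eventually_elim
    case (elim y)
    have "\<bar>m k y\<bar> \<le> 4" using m_bounds[OF elim, of k] by linarith
    then have "\<bar>m k y\<bar> * \<bar>\<phi> k x y\<bar> \<le> 4 * \<bar>\<phi> k x y\<bar>" by (rule mult_right_mono) simp
    then show ?case by (simp add: abs_mult mult.commute)
  qed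
qed measurable

lemma w_bounds:
  assumes x: "x \<in> supp M" and k: "nontrivial k"
  shows "0 < w k x" "w k x \<le> 24" "w k x * ((LINT y|M. \<phi> k x y * m k y) + h k x * m k x) = 1"
proof -
  let ?V = "(LINT y|M. \<phi> k x y * m k y) + h k x * m k x"
  have 1: "2 / 3 * (LINT y|M. \<phi> k x y) \<le> (LINT y|M. \<phi> k x y * m k y)"
    unfolding integral_mult_right_zero[symmetric]
  proof (rule integral_mono_AE)
    show "integrable M (\<lambda>y. 2 / 3 * \<phi> k x y)" "integrable M (\<lambda>y. \<phi> k x y * m k y)"
      using integrable_phi[OF x, of k] integrable_phi_m[OF x, of k] by simp_all
    show "AE y in M. 2 / 3 * \<phi> k x y \<le> \<phi> k x y * m k y"
      using AE_in_supp AE_phi_nonneg(2)[OF x, of k]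
    proof eventually_elim
      case (elim y)
      then show ?case using mult_left_mono[OF m_bounds(1)[OF elim(1), of k] elim(2)] by (simp add: mult.commute)
    qed
  qed
  have 2: "2 / 3 * h k x \<le> h k x * m k x"
    using mult_left_mono[OF m_bounds(1)[OF x, of k], of "h k x"] h_bounds[OF x, of k] by (simp add: mult.commute)
  have "1 / 24 \<le> ?V"
    using phi_row_or_column_large[OF x k] unfolding nn_integral_phi[OF x]
  proof
    assume "ennreal (LINT y|M. \<phi> k y x) \<le> ennreal (1 / 8)"
    then have "1 / 8 \<le> h k x" by (subst (asm) ennreal_le_iff) (auto simp: h_def)
    then show ?thesis using 1 2 LINT_phi_bounds(2)[OF x, of k] by linarith
  next
    assume "ennreal (1 / 16) \<le> ennreal (LINT y|M. \<phi> k x y)"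
    then have "1 / 16 \<le> (LINT y|M. \<phi> k x y)"
      using LINT_phi_bounds(2)[OF x, of k] by (subst (asm) ennreal_le_iff) auto
    then show ?thesis using 1 2 h_bounds[OF x, of k] by linarith
  qed
  then show "0 < w k x" "w k x \<le> 24" "w k x * ?V = 1"
    unfolding w_eq by (auto simp: field_simps)
qed

text \<open>
  \<open>S\<^sub>k = P Q\<close>, where \<open>P\<close> has kernel \<open>KP\<close> and diagonal part \<open>dP\<close>, and \<open>Q\<close> has \<open>KQ\<close> and \<open>dQ\<close>.  The
  normalising functions \<open>m\<^sub>k\<close> and \<open>w\<^sub>k\<close> are just what makes both of them Markov operators.
\<close>

definition KP :: "int \<Rightarrow> 'a \<Rightarrow> 'a \<Rightarrow> real" where "KP k x y = m k x * \<phi> k y x"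
definition dP :: "int \<Rightarrow> 'a \<Rightarrow> real" where "dP k x = m k x * h k x"
definition KQ :: "int \<Rightarrow> 'a \<Rightarrow> 'a \<Rightarrow> real" where "KQ k x y = w k x * \<phi> k x y * m k y"
definition dQ :: "int \<Rightarrow> 'a \<Rightarrow> real" where "dQ k x = w k x * h k x * m k x"

lemma massP:
  assumes x: "x \<in> supp M"
  shows "(\<integral>\<^sup>+y. ennreal (KP k x y) \<partial>M) + ennreal (dP k x) = 1"
proof -
  note b = m_bounds[OF x, of k] LINT_phi_bounds[OF x, of k] h_bounds[OF x, of k]
  have "(\<integral>\<^sup>+y. ennreal (KP k x y) \<partial>M) = ennreal (LINT y|M. m k x * \<phi> k y x)"
    unfolding KP_def using AE_phi_nonneg(1)[OF x, of k] integrable_phi[OF x, of k] b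
    by (intro nn_integral_eq_integral) (auto elim!: eventually_mono)
  then have "(\<integral>\<^sup>+y. ennreal (KP k x y) \<partial>M) + ennreal (dP k x)
      = ennreal (m k x * (LINT y|M. \<phi> k y x) + m k x * h k x)"
    using b by (simp add: dP_def)
  then show ?thesis using b by (simp add: distrib_left del: ennreal_plus)
qed

lemma massQ:
  assumes x: "x \<in> supp M" and k: "nontrivial k"
  shows "(\<integral>\<^sup>+y. ennreal (KQ k x y) \<partial>M) + ennreal (dQ k x) = 1"
proof -
  note b = m_bounds[OF x, of k] LINT_phi_bounds[OF x, of k] h_bounds[OF x, of k] w_bounds[OF x k]
  have nn: "AE y in M. 0 \<le> \<phi> k x y * m k y"
    using AE_in_supp AE_phi_nonneg(2)[OF x, of k]
  proof eventually_elim
    case (elim y)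
    then show ?case using m_bounds[OF elim(1), of k] by simp
  qed
  then have I0: "0 \<le> (LINT y|M. \<phi> k x y * m k y)" by (rule integral_nonneg_AE)
  have "(\<integral>\<^sup>+y. ennreal (KQ k x y) \<partial>M) = ennreal (LINT y|M. w k x * (\<phi> k x y * m k y))"
    unfolding KQ_def mult.assoc using nn integrable_phi_m[OF x, of k] b
    by (intro nn_integral_eq_integral) (auto elim!: eventually_mono)
  then have "(\<integral>\<^sup>+y. ennreal (KQ k x y) \<partial>M) + ennreal (dQ k x)
      = ennreal (w k x * (LINT y|M. \<phi> k x y * m k y) + w k x * (h k x * m k x))"
    using b I0 by (simp add: dQ_def mult.assoc)
  then show ?thesis using b by (simp add: distrib_left del: ennreal_plus)
qed

text \<open>The column sums are at most \<open>4 (3/2 + 1/4) = 7\<close> and \<open>24 * 4 (3/2 + 1/4) = 168\<close>.\<close>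

lemma positive_kernel_P: "positive_kernel M (KP k) (dP k) (supp M) 1 7"
proof -
  interpret sigma_finite_measure M by (rule sigma_finite_M)
  show ?thesis
  proof
    note [measurable (raw)] = phi_measurable_comp[of _ _ _ k]
    show "(\<lambda>(x, y). KP k x y) \<in> borel_measurable (M \<Otimes>\<^sub>M M)" unfolding KP_def by measurable
    show "dP k \<in> borel_measurable M" unfolding dP_def[abs_def] by measurable
    show "AE x in M. x \<in> supp M" by (rule AE_in_supp)
    show "0 \<le> KP k x y" if "x \<in> supp M" "y \<in> supp M" for x y
      using m_bounds[OF that(1), of k] phi_nonneg[OF that(2), of k x] by (simp add: KP_def)
    show "0 \<le> dP k x" if "x \<in> supp M" for x
      using m_bounds[OF that, of k] h_bounds[OF that, of k] by (simp add: dP_def)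
    show "(\<integral>\<^sup>+y. ennreal (KP k x y) \<partial>M) + ennreal (dP k x) \<le> ennreal 1" if "x \<in> supp M" for x
      using massP[OF that, of k] by simp
    show "(\<integral>\<^sup>+x. ennreal (KP k x y) \<partial>M) + ennreal (dP k y) \<le> ennreal 7" if y: "y \<in> supp M" for y
    proof -
      have "(\<integral>\<^sup>+x. ennreal (KP k x y) \<partial>M) \<le> (\<integral>\<^sup>+x. ennreal 4 * ennreal (\<phi> k y x) \<partial>M)"
        using AE_in_supp AE_phi_nonneg(2)[OF y, of k]
      proof (intro nn_integral_mono_AE, eventually_elim)
        case (elim x)
        then have "KP k x y \<le> 4 * \<phi> k y x"
          unfolding KP_def using m_bounds(2)[of x k] by (intro mult_right_mono) auto
        then have "ennreal (KP k x y) \<le> ennreal (4 * \<phi> k y x)" by (rule ennreal_leI)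
        then show ?case by (simp add: ennreal_mult')
      qed
      also have "\<dots> = ennreal 4 * (\<integral>\<^sup>+x. ennreal (\<phi> k y x) \<partial>M)" by (rule nn_integral_cmult) measurable
      also have "\<dots> \<le> ennreal 4 * ennreal (3 / 2)" using phi_le[OF y] by (intro mult_left_mono) auto
      also have "\<dots> = ennreal 6" by (subst ennreal_mult[symmetric]) auto
      finally have "(\<integral>\<^sup>+x. ennreal (KP k x y) \<partial>M) \<le> ennreal 6" .
      moreover have "dP k y \<le> 4 * (1 / 4)"
        unfolding dP_def using m_bounds[OF y, of k] h_bounds[OF y, of k] by (intro mult_mono) auto
      then have "ennreal (dP k y) \<le> ennreal 1" by (intro ennreal_leI) simp
      ultimately have "(\<integral>\<^sup>+x. ennreal (KP k x y) \<partial>M) + ennreal (dP k y) \<le> ennreal 6 + ennreal 1" by (rule add_mono)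
      then show ?thesis by (simp flip: ennreal_plus)
    qed
  qed (simp_all add: space_M)
qed

lemma positive_kernel_Q:
  assumes k: "nontrivial k"
  shows "positive_kernel M (KQ k) (dQ k) (supp M) 1 168"
proof -
  interpret sigma_finite_measure M by (rule sigma_finite_M)
  show ?thesis
  proof
    note [measurable (raw)] = phi_measurable_comp[of _ _ _ k]
    show "(\<lambda>(x, y). KQ k x y) \<in> borel_measurable (M \<Otimes>\<^sub>M M)" unfolding KQ_def by measurable
    show "dQ k \<in> borel_measurable M" unfolding dQ_def[abs_def] by measurable
    show "AE x in M. x \<in> supp M" by (rule AE_in_supp)
    show "0 \<le> KQ k x y" if "x \<in> supp M" "y \<in> supp M" for x y
      using m_bounds[OF that(2), of k] phi_nonneg[OF that(1), of k y] w_bounds[OF that(1) k] by (simp add: KQ_def)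
    show "0 \<le> dQ k x" if "x \<in> supp M" for x
      using m_bounds[OF that, of k] h_bounds[OF that, of k] w_bounds[OF that k] by (simp add: dQ_def)
    show "(\<integral>\<^sup>+y. ennreal (KQ k x y) \<partial>M) + ennreal (dQ k x) \<le> ennreal 1" if "x \<in> supp M" for x
      using massQ[OF that k] by simp
    show "(\<integral>\<^sup>+x. ennreal (KQ k x y) \<partial>M) + ennreal (dQ k y) \<le> ennreal 168" if y: "y \<in> supp M" for y
    proof -
      have "(\<integral>\<^sup>+x. ennreal (KQ k x y) \<partial>M) \<le> (\<integral>\<^sup>+x. ennreal 96 * ennreal (\<phi> k x y) \<partial>M)"
        using AE_in_supp AE_phi_nonneg(1)[OF y, of k]
      proof (intro nn_integral_mono_AE, eventually_elim)
        case (elim x)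
        then have "w k x * \<phi> k x y * m k y \<le> 24 * \<phi> k x y * 4"
          using m_bounds[OF y, of k] w_bounds[OF elim(3) k] by (intro mult_mono mult_right_mono) auto
        then have "ennreal (KQ k x y) \<le> ennreal (96 * \<phi> k x y)" by (intro ennreal_leI) (simp add: KQ_def)
        then show ?case by (simp add: ennreal_mult')
      qed
      also have "\<dots> = ennreal 96 * (\<integral>\<^sup>+x. ennreal (\<phi> k x y) \<partial>M)" by (rule nn_integral_cmult) measurable
      also have "\<dots> \<le> ennreal 96 * ennreal (3 / 2)" using phi_le[OF y] by (intro mult_left_mono) auto
      also have "\<dots> = ennreal 144" by (subst ennreal_mult[symmetric]) auto
      finally have "(\<integral>\<^sup>+x. ennreal (KQ k x y) \<partial>M) \<le> ennreal 144" .
      moreover have "dQ k y \<le> 24 * (1 / 4) * 4"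
        unfolding dQ_def using m_bounds[OF y, of k] h_bounds[OF y, of k] w_bounds[OF y k] by (intro mult_mono) auto
      then have "ennreal (dQ k y) \<le> ennreal 24" by (intro ennreal_leI) simp
      ultimately have "(\<integral>\<^sup>+x. ennreal (KQ k x y) \<partial>M) + ennreal (dQ k y) \<le> ennreal 144 + ennreal 24" by (rule add_mono)
      then show ?thesis by (simp flip: ennreal_plus)
    qed
  qed (simp_all add: space_M)
qed

lemma exists_Whole_iff:
  assumes "supp M \<noteq> {}"
  shows "(\<exists>x\<in>supp M. Q x k = Whole) \<longleftrightarrow> \<not> nontrivial k"
proof -
  obtain x0 where x0: "x0 \<in> supp M" using assms by auto
  have "Q x k = Whole \<longleftrightarrow> \<not> nontrivial k" if "x \<in> supp M" for x
    using generation_Q[OF that, of k] generation_Whole[of k] generation_not_Whole[of "Q x k" k]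
      generation_nontrivial[of "Q x k" k] by (auto simp: nontrivial_def)
  then show ?thesis using x0 by auto
qed

lemma S_op_trivial: "supp M \<noteq> {} \<Longrightarrow> \<not> nontrivial k \<Longrightarrow> S_op M Q \<phi> k f = (\<lambda>x. 0)"
  by (simp add: S_op_def exists_Whole_iff)

lemma S_op_composition:
  assumes "supp M \<noteq> {}" "nontrivial k"
  shows "S_op M Q \<phi> k f = (\<lambda>x. m k x * S_tilde M (\<phi> k) (\<lambda>x. w k x * S_tilde_adj M (\<phi> k) (\<lambda>x. m k x * f x) x) x)"
  using assms by (simp add: S_op_def exists_Whole_iff mult_op_def o_def)

lemma S_op_eq_kop:
  assumes "supp M \<noteq> {}" "nontrivial k"
  shows "S_op M Q \<phi> k f = kop M (KP k) (dP k) (kop M (KQ k) (dQ k) f)"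
proof -
  have q: "w k x * S_tilde_adj M (\<phi> k) (\<lambda>x. m k x * f x) x = kop M (KQ k) (dQ k) f x" for x
    unfolding S_tilde_adj_def kop_def KQ_def dQ_def h_def[symmetric] distrib_left integral_mult_right_zero[symmetric]
    by (simp add: mult.assoc)
  have p: "m k x * S_tilde M (\<phi> k) g x = kop M (KP k) (dP k) g x" for g x
    unfolding S_tilde_def kop_def KP_def dP_def h_def[symmetric] distrib_left integral_mult_right_zero[symmetric]
    by (simp add: mult.assoc)
  show ?thesis unfolding S_op_composition[OF assms] q p ..
qed

lemma L2_sq_le_nrm:
  assumes "in_L2 M f" "in_L2 M g" "L2_sq M f \<le> ennreal b * L2_sq M g" "0 \<le> b" "b \<le> c\<^sup>2" "0 \<le> c"
  shows "nrm M f \<le> c * nrm M g"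
proof (rule power2_le_imp_le)
  have "ennreal ((nrm M f)\<^sup>2) \<le> ennreal (b * (nrm M g)\<^sup>2)"
    using assms by (simp add: L2_sq_eq_nrm ennreal_mult)
  then have "(nrm M f)\<^sup>2 \<le> b * (nrm M g)\<^sup>2" using assms(4) by (subst (asm) ennreal_le_iff) auto
  also have "\<dots> \<le> c\<^sup>2 * (nrm M g)\<^sup>2" using assms(5) by (rule mult_right_mono) simp
  finally show "(nrm M f)\<^sup>2 \<le> (c * nrm M g)\<^sup>2" by (simp add: power_mult_distrib)
qed (use assms in simp)

abbreviation S where "S \<equiv> S_op M Q \<phi>"

lemma S_L2:
  assumes "supp M \<noteq> {}" "in_L2 M f"
  shows "in_L2 M (S k f)"
proof (cases "nontrivial k")
  case True
  interpret P: positive_kernel M "KP k" "dP k" "supp M" 1 7 by (rule positive_kernel_P)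
  interpret Q: positive_kernel M "KQ k" "dQ k" "supp M" 1 168 by (rule positive_kernel_Q[OF True])
  show ?thesis using assms by (simp add: S_op_eq_kop True P.in_L2_kop Q.in_L2_kop)
qed (use assms in \<open>simp add: S_op_trivial in_L2_zero\<close>)

lemma S_bounded:
  assumes s: "supp M \<noteq> {}" and f: "in_L2 M f"
  shows "nrm M (S k f) \<le> 35 * nrm M f"
proof (rule L2_sq_le_nrm[OF S_L2[OF s f] f, where b = 1176])
  show "L2_sq M (S k f) \<le> ennreal 1176 * L2_sq M f"
  proof (cases "nontrivial k")
    case True
    interpret P: positive_kernel M "KP k" "dP k" "supp M" 1 7 by (rule positive_kernel_P)
    interpret Q: positive_kernel M "KQ k" "dQ k" "supp M" 1 168 by (rule positive_kernel_Q[OF True])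
    have Qf: "in_L2 M (kop M (KQ k) (dQ k) f)" by (rule Q.in_L2_kop[OF f])
    have "L2_sq M (S k f) \<le> ennreal (1 * 7) * L2_sq M (kop M (KQ k) (dQ k) f)"
      unfolding S_op_eq_kop[OF s True] by (rule P.L2_sq_kop_le[OF Qf])
    also have "\<dots> \<le> ennreal (1 * 7) * (ennreal (1 * 168) * L2_sq M f)"
      by (rule mult_left_mono[OF Q.L2_sq_kop_le[OF f]]) simp
    also have "\<dots> = ennreal ((1 * 7) * (1 * 168)) * L2_sq M f"
      by (subst ennreal_mult) (simp_all only: mult.assoc, simp_all)
    also have "(1 * 7) * (1 * 168) = (1176 :: real)" by simp
    finally show ?thesis .
  next
    case False
    then show ?thesis by (simp add: S_op_trivial s L2_sq_def)
  qed
qed auto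

lemma AE_m_bounded: "AE x in M. \<bar>m k x\<bar> \<le> 4"
proof (rule eventually_mono[OF AE_in_supp])
  fix x assume "x \<in> supp M"
  then show "\<bar>m k x\<bar> \<le> 4" using m_bounds[of x k] by linarith
qed

lemma AE_w_bounded: "nontrivial k \<Longrightarrow> AE x in M. \<bar>w k x\<bar> \<le> 24"
proof (rule eventually_mono[OF AE_in_supp])
  fix x assume "x \<in> supp M" "nontrivial k"
  then show "\<bar>w k x\<bar> \<le> 24" using w_bounds[of x k] by linarith
qed

lemma S_tilde_kernel: "positive_kernel M (\<lambda>x y. \<phi> k y x) (h k) (supp M) 2 2"
  "positive_kernel M (\<phi> k) (h k) (supp M) 2 2"
proof -
  interpret sigma_finite_measure M by (rule sigma_finite_M)
  note [measurable (raw)] = phi_measurable_comp[of _ _ _ k]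
  have sum: "(\<integral>\<^sup>+y. ennreal (\<phi> k y x) \<partial>M) + ennreal (h k x) \<le> ennreal 2"
    "(\<integral>\<^sup>+y. ennreal (\<phi> k x y) \<partial>M) + ennreal (h k x) \<le> ennreal 2" if x: "x \<in> supp M" for x
  proof -
    have "ennreal (h k x) \<le> ennreal (1 / 4)" using h_bounds[OF x, of k] by (intro ennreal_leI) simp
    moreover have "ennreal (3 / 2) + ennreal (1 / 4) \<le> ennreal 2"
    proof -
      have "ennreal (3 / 2) + ennreal (1 / 4) = ennreal (3 / 2 + 1 / 4)" by (rule ennreal_plus[symmetric]) auto
      also have "\<dots> \<le> ennreal 2" by (rule ennreal_leI) simp
      finally show ?thesis .
    qed
    ultimately show "(\<integral>\<^sup>+y. ennreal (\<phi> k y x) \<partial>M) + ennreal (h k x) \<le> ennreal 2"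
      "(\<integral>\<^sup>+y. ennreal (\<phi> k x y) \<partial>M) + ennreal (h k x) \<le> ennreal 2"
      using phi_le[OF x, of k] by (meson add_mono order_trans)+
  qed
  show "positive_kernel M (\<lambda>x y. \<phi> k y x) (h k) (supp M) 2 2"
    by unfold_locales (use AE_in_supp phi_nonneg h_bounds sum in \<open>auto simp: space_M\<close>)
  show "positive_kernel M (\<phi> k) (h k) (supp M) 2 2"
    by unfold_locales (use phi_measurable AE_in_supp phi_nonneg h_bounds sum in \<open>auto simp: space_M\<close>)
qed

lemma S_tilde_L2:
  assumes "in_L2 M f"
  shows "in_L2 M (S_tilde M (\<phi> k) f)" "in_L2 M (S_tilde_adj M (\<phi> k) f)"
proof -
  interpret a: positive_kernel M "\<lambda>x y. \<phi> k y x" "h k" "supp M" 2 2 by (rule S_tilde_kernel)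
  interpret b: positive_kernel M "\<phi> k" "h k" "supp M" 2 2 by (rule S_tilde_kernel)
  show "in_L2 M (S_tilde M (\<phi> k) f)" "in_L2 M (S_tilde_adj M (\<phi> k) f)"
    using a.in_L2_kop[OF assms] b.in_L2_kop[OF assms]
    by (simp_all add: kop_def[abs_def] S_tilde_def[abs_def] S_tilde_adj_def[abs_def] h_def)
qed

lemma S_selfadjoint:
  assumes s: "supp M \<noteq> {}" and f: "in_L2 M f" and g: "in_L2 M g"
  shows "ip M (S k f) g = ip M f (S k g)"
proof (cases "nontrivial k")
  case True
  let ?a = "\<lambda>f. S_tilde_adj M (\<phi> k) (\<lambda>x. m k x * f x)"
  have mL2: "in_L2 M (\<lambda>x. m k x * f x)" if "in_L2 M f" for f
    using that by (intro in_L2_mult_bounded[OF _ AE_m_bounded]) measurable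
  have aL2: "in_L2 M (?a f)" if "in_L2 M f" for f
    using that by (intro S_tilde_L2 mL2)
  have wL2: "in_L2 M (\<lambda>x. w k x * ?a f x)" if "in_L2 M f" for f
    using that by (intro in_L2_mult_bounded[OF _ AE_w_bounded[OF True]] aL2) measurable
  have *: "ip M (S k f) g = ip M (\<lambda>x. w k x * ?a f x) (?a g)" if "in_L2 M f" "in_L2 M g" for f g
  proof -
    have "ip M (S k f) g = (LINT x|M. S_tilde M (\<phi> k) (\<lambda>x. w k x * ?a f x) x * (m k x * g x))"
      unfolding ip_def S_op_composition[OF s True] by (simp add: ac_simps)
    also have "\<dots> = (LINT x|M. (w k x * ?a f x) * ?a g x)"
      using that by (intro S_tilde_adjoint wL2 mL2)
    finally show ?thesis by (simp add: ip_def)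
  qed
  have "ip M (S k f) g = ip M (S k g) f"
    unfolding *[OF f g] *[OF g f] by (simp add: ip_def ac_simps)
  then show ?thesis by (simp add: ip_sym[of M f])
next
  case False
  then show ?thesis by (simp add: S_op_trivial s ip_def)
qed

section \<open>Oscillation at scale \<open>j\<close>\<close>

text \<open>
  Both steps pass through the same \<open>y\<close>, and by the support of \<open>\<psi>\<^sub>y\<^sub>,\<^sub>j\<close> neither of them leaves \<open>Q\<^sub>y\<^sub>,\<^sub>j\<^sub>-\<^sub>1\<close>.
\<close>

lemma coupled_points:
  assumes j: "nontrivial (j - 1)" and xyz: "x \<in> supp M" "y \<in> supp M" "z \<in> supp M"
    and 1: "y = x \<or> KP j x y \<noteq> 0" and 2: "z = y \<or> KQ j y z \<noteq> 0" and "x \<noteq> z"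
  obtains c l where "generation M n e1 A R (Transit c l) (j - 1)" "x \<in> cube_set (Transit c l)" "z \<in> cube_set (Transit c l)"
proof -
  have px: "x = y \<or> \<psi> j y x \<noteq> 0" using 1 by (auto simp: KP_def phi_psi)
  have pz: "z = y \<or> \<psi> j y z \<noteq> 0" using 2 by (auto simp: KQ_def phi_psi)
  from px pz \<open>x \<noteq> z\<close> obtain u where "\<psi> j y u \<noteq> 0" by auto
  then obtain l where l: "Q y (j - 1) = Transit y l" "generation M n e1 A R (Transit y l) (j - 1)" "0 < l"
    by (rule psi_support[OF xyz(2) j])
  have "u \<in> cube_set (Transit y l)" if "u = y \<or> \<psi> j y u \<noteq> 0" for u
    using that
  proof
    assume "\<psi> j y u \<noteq> 0"
    then show ?thesis by (rule psi_support[OF xyz(2) j]) (use l(1) in auto)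
  qed (use l centre_in_cube[of l y] in auto)
  then show ?thesis using that[OF l(2)] px pz by auto
qed

lemma oscillation_bound:
  assumes s: "supp M \<noteq> {}" and j: "nontrivial (j - 1)" and g: "in_L2 M g" and U: "U \<in> borel_measurable M"
    and osc: "\<And>c l x z. generation M n e1 A R (Transit c l) (j - 1) \<Longrightarrow> x \<in> supp M \<Longrightarrow> z \<in> supp M \<Longrightarrow>
      x \<in> cube_set (Transit c l) \<Longrightarrow> z \<in> cube_set (Transit c l) \<Longrightarrow>
      ennreal ((g x - g z)\<^sup>2) \<le> \<omega> * (U x + U z)"
  shows "L2_sq M (\<lambda>x. S j g x - g x) \<le> \<omega> * 1177 * (\<integral>\<^sup>+x. U x \<partial>M)"
proof -
  have j': "nontrivial j" using nontrivial_mono[OF j] by simp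
  have "L2_sq M (\<lambda>x. g x - kop M (KP j) (dP j) (kop M (KQ j) (dQ j) g) x)
      \<le> \<omega> * (1 + ennreal (7 * 168)) * (\<integral>\<^sup>+x. U x \<partial>M)"
  proof (rule two_step_oscillation_bound[OF positive_kernel_P positive_kernel_Q[OF j'] massP massQ[OF _ j'] g U])
    fix x y z
    assume a: "x \<in> supp M" "y \<in> supp M" "z \<in> supp M" "y = x \<or> KP j x y \<noteq> 0" "z = y \<or> KQ j y z \<noteq> 0"
    show "ennreal ((g x - g z)\<^sup>2) \<le> \<omega> * (U x + U z)"
    proof (cases "x = z")
      case False
      obtain c l where "generation M n e1 A R (Transit c l) (j - 1)" "x \<in> cube_set (Transit c l)" "z \<in> cube_set (Transit c l)"
        by (rule coupled_points[OF j a False])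
      then show ?thesis using a by (intro osc)
    qed simp
  qed auto
  moreover have "1 + ennreal (7 * 168) = 1177" by (simp flip: ennreal_numeral ennreal_1 ennreal_plus del: ennreal_1 ennreal_numeral)
  ultimately show ?thesis
    unfolding S_op_eq_kop[OF s j'] L2_sq_def by (simp add: power2_commute)
qed

text \<open>
  On points of transit cubes of generation \<open>k\<close> the diagonal part of \<open>S\<^sub>k\<close> vanishes, so that
  \<open>S\<^sub>k f\<close> inherits the regularity of the bump functions.
\<close>

lemma range_oscillation:
  assumes k: "nontrivial k" and kj: "k + 2 \<le> j"
    and gen: "generation M n e1 A R (Transit c l) (j - 1)"
    and x: "x \<in> supp M" "x \<in> cube_set (Transit c l)" and z: "z \<in> supp M" "z \<in> cube_set (Transit c l)"
    and b: "in_L2 M b"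
  defines "U \<equiv> \<lambda>x. \<integral>\<^sup>+y. ennreal (\<phi> k y x) * ennreal ((b y)\<^sup>2) \<partial>M"
  shows "ennreal ((kop M (KP k) (dP k) b x - kop M (KP k) (dP k) b z)\<^sup>2)
    \<le> ennreal (16 * (Creg / \<alpha>2) / 2 ^ nat (j - k)) * (U x + U z)"
proof -
  let ?\<omega> = "16 * (Creg / \<alpha>2) / 2 ^ nat (j - k)"
  have wpos: "0 < ?\<omega>" using Creg_pos pos by simp
  have [measurable]: "b \<in> borel_measurable M" using b by (simp add: in_L2_def)
  interpret T: positive_kernel M "\<lambda>x y. \<phi> k y x" "h k" "supp M" 2 2 by (rule S_tilde_kernel)
  show ?thesis
  proof (cases "U x = top \<or> U z = top")
    case True
    then have "ennreal ?\<omega> * (U x + U z) = top" using wpos by (auto simp: ennreal_mult_eq_top_iff)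
    then show ?thesis by simp
  next
    case False
    then have fin: "U x < \<infinity>" "U z < \<infinity>" by (auto simp: less_top)
    define I where "I u = (LINT y|M. \<phi> k y u)" for u
    have at: "kop M (KP k) (dP k) b u = (LINT y|M. (1 / I u * \<phi> k y u) * b y) \<and> h k u = 0 \<and>
        1 / 2 \<le> I u \<and> I u \<le> 3 / 2 \<and> integrable M (\<lambda>y. \<phi> k y u * b y)"
      if u: "u \<in> supp M" "u \<in> cube_set (Transit c l)" and f: "U u < \<infinity>" for u
    proof -
      obtain c' l' where "generation M n e1 A R (Transit c' l') k" "u \<in> cube_set (Transit c' l')"
        by (rule in_earlier_generation[OF u(1) gen u(2) k]) (use kj in auto)
      then have "ennreal (1 / 2) \<le> (\<integral>\<^sup>+y. ennreal (\<phi> k y u) \<partial>M)" using phi_ge[OF u(1)] by blast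
      then have I: "1 / 2 \<le> I u"
        unfolding nn_integral_phi[OF u(1)] I_def using LINT_phi_bounds[OF u(1), of k]
        by (subst (asm) ennreal_le_iff) auto
      then have h0: "h k u = 0" by (simp add: h_def I_def)
      then have "m k u = 1 / I u" by (simp add: m_eq I_def)
      moreover have "integrable M (\<lambda>y. \<phi> k y u * b y)"
        using u(1) f by (intro T.integrable_row_of_square) (auto simp: U_def)
      ultimately show ?thesis
        using I h0 LINT_phi_bounds[OF u(1), of k] by (simp add: kop_def KP_def dP_def I_def)
    qed
    note ax = at[OF x fin(1)] and az = at[OF z fin(2)]
    \<comment> \<open>The difference of the two values is the integral of \<open>\<kappa> b\<close>; as \<open>\<kappa>\<close> is small in \<open>L\<^sup>1\<close>, it
      is estimated by Cauchy-Schwarz with respect to the measure \<open>|\<kappa>| d\<mu>\<close>.\<close>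
    define \<kappa> where "\<kappa> y = 1 / I x * \<phi> k y x - 1 / I z * \<phi> k y z" for y
    have [measurable]: "\<kappa> \<in> borel_measurable M" unfolding \<kappa>_def by measurable
    define \<delta> where "\<delta> = (LINT y|M. \<bar>\<phi> k y x - \<phi> k y z\<bar>)"
    have idiff: "integrable M (\<lambda>y. \<bar>\<phi> k y x - \<phi> k y z\<bar>)"
      using integrable_phi(1)[OF x(1), of k] integrable_phi(1)[OF z(1), of k] by simp
    have \<delta>: "0 \<le> \<delta>" "\<delta> \<le> (Creg / \<alpha>2) / 2 ^ nat (j - k)"
    proof -
      show "0 \<le> \<delta>" unfolding \<delta>_def by (intro integral_nonneg_AE) auto
      have "ennreal (\<alpha>2 * \<delta>) = ennreal \<alpha>2 * (\<integral>\<^sup>+y. ennreal \<bar>\<phi> k y x - \<phi> k y z\<bar> \<partial>M)"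
        using nn_integral_eq_integral[OF idiff] pos \<open>0 \<le> \<delta>\<close> by (simp add: \<delta>_def ennreal_mult)
      also have "\<dots> = (\<integral>\<^sup>+y. ennreal \<alpha>2 * ennreal \<bar>\<phi> k y x - \<phi> k y z\<bar> \<partial>M)"
        by (rule nn_integral_cmult[symmetric]) measurable
      also have "\<dots> = (\<integral>\<^sup>+y. ennreal \<bar>\<psi> k y x - \<psi> k y z\<bar> \<partial>M)"
        using pos by (intro nn_integral_cong) (simp add: phi_psi abs_divide diff_divide_distrib[symmetric] flip: ennreal_mult)
      also have "\<dots> \<le> ennreal (Creg / 2 ^ nat (j - k))"
        by (rule psi_regularity[OF k kj gen x(2) z(2)])
      finally have "\<alpha>2 * \<delta> \<le> Creg / 2 ^ nat (j - k)"
        using Creg_pos by (subst (asm) ennreal_le_iff) auto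
      then show "\<delta> \<le> (Creg / \<alpha>2) / 2 ^ nat (j - k)" using pos by (simp add: field_simps)
    qed
    have Idiff: "\<bar>I x - I z\<bar> \<le> \<delta>"
    proof -
      have "I x - I z = (LINT y|M. \<phi> k y x - \<phi> k y z)"
        unfolding I_def using integrable_phi(1)[OF x(1), of k] integrable_phi(1)[OF z(1), of k] by simp
      then show ?thesis unfolding \<delta>_def by (simp add: integral_abs_bound)
    qed
    have inv: "\<bar>1 / I x - 1 / I z\<bar> \<le> 4 * \<delta>"
    proof -
      have "1 / I x - 1 / I z = (I z - I x) / (I x * I z)" using ax az by (auto simp: field_simps)
      then have "\<bar>1 / I x - 1 / I z\<bar> = \<bar>I x - I z\<bar> / (I x * I z)" using ax az by (simp add: abs_mult abs_minus_commute)
      also have "\<dots> \<le> \<delta> / ((1 / 2) * (1 / 2))"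
        using Idiff ax az \<delta> by (intro frac_le mult_mono) auto
      finally show ?thesis by simp
    qed
    have le2: "0 < 1 / I x" "1 / I x \<le> 2" "0 < 1 / I z" "1 / I z \<le> 2" using ax az by (auto simp: field_simps)
    have k1: "(\<integral>\<^sup>+y. ennreal \<bar>\<kappa> y\<bar> \<partial>M) \<le> ennreal (8 * \<delta>)"
    proof -
      have "(\<integral>\<^sup>+y. ennreal \<bar>\<kappa> y\<bar> \<partial>M) \<le> (\<integral>\<^sup>+y. ennreal (2 * \<bar>\<phi> k y x - \<phi> k y z\<bar> + 4 * \<delta> * \<phi> k y z) \<partial>M)"
      proof (intro nn_integral_mono_AE eventually_mono[OF AE_phi_nonneg(1)[OF z(1), of k]] ennreal_leI)
        fix y assume p: "0 \<le> \<phi> k y z"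
        have "\<kappa> y = 1 / I x * (\<phi> k y x - \<phi> k y z) + (1 / I x - 1 / I z) * \<phi> k y z"
          by (simp add: \<kappa>_def algebra_simps)
        also have "\<bar>\<dots>\<bar> \<le> 1 / I x * \<bar>\<phi> k y x - \<phi> k y z\<bar> + \<bar>1 / I x - 1 / I z\<bar> * \<phi> k y z"
          using p le2 by (intro order_trans[OF abs_triangle_ineq]) (simp add: abs_mult)
        also have "\<dots> \<le> 2 * \<bar>\<phi> k y x - \<phi> k y z\<bar> + 4 * \<delta> * \<phi> k y z"
          using p le2 inv by (intro add_mono mult_right_mono) auto
        finally show "\<bar>\<kappa> y\<bar> \<le> 2 * \<bar>\<phi> k y x - \<phi> k y z\<bar> + 4 * \<delta> * \<phi> k y z" .
      qed
      also have "\<dots> = ennreal (LINT y|M. 2 * \<bar>\<phi> k y x - \<phi> k y z\<bar> + 4 * \<delta> * \<phi> k y z)"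
        using idiff integrable_phi(1)[OF z(1), of k] AE_phi_nonneg(1)[OF z(1), of k] \<delta>(1)
        by (intro nn_integral_eq_integral) (auto elim!: eventually_mono)
      also have "\<dots> \<le> ennreal (8 * \<delta>)"
      proof (rule ennreal_leI)
        have "(LINT y|M. 2 * \<bar>\<phi> k y x - \<phi> k y z\<bar> + 4 * \<delta> * \<phi> k y z) = 2 * \<delta> + 4 * \<delta> * I z"
          using idiff integrable_phi(1)[OF z(1), of k] by (simp add: \<delta>_def I_def)
        also have "4 * \<delta> * I z \<le> 4 * \<delta> * (3 / 2)" using az \<delta>(1) by (intro mult_left_mono) auto
        finally show "(LINT y|M. 2 * \<bar>\<phi> k y x - \<phi> k y z\<bar> + 4 * \<delta> * \<phi> k y z) \<le> 8 * \<delta>" by simp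
      qed
      finally show ?thesis .
    qed
    have k2: "(\<integral>\<^sup>+y. ennreal \<bar>\<kappa> y\<bar> * ennreal ((b y)\<^sup>2) \<partial>M) \<le> 2 * (U x + U z)"
    proof -
      have "(\<integral>\<^sup>+y. ennreal \<bar>\<kappa> y\<bar> * ennreal ((b y)\<^sup>2) \<partial>M)
          \<le> (\<integral>\<^sup>+y. 2 * (ennreal (\<phi> k y x) * ennreal ((b y)\<^sup>2) + ennreal (\<phi> k y z) * ennreal ((b y)\<^sup>2)) \<partial>M)"
        using AE_phi_nonneg(1)[OF x(1), of k] AE_phi_nonneg(1)[OF z(1), of k]
      proof (intro nn_integral_mono_AE, eventually_elim)
        case (elim y)
        then have p: "0 \<le> \<phi> k y x" "0 \<le> \<phi> k y z" by auto
        have "\<bar>\<kappa> y\<bar> \<le> 1 / I x * \<phi> k y x + 1 / I z * \<phi> k y z"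
          unfolding \<kappa>_def using p le2 by (intro order_trans[OF abs_triangle_ineq4]) (simp add: abs_mult)
        also have "\<dots> \<le> 2 * \<phi> k y x + 2 * \<phi> k y z" using p le2 by (intro add_mono mult_right_mono) auto
        finally have "ennreal \<bar>\<kappa> y\<bar> \<le> ennreal (2 * \<phi> k y x + 2 * \<phi> k y z)" by (rule ennreal_leI)
        also have "\<dots> = 2 * (ennreal (\<phi> k y x) + ennreal (\<phi> k y z))"
          using p by (simp add: ennreal_mult' distrib_left)
        finally have "ennreal \<bar>\<kappa> y\<bar> * ennreal ((b y)\<^sup>2) \<le> 2 * (ennreal (\<phi> k y x) + ennreal (\<phi> k y z)) * ennreal ((b y)\<^sup>2)"
          by (rule mult_right_mono) simp
        then show ?case by (simp add: distrib_left distrib_right mult.assoc)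
      qed
      also have "\<dots> = 2 * (U x + U z)"
        unfolding U_def by (subst nn_integral_cmult, measurable) (subst nn_integral_add, auto)
      finally show ?thesis .
    qed
    have "kop M (KP k) (dP k) b x - kop M (KP k) (dP k) b z = (LINT y|M. \<kappa> y * b y)"
    proof -
      have "integrable M (\<lambda>y. 1 / I x * \<phi> k y x * b y)" "integrable M (\<lambda>y. 1 / I z * \<phi> k y z * b y)"
        using ax az by (auto simp: mult.assoc)
      then show ?thesis using ax az by (simp add: \<kappa>_def left_diff_distrib)
    qed
    then have "ennreal \<bar>kop M (KP k) (dP k) b x - kop M (KP k) (dP k) b z\<bar> \<le> (\<integral>\<^sup>+y. ennreal \<bar>\<kappa> y * b y\<bar> \<partial>M)"
      using integral_norm_bound_ennreal[of M "\<lambda>y. \<kappa> y * b y"]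
      by (cases "integrable M (\<lambda>y. \<kappa> y * b y)") (auto simp: not_integrable_integral_eq)
    also have "\<dots> = (\<integral>\<^sup>+y. ennreal (sqrt \<bar>\<kappa> y\<bar>) * ennreal (sqrt \<bar>\<kappa> y\<bar> * \<bar>b y\<bar>) \<partial>M)"
      by (intro nn_integral_cong) (simp add: abs_mult ennreal_mult[symmetric] flip: mult.assoc)
    finally have "(ennreal \<bar>kop M (KP k) (dP k) b x - kop M (KP k) (dP k) b z\<bar>)\<^sup>2
        \<le> (\<integral>\<^sup>+y. ennreal (sqrt \<bar>\<kappa> y\<bar>) * ennreal (sqrt \<bar>\<kappa> y\<bar> * \<bar>b y\<bar>) \<partial>M)\<^sup>2" by (rule power_mono) simp
    also have "\<dots> \<le> (\<integral>\<^sup>+y. (ennreal (sqrt \<bar>\<kappa> y\<bar>))\<^sup>2 \<partial>M) * (\<integral>\<^sup>+y. (ennreal (sqrt \<bar>\<kappa> y\<bar> * \<bar>b y\<bar>))\<^sup>2 \<partial>M)"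
      by (rule Cauchy_Schwarz_nn_integral) measurable
    also have "\<dots> = (\<integral>\<^sup>+y. ennreal \<bar>\<kappa> y\<bar> \<partial>M) * (\<integral>\<^sup>+y. ennreal \<bar>\<kappa> y\<bar> * ennreal ((b y)\<^sup>2) \<partial>M)"
      by (simp add: ennreal_power power_mult_distrib ennreal_mult)
    also have "\<dots> \<le> ennreal (8 * \<delta>) * (2 * (U x + U z))"
      by (intro mult_mono k1 k2) auto
    also have "\<dots> = ennreal (16 * \<delta>) * (U x + U z)"
    proof -
      have "ennreal (16 * \<delta>) = ennreal (8 * \<delta> * 2)" by (simp add: mult.commute)
      also have "\<dots> = ennreal (8 * \<delta>) * ennreal 2" using \<delta>(1) by (intro ennreal_mult) auto
      finally show ?thesis by (simp add: mult.assoc)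
    qed
    also have "\<dots> \<le> ennreal ?\<omega> * (U x + U z)"
      using \<delta>(2) by (intro mult_right_mono ennreal_leI) auto
    finally show ?thesis by (simp add: ennreal_power)
  qed
qed

definition Cnest :: real where "Cnest = sqrt (16 * (Creg / \<alpha>2) * 1177 * (3 / 2) * 168)"

lemma Cnest_nonneg: "0 \<le> Cnest" using Creg_pos pos by (simp add: Cnest_def)

text \<open>
  With \<open>g = S\<^sub>k f = P b\<close>, where \<open>b = Q f\<close>, the oscillation of \<open>g\<close> at scale \<open>j\<close> is dominated by
  \<open>U x = \<integral> \<phi>\<^sub>y\<^sub>,\<^sub>k(x) b(y)\<^sup>2 d\<mu>(y)\<close>, whose integral is at most a constant times \<open>\<parallel>f\<parallel>\<^sup>2\<close>.
\<close>

lemma S_nested: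
  assumes s: "supp M \<noteq> {}" and f: "in_L2 M f" and kj: "k + 2 \<le> j"
  shows "nrm M (\<lambda>x. S j (S k f) x - S k f x) \<le> Cnest * sqrt ((1 / 2) ^ nat (j - k)) * nrm M f"
proof (cases "nontrivial k")
  case False
  have "S j (\<lambda>x. 0) = (\<lambda>x. 0)"
    by (cases "nontrivial j") (simp_all add: S_op_trivial s S_op_eq_kop kop_def[abs_def])
  then show ?thesis
    using False Cnest_nonneg by (simp add: S_op_trivial s nrm_def ip_def)
next
  case True
  interpret P: positive_kernel M "KP k" "dP k" "supp M" 1 7 by (rule positive_kernel_P)
  interpret Q: positive_kernel M "KQ k" "dQ k" "supp M" 1 168 by (rule positive_kernel_Q[OF True])
  have j1: "nontrivial (j - 1)" using nontrivial_mono[OF True] kj by simp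
  define b where "b = kop M (KQ k) (dQ k) f"
  have b: "in_L2 M b" unfolding b_def by (rule Q.in_L2_kop[OF f])
  then have [measurable]: "b \<in> borel_measurable M" by (simp add: in_L2_def)
  note [measurable (raw)] = phi_measurable_comp[of _ _ _ k]
  let ?U = "\<lambda>x. \<integral>\<^sup>+y. ennreal (\<phi> k y x) * ennreal ((b y)\<^sup>2) \<partial>M"
  let ?\<omega> = "16 * (Creg / \<alpha>2) / 2 ^ nat (j - k)"
  have "L2_sq M (\<lambda>x. S j (S k f) x - S k f x) \<le> ennreal ?\<omega> * 1177 * (\<integral>\<^sup>+x. ?U x \<partial>M)"
  proof (rule oscillation_bound[OF s j1 S_L2[OF s f]])
    show "?U \<in> borel_measurable M" by measurable
    show "ennreal ((S k f x - S k f z)\<^sup>2) \<le> ennreal ?\<omega> * (?U x + ?U z)"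
      if "generation M n e1 A R (Transit c l) (j - 1)" "x \<in> supp M" "z \<in> supp M"
        "x \<in> cube_set (Transit c l)" "z \<in> cube_set (Transit c l)" for c l x z
      using range_oscillation[OF True kj that(1,2,4,3,5) b] by (simp add: S_op_eq_kop[OF s True] b_def)
  qed
  also have "\<dots> \<le> ennreal ?\<omega> * 1177 * (ennreal (3 / 2) * (ennreal 168 * L2_sq M f))"
  proof (rule mult_left_mono)
    interpret pair_sigma_finite M M ..
    have "(\<integral>\<^sup>+x. ?U x \<partial>M) = (\<integral>\<^sup>+y. \<integral>\<^sup>+x. ennreal (\<phi> k y x) * ennreal ((b y)\<^sup>2) \<partial>M \<partial>M)"
      by (rule Fubini') measurable
    also have "\<dots> = (\<integral>\<^sup>+y. (\<integral>\<^sup>+x. ennreal (\<phi> k y x) \<partial>M) * ennreal ((b y)\<^sup>2) \<partial>M)"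
      by (intro nn_integral_cong nn_integral_multc) measurable
    also have "\<dots> \<le> (\<integral>\<^sup>+y. ennreal (3 / 2) * ennreal ((b y)\<^sup>2) \<partial>M)"
      by (intro nn_integral_mono_AE eventually_mono[OF AE_in_supp] mult_right_mono conjunct1[OF phi_le]) auto
    also have "\<dots> = ennreal (3 / 2) * L2_sq M b"
      unfolding L2_sq_def by (rule nn_integral_cmult) measurable
    also have "\<dots> \<le> ennreal (3 / 2) * (ennreal 168 * L2_sq M f)"
      using Q.L2_sq_kop_le[OF f] by (intro mult_left_mono) (auto simp: b_def)
    finally show "(\<integral>\<^sup>+x. ?U x \<partial>M) \<le> ennreal (3 / 2) * (ennreal 168 * L2_sq M f)" .
  qed simp
  also have "\<dots> = ennreal (?\<omega> * 1177 * (3 / 2) * 168) * L2_sq M f"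
  proof -
    have "0 \<le> ?\<omega>" using Creg_pos pos by simp
    then have "ennreal (?\<omega> * 1177 * (3 / 2) * 168) = ennreal ?\<omega> * ennreal 1177 * ennreal (3 / 2) * ennreal 168"
      by (subst ennreal_mult[symmetric]; (subst ennreal_mult[symmetric])?; (subst ennreal_mult[symmetric])?; simp)
    then show ?thesis by (simp add: mult.assoc)
  qed
  finally have main: "L2_sq M (\<lambda>x. S j (S k f) x - S k f x) \<le> ennreal (?\<omega> * 1177 * (3 / 2) * 168) * L2_sq M f" .
  show ?thesis
  proof (rule L2_sq_le_nrm[OF _ f main])
    show "in_L2 M (\<lambda>x. S j (S k f) x - S k f x)" using f by (intro in_L2_diff S_L2 s)
    have "(Cnest * sqrt ((1 / 2) ^ nat (j - k)))\<^sup>2 = ?\<omega> * 1177 * (3 / 2) * 168"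
      using Creg_pos pos by (simp add: Cnest_def power_mult_distrib power_divide)
    then show "?\<omega> * 1177 * (3 / 2) * 168 \<le> (Cnest * sqrt ((1 / 2) ^ nat (j - k)))\<^sup>2" by simp
  qed (use Creg_pos pos Cnest_nonneg in auto)
qed

section \<open>Convergence at both ends\<close>

lemma finite_measure_bounded:
  assumes "bounded K"
  obtains B V where "B \<in> sets M" "K \<subseteq> B" "emeasure M B = ennreal V" "0 \<le> V"
proof -
  obtain r where "\<And>x. x \<in> K \<Longrightarrow> norm x \<le> r" using assms by (auto simp: bounded_iff)
  then have r: "K \<subseteq> cball 0 r" by auto
  have "emeasure M (cball 0 r) < \<infinity>" by (rule finite_compact) simp
  then obtain V where "emeasure M (cball 0 r) = ennreal V" "0 \<le> V"
    by (cases "emeasure M (cball 0 r)") auto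
  then show ?thesis using that[of "cball 0 r" V] r by (simp add: sets_M)
qed

text \<open>
  For a Lipschitz function \<open>f\<close> of bounded support the oscillation at scale \<open>i\<close> tends to \<open>0\<close> uniformly,
  because cubes of high generation that meet the support are small.
\<close>

lemma S_top:
  assumes s: "supp M \<noteq> {}" and f: "in_L2 M f"
  shows "(\<lambda>i. nrm M (\<lambda>x. S (int i) f x - f x)) \<longlonglongrightarrow> 0"
proof -
  have "(\<lambda>i. nrm M (\<lambda>x. S (int i) f x - 1 * f x)) \<longlonglongrightarrow> 0"
    using S_L2[OF s] S_selfadjoint[OF s] S_bounded[OF s] _ _ f
  proof (rule strong_limit_by_density)
    fix f L K
    assume f: "in_L2 M f" and K: "bounded K" "\<And>x. x \<notin> K \<Longrightarrow> f x = 0"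
      and Lip: "\<And>x y. \<bar>f x - f y\<bar> \<le> L * dist x y"
    obtain B V where B: "B \<in> sets M" "K \<subseteq> B" "emeasure M B = ennreal V" "0 \<le> V"
      by (rule finite_measure_bounded[OF K(1)])
    define a where "a = max L 0 * sdim"
    have a: "0 \<le> a" using sdim(1) by (simp add: a_def)
    have "(\<lambda>i. nrm M (\<lambda>x. S (int i) f x - f x)) \<longlonglongrightarrow> 0"
    proof (rule LIMSEQ_I)
      fix r :: real assume r: "0 < r"
      define \<eta> where "\<eta> = r / (2 * (1 + a * sqrt (1177 * V)))"
      have den: "0 < 1 + a * sqrt (1177 * V)" using a B by (simp add: add_pos_nonneg)
      have \<eta>: "0 < \<eta>" using r den by (simp add: \<eta>_def)
      have small: "a * \<eta> * sqrt (1177 * V) < r"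
      proof -
        have "a * \<eta> * sqrt (1177 * V) \<le> (1 + a * sqrt (1177 * V)) * \<eta>" using \<eta> by (simp add: algebra_simps)
        also have "\<dots> = r / 2"
        proof -
          have "D * (r / (2 * D)) = r / 2" if "0 < D" for D :: real using that by simp
          then show ?thesis unfolding \<eta>_def using den by blast
        qed
        finally show ?thesis using r by simp
      qed
      obtain J where J: "\<And>j z l. J \<le> j \<Longrightarrow> generation M n e1 A R (Transit z l) j \<Longrightarrow>
          cube_set (Transit z l) \<inter> K \<noteq> {} \<Longrightarrow> l \<le> \<eta>"
        using high_generation_small[OF K(1) \<eta>] by metis
      show "\<exists>i0. \<forall>i\<ge>i0. norm (nrm M (\<lambda>x. S (int i) f x - f x) - 0) < r"
      proof (intro exI[of _ "nat (max 2 (J + 1))"] allI impI)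
        fix i assume "nat (max 2 (J + 1)) \<le> i"
        then have i: "J \<le> int i - 1" "nontrivial (int i - 1)" by (auto simp: nontrivial_def)
        have "L2_sq M (\<lambda>x. S (int i) f x - f x) \<le> ennreal ((a * \<eta>)\<^sup>2) * 1177 * (\<integral>\<^sup>+x. indicator B x \<partial>M)"
        proof (rule oscillation_bound[OF s i(2) f])
          show "(\<lambda>x. indicator B x :: ennreal) \<in> borel_measurable M" using B by measurable
          fix c l x z
          assume gen: "generation M n e1 A R (Transit c l) (int i - 1)"
            and x: "x \<in> cube_set (Transit c l)" and z: "z \<in> cube_set (Transit c l)"
          show "ennreal ((f x - f z)\<^sup>2) \<le> ennreal ((a * \<eta>)\<^sup>2) * (indicator B x + indicator B z)"
          proof (cases "x \<in> K \<or> z \<in> K")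
            case True
            then have l: "l \<le> \<eta>" using J[OF i(1) gen] x z by auto
            have "infnorm (x - z) \<le> l"
              using infnorm_dist_triangle[of x z c] x z by (simp add: mem_cube infnorm_dist_commute[of c])
            then have "sdim * infnorm (x - z) \<le> sdim * \<eta>" using l sdim(1) by (intro mult_left_mono) auto
            then have d: "dist x z \<le> sdim * \<eta>" using sdim(2)[of "x - z"] by (simp add: dist_norm)
            have "\<bar>f x - f z\<bar> \<le> max L 0 * dist x z"
              using Lip[of x z] mult_right_mono[of L "max L 0" "dist x z"] by simp
            also have "\<dots> \<le> max L 0 * (sdim * \<eta>)" using d by (intro mult_left_mono) auto
            finally have "\<bar>f x - f z\<bar> \<le> \<bar>a * \<eta>\<bar>" by (simp add: a_def mult.assoc)
            then have "ennreal ((f x - f z)\<^sup>2) \<le> ennreal ((a * \<eta>)\<^sup>2) * 1"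
              by (simp add: abs_le_square_iff ennreal_leI)
            also have "\<dots> \<le> ennreal ((a * \<eta>)\<^sup>2) * (indicator B x + indicator B z)"
              using True B by (intro mult_left_mono) (auto simp: indicator_def)
            finally show ?thesis .
          qed (simp add: K)
        qed
        also have "\<dots> = ennreal ((a * \<eta>)\<^sup>2) * ennreal 1177 * ennreal V" using B by simp
        also have "\<dots> = ennreal ((a * \<eta>)\<^sup>2 * 1177 * V)" 
        proof -
          have "ennreal ((a * \<eta>)\<^sup>2) * ennreal 1177 = ennreal ((a * \<eta>)\<^sup>2 * 1177)"
            by (rule ennreal_mult[symmetric]) auto
          then show ?thesis using B(4) by (simp only:) (rule ennreal_mult[symmetric], auto)
        qed
        also have "(a * \<eta>)\<^sup>2 * 1177 * V = (a * \<eta> * sqrt (1177 * V))\<^sup>2"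
          using B(4) by (simp add: power_mult_distrib)
        finally have "ennreal ((nrm M (\<lambda>x. S (int i) f x - f x))\<^sup>2) \<le> ennreal ((a * \<eta> * sqrt (1177 * V))\<^sup>2)"
          using S_L2[OF s f] f by (simp add: L2_sq_eq_nrm in_L2_diff)
        then have "nrm M (\<lambda>x. S (int i) f x - f x) \<le> a * \<eta> * sqrt (1177 * V)"
          using a \<eta> B(4) by (subst (asm) ennreal_le_iff) (auto intro: power2_le_imp_le)
        then show "norm (nrm M (\<lambda>x. S (int i) f x - f x) - 0) < r" using small by simp
      qed
    qed
    then show "(\<lambda>i. nrm M (\<lambda>x. S (int i) f x - 1 * f x)) \<longlonglongrightarrow> 0" by simp
  qed auto
  then show ?thesis by simp
qed

text \<open>
  For \<open>k\<close> far below the generation of a reference cube that contains the support of \<open>f\<close>, the values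
  \<open>\<phi>\<^sub>y\<^sub>,\<^sub>k(z)\<close> at points \<open>z\<close> of this cube are small, while their integrals stay bounded.
\<close>

lemma S_bot_bound:
  assumes s: "supp M \<noteq> {}" and ni: "\<not> initial M n" and f: "in_L2 M f"
    and Ri: "R i0 = Transit zR l" and f0: "\<And>x. x \<notin> cube_set (R i0) \<Longrightarrow> f x = 0" and f1: "\<And>x. \<bar>f x\<bar> \<le> 1"
    and V: "emeasure M (cube_set (R i0)) = ennreal V" "0 \<le> V"
  defines "H \<equiv> \<lambda>p. max 4 (4 powr n) * (2 ^ (p + 2) * l / 4) powr (- n) / \<alpha>2"
  shows "(nrm M (S (- int (p + (i0 + 1))) f))\<^sup>2 \<le> 7 * (96\<^sup>2 * (H p * V) * (3 / 2 * V))"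
proof -
  let ?B = "cube_set (R i0)"
  define k where "k = - int (p + (i0 + 1))"
  define j where "j = 1 - int i0"
  have nt: "nontrivial i" for i using ni by (simp add: nontrivial_def)
  have kj: "k + 2 \<le> j" "nat (j - k) = p + 2" by (auto simp: k_def j_def)
  have gen: "generation M n e1 A R (Transit zR l) (j - 1)"
    using reference_generation[OF ni, of i0] Ri by (simp add: j_def)
  have l: "0 < l" using generation_cube[OF gen] by simp
  have H0: "0 \<le> H p" using pos by (simp add: H_def)
  interpret P: positive_kernel M "KP k" "dP k" "supp M" 1 7 by (rule positive_kernel_P)
  interpret Q: positive_kernel M "KQ k" "dQ k" "supp M" 1 168 by (rule positive_kernel_Q[OF nt])
  interpret pair_sigma_finite M M ..
  note [measurable (raw)] = phi_measurable_comp[of _ _ _ k]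
  have [measurable]: "f \<in> borel_measurable M" using f by (simp add: in_L2_def)
  define b where "b = kop M (KQ k) (dQ k) f"
  have b: "in_L2 M b" unfolding b_def by (rule Q.in_L2_kop[OF f])
  define N where "N y = (\<integral>\<^sup>+z. ennreal (\<phi> k y z) * indicator ?B z \<partial>M)" for y
  have [measurable]: "N \<in> borel_measurable M" unfolding N_def by measurable
  have bN: "ennreal \<bar>b y\<bar> \<le> ennreal 96 * N y" if y: "y \<in> supp M" for y
  proof -
    \<comment> \<open>Points of the support of \<open>f\<close> lie in a transit cube of generation \<open>k\<close>.\<close>
    have d: "dQ k y * f y = 0"
    proof (cases "y \<in> ?B")
      case True
      have "y \<in> cube_set (R (p + (i0 + 1)))" using True reference_level(2)[OF ni, of i0 "p + (i0 + 1)"] by auto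
      moreover obtain z' l' where "R (p + (i0 + 1)) = Transit z' l'" using reference_cubes_exhaust[OF ni] by metis
      ultimately have "ennreal (1 / 2) \<le> (\<integral>\<^sup>+x. ennreal (\<phi> k x y) \<partial>M)"
        using reference_generation[OF ni, of "p + (i0 + 1)"] phi_ge[OF y, of z' l' k] by (auto simp: k_def)
      then have "1 / 2 \<le> (LINT x|M. \<phi> k x y)"
        unfolding nn_integral_phi[OF y] using LINT_phi_bounds[OF y, of k] by (subst (asm) ennreal_le_iff) auto
      then show ?thesis by (simp add: dQ_def h_def)
    qed (simp add: f0)
    have "ennreal \<bar>b y\<bar> \<le> (\<integral>\<^sup>+z. ennreal \<bar>KQ k y z * f z\<bar> \<partial>M)"
      using integral_norm_bound_ennreal[of M "\<lambda>z. KQ k y z * f z"]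
      by (cases "integrable M (\<lambda>z. KQ k y z * f z)") (auto simp: not_integrable_integral_eq b_def kop_def d)
    also have "\<dots> \<le> (\<integral>\<^sup>+z. ennreal 96 * (ennreal (\<phi> k y z) * indicator ?B z) \<partial>M)"
      using AE_in_supp
    proof (intro nn_integral_mono_AE, eventually_elim)
      case (elim z)
      show ?case
      proof (cases "z \<in> ?B")
        case True
        have p: "0 \<le> \<phi> k y z" by (rule phi_nonneg[OF y])
        have "\<bar>KQ k y z * f z\<bar> \<le> w k y * \<phi> k y z * m k z * 1"
          using p w_bounds[OF y nt, of k] m_bounds[OF elim(2), of k] f1[of z]
          unfolding KQ_def abs_mult by (intro mult_mono) auto
        also have "\<dots> \<le> 24 * \<phi> k y z * 4 * 1"
          using p w_bounds[OF y nt, of k] m_bounds[OF elim(2), of k] by (intro mult_mono mult_right_mono) auto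
        finally have "ennreal \<bar>KQ k y z * f z\<bar> \<le> ennreal (96 * \<phi> k y z)" by (intro ennreal_leI) simp
        then show ?thesis using True p by (simp add: ennreal_mult)
      qed (simp add: f0)
    qed
    also have "\<dots> = ennreal 96 * N y" unfolding N_def by (rule nn_integral_cmult) measurable
    finally show ?thesis .
  qed
  have NH: "N y \<le> ennreal (H p * V)" if y: "y \<in> supp M" for y
  proof -
    have "N y \<le> (\<integral>\<^sup>+z. ennreal (H p) * indicator ?B z \<partial>M)"
      unfolding N_def
    proof (intro nn_integral_mono)
      fix z
      show "ennreal (\<phi> k y z) * indicator ?B z \<le> ennreal (H p) * indicator ?B z"
      proof (cases "z \<in> ?B")
        case True
        then have "\<psi> k y z \<le> max 4 (4 powr n) * (2 ^ (p + 2) * l / 4) powr (- n)"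
          using early_aux_cube_large_or_far[OF y nt kj(1) gen, of z] l Ri kj
          by (intro psi_height_le[OF y]) auto
        then have "\<phi> k y z \<le> H p" unfolding phi_psi H_def using pos by (intro divide_right_mono) auto
        then show ?thesis by (intro mult_right_mono ennreal_leI) auto
      qed simp
    qed
    also have "\<dots> = ennreal (H p) * ennreal V" using V by (simp add: nn_integral_cmult_indicator)
    also have "\<dots> = ennreal (H p * V)" using H0 V by (simp add: ennreal_mult)
    finally show ?thesis .
  qed
  have intN: "(\<integral>\<^sup>+y. N y \<partial>M) \<le> ennreal (3 / 2 * V)"
  proof -
    have "(\<integral>\<^sup>+y. N y \<partial>M) = (\<integral>\<^sup>+z. \<integral>\<^sup>+y. ennreal (\<phi> k y z) * indicator ?B z \<partial>M \<partial>M)"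
      unfolding N_def by (rule Fubini') measurable
    also have "\<dots> = (\<integral>\<^sup>+z. (\<integral>\<^sup>+y. ennreal (\<phi> k y z) \<partial>M) * indicator ?B z \<partial>M)"
      by (intro nn_integral_cong nn_integral_multc) measurable
    also have "\<dots> \<le> (\<integral>\<^sup>+z. ennreal (3 / 2) * indicator ?B z \<partial>M)"
      by (intro nn_integral_mono_AE eventually_mono[OF AE_in_supp] mult_right_mono conjunct2[OF phi_le]) auto
    also have "\<dots> = ennreal (3 / 2) * ennreal V" using V by (simp add: nn_integral_cmult_indicator)
    also have "\<dots> = ennreal (3 / 2 * V)" using V(2) by (intro ennreal_mult[symmetric]) auto
    finally show ?thesis .
  qed
  have "L2_sq M b \<le> (\<integral>\<^sup>+y. ennreal (96\<^sup>2 * (H p * V)) * N y \<partial>M)"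
    unfolding L2_sq_def using AE_in_supp
  proof (intro nn_integral_mono_AE, eventually_elim)
    case (elim y)
    have "ennreal ((b y)\<^sup>2) = ennreal \<bar>b y\<bar> * ennreal \<bar>b y\<bar>" by (simp add: power2_eq_square flip: ennreal_mult)
    also have "\<dots> \<le> (ennreal 96 * ennreal (H p * V)) * (ennreal 96 * N y)"
      using bN[OF elim(2)] NH[OF elim(2)]
      by (intro mult_mono order_trans[OF bN[OF elim(2)]] mult_left_mono) auto
    also have "\<dots> = (ennreal 96 * ennreal 96 * ennreal (H p * V)) * N y" by (simp add: ac_simps)
    also have "ennreal 96 * ennreal 96 * ennreal (H p * V) = ennreal (96\<^sup>2 * (H p * V))"
    proof -
      have "ennreal 96 * ennreal 96 = ennreal (96\<^sup>2)" by (subst ennreal_mult[symmetric]) auto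
      then show ?thesis using H0 V(2) by (simp only:) (rule ennreal_mult[symmetric], auto)
    qed
    finally show ?case .
  qed
  also have "\<dots> = ennreal (96\<^sup>2 * (H p * V)) * (\<integral>\<^sup>+y. N y \<partial>M)" by (rule nn_integral_cmult) measurable
  also have "\<dots> \<le> ennreal (96\<^sup>2 * (H p * V)) * ennreal (3 / 2 * V)" using intN by (rule mult_left_mono) simp
  also have "\<dots> = ennreal (96\<^sup>2 * (H p * V) * (3 / 2 * V))" using H0 V(2) by (intro ennreal_mult[symmetric]) auto
  finally have Lb: "L2_sq M b \<le> ennreal (96\<^sup>2 * (H p * V) * (3 / 2 * V))" .
  have "L2_sq M (S k f) \<le> ennreal (1 * 7) * L2_sq M b"
    unfolding S_op_eq_kop[OF s nt] b_def[symmetric] by (rule P.L2_sq_kop_le[OF b])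
  also have "\<dots> \<le> ennreal (1 * 7) * ennreal (96\<^sup>2 * (H p * V) * (3 / 2 * V))" using Lb by (rule mult_left_mono) simp
  also have "\<dots> = ennreal (1 * 7 * (96\<^sup>2 * (H p * V) * (3 / 2 * V)))"
    using H0 V(2) by (intro ennreal_mult[symmetric]) auto
  finally have "ennreal ((nrm M (S k f))\<^sup>2) \<le> ennreal (1 * 7 * (96\<^sup>2 * (H p * V) * (3 / 2 * V)))"
    using S_L2[OF s f] by (simp add: L2_sq_eq_nrm)
  then show ?thesis
    using H0 V(2) by (subst (asm) ennreal_le_iff) (auto simp: k_def)
qed

text \<open>
  If the whole space is initial, \<open>S\<^sub>k = 0\<close> for \<open>k \<le> 0\<close>.  Otherwise the previous bound tends to \<open>0\<close>.
\<close>

lemma S_bot: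
  assumes s: "supp M \<noteq> {}" and f: "in_L2 M f"
  shows "(\<lambda>i. nrm M (S (- int i) f)) \<longlonglongrightarrow> 0"
proof (cases "initial M n")
  case True
  then have "S (- int i) f = (\<lambda>x. 0)" for i by (intro S_op_trivial s) (simp add: nontrivial_def)
  then show ?thesis by (simp add: nrm_def ip_def)
next
  case ni: False
  have "(\<lambda>i. nrm M (\<lambda>x. S (- int i) f x - 0 * f x)) \<longlonglongrightarrow> 0"
    using S_L2[OF s] S_selfadjoint[OF s] S_bounded[OF s] _ _ f
  proof (rule strong_limit_by_density)
    fix f L K
    assume f: "in_L2 M f" and K: "bounded K" "\<And>x. x \<notin> K \<Longrightarrow> f x = 0" and f1: "\<And>x. \<bar>f x\<bar> \<le> 1"
    obtain T c where T: "top_cube T c" "K \<subseteq> cube_set T" by (rule top_cube_covers[OF K(1)])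
    then obtain i0 where i0: "T = R i0" using ni by (auto simp: top_cube_def)
    obtain zR l where Ri: "R i0 = Transit zR l" "0 < l" using reference_cubes_exhaust[OF ni] by metis
    have "emeasure M (cube_set (R i0)) < \<infinity>" unfolding Ri by (rule finite_compact[OF compact_cube])
    then obtain V where V: "emeasure M (cube_set (R i0)) = ennreal V" "0 \<le> V"
      by (cases "emeasure M (cube_set (R i0))") auto
    define G where "G p = 7 * (96\<^sup>2 * ((max 4 (4 powr n) * (2 ^ (p + 2) * l / 4) powr (- n) / \<alpha>2) * V) * (3 / 2 * V))" for p :: nat
    have le: "nrm M (S (- int (p + (i0 + 1))) f) \<le> sqrt (G p)" for p
    proof (rule real_le_rsqrt)
      have "f x = 0" if "x \<notin> cube_set (R i0)" for x using that T(2) i0 K(2)[of x] by auto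
      then show "(nrm M (S (- int (p + (i0 + 1))) f))\<^sup>2 \<le> G p"
        unfolding G_def by (rule S_bot_bound[OF s ni f Ri(1) _ f1 V])
    qed
    have "filterlim (\<lambda>p. (2::real) ^ p) at_top sequentially"
      using filterlim_realpow_sequentially_gt1[of "2::real"] by (simp add: filterlim_at_infinity_imp_filterlim_at_top)
    then have lim2: "filterlim (\<lambda>p. l * 2 ^ p) at_top sequentially"
      using Ri(2) by (intro filterlim_tendsto_pos_mult_at_top[OF tendsto_const])
    have "(\<lambda>p. (l * 2 ^ p) powr (- n)) \<longlonglongrightarrow> 0"
      using n_pos by (intro tendsto_neg_powr lim2) auto
    then have "(\<lambda>p. 7 * (96\<^sup>2 * ((max 4 (4 powr n) * (l * 2 ^ p) powr (- n) / \<alpha>2) * V) * (3 / 2 * V))) \<longlonglongrightarrow>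
        7 * (96\<^sup>2 * ((max 4 (4 powr n) * 0 / \<alpha>2) * V) * (3 / 2 * V))"
      using pos by (intro tendsto_intros) auto
    moreover have e: "2 ^ (p + 2) * l / 4 = l * 2 ^ p" for p :: nat by (simp add: mult.commute)
    ultimately have "G \<longlonglongrightarrow> 0" unfolding G_def e by simp
    then have "(\<lambda>p. sqrt (G p)) \<longlonglongrightarrow> sqrt 0" by (rule tendsto_real_sqrt)
    then have "(\<lambda>p. sqrt (G p)) \<longlonglongrightarrow> 0" by simp
    then have "(\<lambda>p. nrm M (S (- int (p + (i0 + 1))) f)) \<longlonglongrightarrow> 0"
      by (rule tendsto_sandwich[OF always_eventually always_eventually tendsto_const, rotated -1])
         (use le in auto)
    then have "(\<lambda>i. nrm M (S (- int i) f)) \<longlonglongrightarrow> 0" by (rule LIMSEQ_offset)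
    then show "(\<lambda>i. nrm M (\<lambda>x. S (- int i) f x - 0 * f x)) \<longlonglongrightarrow> 0" by simp
  qed auto
  then show ?thesis by simp
qed

section \<open>The theorem\<close>

lemma square_function_estimate:
  "\<exists>C>0. \<forall>f. in_L2 M f \<longrightarrow>
    ennreal (1 / C) * (\<Sum>\<^sub>\<infinity>k\<in>UNIV. L2_sq M (D_op M Q \<phi> k f)) \<le> L2_sq M f \<and>
    L2_sq M f \<le> ennreal C * (\<Sum>\<^sub>\<infinity>k\<in>UNIV. L2_sq M (D_op M Q \<phi> k f))"
proof (cases "supp M = {}")
  case True
  have "L2_sq M g = 0" for g
  proof -
    have "AE x in M. ennreal ((g x)\<^sup>2) = 0" by (rule eventually_mono[OF AE_in_supp]) (simp add: True)
    then show ?thesis unfolding L2_sq_def by (simp add: nn_integral_cong_AE[of _ "\<lambda>_. 0"])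
  qed
  then show ?thesis by (intro exI[of _ 1]) simp
next
  case s: False
  \<comment> \<open>Nestedness holds with decay \<open>2\<^sup>-\<^sup>(\<^sup>j\<^sup>-\<^sup>k\<^sup>)\<^sup>/\<^sup>2\<close>, which is to be \<open>\<theta>\<close> to the power \<open>8 (j - k)\<close>.\<close>
  define \<theta> :: real where "\<theta> = root 16 (1 / 2)"
  have \<theta>: "0 < \<theta>" "\<theta> < 1" by (auto simp: \<theta>_def)
  have "\<theta> ^ 16 = 1 / 2" unfolding \<theta>_def by (subst real_root_pow_pos) auto
  then have "(\<theta> ^ 8)\<^sup>2 = 1 / 2" by (simp flip: power_mult)
  then have sq: "sqrt (1 / 2) = \<theta> ^ 8" using \<theta> by (intro real_sqrt_unique) auto
  then have root: "sqrt ((1 / 2) ^ p) = \<theta> ^ (8 * p)" for p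
    by (simp only: real_sqrt_power sq power_mult)
  interpret almost_nested_projections M S 35 Cnest \<theta>
    by unfold_locales
       (use S_L2[OF s] S_selfadjoint[OF s] S_bounded[OF s] S_nested[OF s] S_top[OF s] S_bot[OF s]
          Cnest_nonneg \<theta> root in auto)
  have D: "D k f = D_op M Q \<phi> k f" for k f by (simp add: D_def D_op_def)
  obtain C where C: "0 < C"
    "\<And>f F. in_L2 M f \<Longrightarrow> finite F \<Longrightarrow> (\<Sum>k\<in>F. (nrm M (D k f))\<^sup>2) \<le> C * (nrm M f)\<^sup>2"
    "\<And>f b. in_L2 M f \<Longrightarrow> (\<And>F. finite F \<Longrightarrow> (\<Sum>k\<in>F. (nrm M (D k f))\<^sup>2) \<le> b) \<Longrightarrow> (nrm M f)\<^sup>2 \<le> C * b"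
    using square_function_equivalence by metis
  show ?thesis
  proof (intro exI[of _ C] conjI allI impI C(1))
    fix f assume f: "in_L2 M f"
    let ?t = "\<lambda>k. L2_sq M (D_op M Q \<phi> k f)"
    have t: "?t k = ennreal ((nrm M (D k f))\<^sup>2)" for k
      using D_L2[OF f, of k] by (simp add: L2_sq_eq_nrm flip: D)
    have fin: "sum ?t F = ennreal (\<Sum>k\<in>F. (nrm M (D k f))\<^sup>2)" for F
      unfolding t by (rule sum_ennreal) simp
    have summ: "?t summable_on UNIV" by (rule nonneg_summable_on_complete) simp
    have upper: "infsum ?t UNIV \<le> ennreal (C * (nrm M f)\<^sup>2)"
      by (rule infsum_le_finite_sums[OF summ]) (auto simp: fin intro!: ennreal_leI C(2) f)
    have "ennreal (1 / C) * infsum ?t UNIV \<le> ennreal (1 / C) * ennreal (C * (nrm M f)\<^sup>2)"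
      using upper by (rule mult_left_mono) simp
    also have "\<dots> = ennreal (1 / C * (C * (nrm M f)\<^sup>2))"
      using C(1) by (intro ennreal_mult[symmetric]) auto
    also have "\<dots> = L2_sq M f" using C(1) by (simp add: L2_sq_eq_nrm[OF f])
    finally show "ennreal (1 / C) * infsum ?t UNIV \<le> L2_sq M f" .
    have "infsum ?t UNIV < top" using upper by (rule order.strict_trans1) simp
    then obtain b where b: "infsum ?t UNIV = ennreal b" "0 \<le> b" by (cases "infsum ?t UNIV") auto
    have "(\<Sum>k\<in>F. (nrm M (D k f))\<^sup>2) \<le> b" if "finite F" for F
    proof -
      have "sum ?t F \<le> infsum ?t UNIV"
        using that by (subst nonneg_infsum_complete) (auto intro: SUP_upper)
      then show ?thesis unfolding fin b(1) using b(2) by simp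
    qed
    then have "(nrm M f)\<^sup>2 \<le> C * b" by (rule C(3)[OF f])
    then have "L2_sq M f \<le> ennreal (C * b)" by (simp add: L2_sq_eq_nrm[OF f] ennreal_leI)
    also have "\<dots> = ennreal C * infsum ?t UNIV" using C(1) b by (simp add: ennreal_mult)
    finally show "L2_sq M f \<le> ennreal C * infsum ?t UNIV" .
  qed
qed

end

theorem theorem6p2:
  fixes n C0 C7 e0 e1 g0 :: real
  assumes n: "0 < n" "n \<le> real DIM('a::euclidean_space)"
    and C0: "0 < C0"
    and C7: "0 < C7"
    and e0: "\<And>M :: 'a measure. growth_measure M n C0 \<Longrightarrow> delta_additive M n e0"
    and e1: "e0 \<le> e1"
      "\<And>M :: 'a measure. growth_measure M n C0 \<Longrightarrow> doubling_cubes_exist M n g0 e1"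
  shows "\<exists>a1>0. \<forall>\<alpha>1\<ge>a1. \<exists>a2>0. \<forall>\<alpha>2\<ge>a2. \<exists>A0>0. \<forall>A\<ge>A0.
    \<forall>(M :: 'a measure) R Q Qa \<psi> \<phi>.
      approximation_of_identity M n C0 e0 e1 \<alpha>1 \<alpha>2 A C7 R Q Qa \<psi> \<phi> \<longrightarrow>
      (\<exists>C>0. \<forall>f. in_L2 M f \<longrightarrow>
        ennreal (1 / C) * (\<Sum>\<^sub>\<infinity>k\<in>UNIV. L2_sq M (D_op M Q \<phi> k f)) \<le> L2_sq M f \<and>
        L2_sq M f \<le> ennreal C * (\<Sum>\<^sub>\<infinity>k\<in>UNIV. L2_sq M (D_op M Q \<phi> k f)))"
proof -
  define \<kappa> where "\<kappa> = 4 powr n * C0"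
  define a2 where "a2 = max 1 (16 * (sigma n C0 e0 e1 + 50 * e1 + 10 * \<kappa> + 1))"
  define A0 where "A0 \<alpha>1 \<alpha>2 = nat \<lceil>10 * \<kappa> + 100 * e1 + \<alpha>1 + \<alpha>2 + 3 * sigma n C0 e0 e1 + 1\<rceil> + 1"
    for \<alpha>1 \<alpha>2
  have main: "\<exists>C>0. \<forall>f. in_L2 M f \<longrightarrow>
        ennreal (1 / C) * (\<Sum>\<^sub>\<infinity>k\<in>UNIV. L2_sq M (D_op M Q \<phi> k f)) \<le> L2_sq M f \<and>
        L2_sq M f \<le> ennreal C * (\<Sum>\<^sub>\<infinity>k\<in>UNIV. L2_sq M (D_op M Q \<phi> k f))"
    if \<alpha>2: "a2 \<le> \<alpha>2" and A: "A0 \<alpha>1 \<alpha>2 \<le> A"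
      and ap: "approximation_of_identity M n C0 e0 e1 \<alpha>1 \<alpha>2 A C7 R Q Qa \<psi> \<phi>"
    for \<alpha>1 \<alpha>2 A R Q Qa \<psi> \<phi> and M :: "'a measure"
  proof -
    interpret approximation_of_identity M n C0 e0 e1 \<alpha>1 \<alpha>2 A C7 R Q Qa \<psi> \<phi> by (rule ap)
    interpret large_parameters M n C0 e0 e1 \<alpha>1 \<alpha>2 A C7 R Q Qa \<psi> \<phi>
    proof
      show "delta_additive M n e0" by (rule e0) unfold_locales
      show "10 * kappa + 100 * e1 + \<alpha>1 + \<alpha>2 + 3 * sigma n C0 e0 e1 + 1 \<le> real A"
        using A unfolding kappa_def \<kappa>_def A0_def by linarith
      show "16 * (sigma n C0 e0 e1 + 50 * e1 + 10 * kappa + 1) \<le> \<alpha>2"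
        using \<alpha>2 unfolding kappa_def \<kappa>_def a2_def by simp
    qed (use n C0 C7 e1 in auto)
    show ?thesis by (rule square_function_estimate)
  qed
  have pos: "0 < a2" "0 < A0 \<alpha>1 \<alpha>2" for \<alpha>1 \<alpha>2 by (simp_all add: a2_def A0_def)
  show ?thesis
    by (rule exI[of _ 1], rule conjI, rule zero_less_one, intro allI impI,
        rule exI[of _ a2], rule conjI, rule pos, intro allI impI,
        rule exI[of _ "A0 _ _"], rule conjI, rule pos, intro allI impI) (rule main)
qed

end
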